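(* Let $\Gamma$ be an ordered group, let $\Lambda\subseteq\Gamma$ be a subset with a greatest element $0$, and let $FR$ be a $\Gamma$-filtered ring. The conflation structure on $\operatorname{NGlid}_\Lambda FR$ induced by the embedding $\operatorname{NGlid}_\Lambda FR\to\operatorname{Glid}_\Lambda FR$ gives $\operatorname{NGlid}_\Lambda FR$ the structure of a deflation-exact category.
   Context: Rings are unital. An ordered group $(\Gamma,\le)$ is a group with a (partial) order such that $\alpha\le\beta$ and $\gamma\le\delta$ imply $\alpha\gamma\le\beta\delta$; its unit is $e$. A $\Gamma$-filtered ring $FR$ is a ring $R$ with additive subgroups $\{F_\gamma R\}_{\gamma\in\Gamma}$ such that $1_R\in F_eR$, $F_\alpha R\subseteq F_\beta R$ if $\alpha\le\beta$, and $(F_\alpha R)(F_\beta R)\subseteq F_{\alpha\beta}R$. The preadditive category $\overline{\mathcal F}_\Lambda R$ has object set $\Lambda\sqcup\{\infty\}$; for $\alpha,\beta\in\Lambda$, $\operatorname{Hom}(\alpha,\beta)=F_{\beta\alpha^{-1}}R$ if $\alpha\le\beta$ and $0$ otherwise; $\operatorname{Hom}(\alpha,\infty)=R$ for all $\alpha\in\Lambda\sqcup\{\infty\}$; $\operatorname{Hom}(\infty,\alpha)=0$ for $\alpha\in\Lambda$; composition is multiplication in $R$. If $\alpha\le\beta$ or $\beta=\infty$, write $1_{\alpha,\beta}$ for $1_R\in\operatorname{Hom}(\alpha,\beta)$. $\operatorname{Mod}$ denotes additive covariant functors to abelian groups. $\operatorname{Preglid}_\Lambda FR\subseteq\operatorname{Mod}\overline{\mathcal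 F}_\Lambda R$ is the full subcategory of those $M$ for which all $M(1_{\alpha,\beta})$ are monomorphisms. With $\Sigma$ the class of its morphisms $f$ such that $f_\lambda$ is an isomorphism for all $\lambda\in\Lambda$, $\operatorname{Glid}_\Lambda FR=(\operatorname{Preglid}_\Lambda FR)[\Sigma^{-1}]$, with localization functor $Q$. A natural preglider is an object in the essential image of the right adjoint $n_*$ of the restriction functor $\operatorname{Preglid}_\Lambda FR\to\operatorname{Preglid}_{\{0\}}FR$ along $\{0,\infty\}\subseteq\Lambda\sqcup\{\infty\}$; explicitly, $n_*(M)(\infty)=M(\infty)$ and $n_*(M)(\lambda)=\{m\in M(\infty)\mid (F_{0\lambda^{-1}}R)\cdot m\subseteq\operatorname{im}M(1_{0,\infty})\}$ for $\lambda\in\Lambda$ (with $0\lambda^{-1}$ the product in $\Gamma$ of the element $0\in\Lambda$ and $\lambda^{-1}$). A natural glider is an object of $\operatorname{Glid}_\Lambda FR$ isomorphic to $Q(M)$ for a natural preglider $M$; $\operatorname{NGlid}_\Lambda FR\subseteq\operatorname{Glid}_\Lambda FR$ is the full subcategory of natural gliders. A deflation-exact category is an additive category with a class, closed under isomorphism, of kernel-cokernel pairs (conflations; the second map is called a deflation) such that $0\to0$ is a deflation, deflations are closed under composition, and pullbacks along deflations exist and deflations are stable under pullback. $\operatorname{Glid}_\Lambda FR$ is deflation-exact with all kernel-cokernel pairs as conflations. The induced conflation structure on $\operatorname{NGlid}_\Lambda FR$ consists of the sequences in $\operatorname{NGlid}_\Lambda FR$ that are conflations in $\operatorname{Glid}_\Lambda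 FR$. *)

theory Defs
  imports "HOL-Algebra.Algebra"
begin

section \<open>Categories\<close>

record ('o, 'm) category =
  Obj :: "'o set"
  Arr :: "'m set"
  Dom :: "'m \<Rightarrow> 'o"
  Cod :: "'m \<Rightarrow> 'o"
  Ident :: "'o \<Rightarrow> 'm"
  Cmp :: "'m \<Rightarrow> 'm \<Rightarrow> 'm"  (infixl \<open>\<bullet>\<index>\<close> 70)

definition homs :: "('o, 'm) category \<Rightarrow> 'o \<Rightarrow> 'o \<Rightarrow> 'm set" where
  "homs C A B = {f \<in> Arr C. Dom C f = A \<and> Cod C f = B}"

locale category =
  fixes C :: "('o, 'm) category" (structure)
  assumes dom_obj: "f \<in> Arr C \<Longrightarrow> Dom C f \<in> Obj C"
    and cod_obj: "f \<in> Arr C \<Longrightarrow> Cod C f \<in> Obj C"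
    and ident_hom: "A \<in> Obj C \<Longrightarrow> Ident C A \<in> homs C A A"
    and cmp_hom: "f \<in> homs C A B \<Longrightarrow> g \<in> homs C B D \<Longrightarrow> g \<bullet> f \<in> homs C A D"
    and cmp_ident_right: "f \<in> homs C A B \<Longrightarrow> f \<bullet> Ident C A = f"
    and cmp_ident_left: "f \<in> homs C A B \<Longrightarrow> Ident C B \<bullet> f = f"
    and cmp_assoc: "f \<in> homs C A B \<Longrightarrow> g \<in> homs C B D \<Longrightarrow> h \<in> homs C D E
      \<Longrightarrow> (h \<bullet> g) \<bullet> f = h \<bullet> (g \<bullet> f)"

definition iso_arr :: "('o, 'm) category \<Rightarrow> 'm \<Rightarrow> bool" where
  "iso_arr C f \<longleftrightarrow> f \<in> Arr C \<and> (\<exists>g \<in> homs C (Cod C f) (Dom C f).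
     g \<bullet>\<^bsub>C\<^esub> f = Ident C (Dom C f) \<and> f \<bullet>\<^bsub>C\<^esub> g = Ident C (Cod C f))"

definition isomorphic :: "('o, 'm) category \<Rightarrow> 'o \<Rightarrow> 'o \<Rightarrow> bool" where
  "isomorphic C A B \<longleftrightarrow> (\<exists>f \<in> homs C A B. iso_arr C f)"

definition full_subcategory :: "('o, 'm) category \<Rightarrow> 'o set \<Rightarrow> ('o, 'm) category" where
  "full_subcategory C S =
     C\<lparr>Obj := Obj C \<inter> S, Arr := {f \<in> Arr C. Dom C f \<in> S \<and> Cod C f \<in> S}\<rparr>"


section \<open>Additive and deflation-exact categories\<close>

text \<open>The second argument assigns to two objects the abelian group, written multiplicatively
  as a \<^typ>\<open>'m monoid\<close>, on the set of arrows between them.\<close>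

definition preadditive :: "('o, 'm) category \<Rightarrow> ('o \<Rightarrow> 'o \<Rightarrow> 'm monoid) \<Rightarrow> bool" where
  "preadditive C G \<longleftrightarrow> category C \<and>
     (\<forall>A \<in> Obj C. \<forall>B \<in> Obj C. comm_group (G A B) \<and> carrier (G A B) = homs C A B) \<and>
     (\<forall>A \<in> Obj C. \<forall>B \<in> Obj C. \<forall>D \<in> Obj C.
        \<forall>f \<in> homs C A B. \<forall>f' \<in> homs C A B. \<forall>g \<in> homs C B D. \<forall>g' \<in> homs C B D.
          g \<bullet>\<^bsub>C\<^esub> (f \<otimes>\<^bsub>G A B\<^esub> f') = (g \<bullet>\<^bsub>C\<^esub> f) \<otimes>\<^bsub>G A D\<^esub> (g \<bullet>\<^bsub>C\<^esub> f') \<and>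
          (g \<otimes>\<^bsub>G B D\<^esub> g') \<bullet>\<^bsub>C\<^esub> f = (g \<bullet>\<^bsub>C\<^esub> f) \<otimes>\<^bsub>G A D\<^esub> (g' \<bullet>\<^bsub>C\<^esub> f))"

definition zero_object :: "('o, 'm) category \<Rightarrow> 'o \<Rightarrow> bool" where
  "zero_object C Z \<longleftrightarrow> Z \<in> Obj C \<and>
     (\<forall>A \<in> Obj C. (\<exists>!f. f \<in> homs C A Z) \<and> (\<exists>!f. f \<in> homs C Z A))"

definition zero_arr :: "('o, 'm) category \<Rightarrow> 'm \<Rightarrow> bool" where
  "zero_arr C f \<longleftrightarrow> f \<in> Arr C \<and> (\<exists>Z. zero_object C Z \<and>
     (\<exists>g \<in> homs C (Dom C f) Z. \<exists>h \<in> homs C Z (Cod C f). f = h \<bullet>\<^bsub>C\<^esub> g))"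

definition biproduct ::
  "('o, 'm) category \<Rightarrow> ('o \<Rightarrow> 'o \<Rightarrow> 'm monoid) \<Rightarrow> 'o \<Rightarrow> 'o \<Rightarrow> 'o \<Rightarrow> bool" where
  "biproduct C G A B P \<longleftrightarrow> P \<in> Obj C \<and>
     (\<exists>i \<in> homs C A P. \<exists>j \<in> homs C B P. \<exists>p \<in> homs C P A. \<exists>q \<in> homs C P B.
        p \<bullet>\<^bsub>C\<^esub> i = Ident C A \<and> q \<bullet>\<^bsub>C\<^esub> j = Ident C B \<and>
        q \<bullet>\<^bsub>C\<^esub> i = \<one>\<^bsub>G A B\<^esub> \<and> p \<bullet>\<^bsub>C\<^esub> j = \<one>\<^bsub>G B A\<^esub> \<and>
        (i \<bullet>\<^bsub>C\<^esub> p) \<otimes>\<^bsub>G P P\<^esub> (j \<bullet>\<^bsub>C\<^esub> q) = Ident C P)"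

definition additive_category :: "('o, 'm) category \<Rightarrow> bool" where
  "additive_category C \<longleftrightarrow> (\<exists>G. preadditive C G \<and> (\<exists>Z. zero_object C Z) \<and>
     (\<forall>A \<in> Obj C. \<forall>B \<in> Obj C. \<exists>P. biproduct C G A B P))"

definition is_kernel :: "('o, 'm) category \<Rightarrow> 'm \<Rightarrow> 'm \<Rightarrow> bool" where
  "is_kernel C k f \<longleftrightarrow> k \<in> Arr C \<and> f \<in> Arr C \<and> Cod C k = Dom C f \<and> zero_arr C (f \<bullet>\<^bsub>C\<^esub> k) \<and>
     (\<forall>h \<in> Arr C. Cod C h = Dom C f \<and> zero_arr C (f \<bullet>\<^bsub>C\<^esub> h)
        \<longrightarrow> (\<exists>!u. u \<in> homs C (Dom C h) (Dom C k) \<and> k \<bullet>\<^bsub>C\<^esub> u = h))"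

definition is_cokernel :: "('o, 'm) category \<Rightarrow> 'm \<Rightarrow> 'm \<Rightarrow> bool" where
  "is_cokernel C c f \<longleftrightarrow> c \<in> Arr C \<and> f \<in> Arr C \<and> Dom C c = Cod C f \<and> zero_arr C (c \<bullet>\<^bsub>C\<^esub> f) \<and>
     (\<forall>h \<in> Arr C. Dom C h = Cod C f \<and> zero_arr C (h \<bullet>\<^bsub>C\<^esub> f)
        \<longrightarrow> (\<exists>!u. u \<in> homs C (Cod C c) (Cod C h) \<and> u \<bullet>\<^bsub>C\<^esub> c = h))"

definition kernel_cokernel_pairs :: "('o, 'm) category \<Rightarrow> ('m \<times> 'm) set" where
  "kernel_cokernel_pairs C = {(i, p). is_kernel C i p \<and> is_cokernel C p i}"

text \<open>The square with \<open>p : X \<rightarrow> Z\<close>, \<open>f : Y \<rightarrow> Z\<close>, \<open>p' : P \<rightarrow> Y\<close>, \<open>f' : P \<rightarrow> X\<close>.\<close>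

definition is_pullback :: "('o, 'm) category \<Rightarrow> 'm \<Rightarrow> 'm \<Rightarrow> 'm \<Rightarrow> 'm \<Rightarrow> bool" where
  "is_pullback C p f p' f' \<longleftrightarrow>
     p \<in> Arr C \<and> f \<in> Arr C \<and> p' \<in> Arr C \<and> f' \<in> Arr C \<and>
     Cod C p = Cod C f \<and> Dom C p' = Dom C f' \<and> Cod C p' = Dom C f \<and> Cod C f' = Dom C p \<and>
     p \<bullet>\<^bsub>C\<^esub> f' = f \<bullet>\<^bsub>C\<^esub> p' \<and>
     (\<forall>a \<in> Arr C. \<forall>b \<in> Arr C. Dom C a = Dom C b \<and> Cod C a = Dom C p \<and> Cod C b = Dom C f \<and>
        p \<bullet>\<^bsub>C\<^esub> a = f \<bullet>\<^bsub>C\<^esub> b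
        \<longrightarrow> (\<exists>!u. u \<in> homs C (Dom C a) (Dom C p') \<and> f' \<bullet>\<^bsub>C\<^esub> u = a \<and> p' \<bullet>\<^bsub>C\<^esub> u = b))"

definition deflation :: "('m \<times> 'm) set \<Rightarrow> 'm \<Rightarrow> bool" where
  "deflation E p \<longleftrightarrow> (\<exists>i. (i, p) \<in> E)"

locale deflation_exact_category =
  fixes C :: "('o, 'm) category" (structure) and E :: "('m \<times> 'm) set"
  assumes additive: "additive_category C"
    and conflation_pairs: "E \<subseteq> kernel_cokernel_pairs C"
    and conflation_iso: "\<lbrakk>(i, p) \<in> E; i' \<in> Arr C; p' \<in> Arr C; Cod C i' = Dom C p';
        a \<in> homs C (Dom C i) (Dom C i'); b \<in> homs C (Dom C p) (Dom C p');
        c \<in> homs C (Cod C p) (Cod C p');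
        iso_arr C a; iso_arr C b; iso_arr C c; b \<bullet> i = i' \<bullet> a; c \<bullet> p = p' \<bullet> b\<rbrakk>
      \<Longrightarrow> (i', p') \<in> E"
    and deflation_zero: "zero_object C Z \<Longrightarrow> deflation E (Ident C Z)"
    and deflation_cmp: "\<lbrakk>deflation E p; deflation E q; Cod C p = Dom C q\<rbrakk>
      \<Longrightarrow> deflation E (q \<bullet> p)"
    and deflation_pullback_ex: "\<lbrakk>deflation E p; f \<in> Arr C; Cod C f = Cod C p\<rbrakk>
      \<Longrightarrow> \<exists>p' f'. is_pullback C p f p' f'"
    and deflation_pullback: "\<lbrakk>deflation E p; is_pullback C p f p' f'\<rbrakk> \<Longrightarrow> deflation E p'"


section \<open>Localization\<close>

text \<open>The Gabriel--Zisman construction of the localization of \<open>C\<close> at a class \<open>S\<close> of arrows: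
  the objects are those of \<open>C\<close>, and the arrows are zigzags of arrows of \<open>C\<close> and formal
  inverses of arrows in \<open>S\<close>, modulo the congruence generated by the composition of \<open>C\<close> and
  by the requirement that \<open>Bwd s\<close> be inverse to \<open>Fwd s\<close>.  Zigzags are read in the order in which
  they are traversed.  The localization functor is the identity on objects and maps \<open>f\<close>
  to the class of \<open>[Fwd f]\<close>.\<close>

datatype 'm step = Fwd 'm | Bwd 'm

inductive zigzag :: "('o, 'm) category \<Rightarrow> 'm set \<Rightarrow> 'o \<Rightarrow> 'm step list \<Rightarrow> 'o \<Rightarrow> bool"
  for C S where
  empty: "A \<in> Obj C \<Longrightarrow> zigzag C S A [] A"
| fwd: "f \<in> homs C A B \<Longrightarrow> zigzag C S B w D \<Longrightarrow> zigzag C S A (Fwd f # w) D"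
| bwd: "s \<in> S \<Longrightarrow> s \<in> homs C B A \<Longrightarrow> zigzag C S B w D \<Longrightarrow> zigzag C S A (Bwd s # w) D"

inductive zigzag_eq ::
  "('o, 'm) category \<Rightarrow> 'm set \<Rightarrow> 'o \<Rightarrow> 'm step list \<Rightarrow> 'm step list \<Rightarrow> 'o \<Rightarrow> bool"
  for C S where
  refl: "zigzag C S A w B \<Longrightarrow> zigzag_eq C S A w w B"
| sym: "zigzag_eq C S A v w B \<Longrightarrow> zigzag_eq C S A w v B"
| trans: "zigzag_eq C S A u v B \<Longrightarrow> zigzag_eq C S A v w B \<Longrightarrow> zigzag_eq C S A u w B"
| append: "zigzag_eq C S A v w B \<Longrightarrow> zigzag_eq C S B v' w' D
    \<Longrightarrow> zigzag_eq C S A (v @ v') (w @ w') D"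
| ident: "A \<in> Obj C \<Longrightarrow> zigzag_eq C S A [Fwd (Ident C A)] [] A"
| cmp: "f \<in> homs C A B \<Longrightarrow> g \<in> homs C B D
    \<Longrightarrow> zigzag_eq C S A [Fwd f, Fwd g] [Fwd (g \<bullet>\<^bsub>C\<^esub> f)] D"
| fwd_bwd: "s \<in> S \<Longrightarrow> s \<in> homs C A B \<Longrightarrow> zigzag_eq C S A [Fwd s, Bwd s] [] A"
| bwd_fwd: "s \<in> S \<Longrightarrow> s \<in> homs C A B \<Longrightarrow> zigzag_eq C S B [Bwd s, Fwd s] [] B"

type_synonym ('o, 'm) frac = "'o \<times> 'm step list set \<times> 'o"

definition zigzag_class ::
  "('o, 'm) category \<Rightarrow> 'm set \<Rightarrow> 'o \<Rightarrow> 'm step list \<Rightarrow> 'o \<Rightarrow> ('o, 'm) frac" where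
  "zigzag_class C S A w B = (A, {v. zigzag_eq C S A w v B}, B)"

definition localization :: "('o, 'm) category \<Rightarrow> 'm set \<Rightarrow> ('o, ('o, 'm) frac) category" where
  "localization C S =
     \<lparr>Obj = Obj C,
      Arr = {zigzag_class C S A w B | A w B. zigzag C S A w B},
      Dom = (\<lambda>(A, W, B). A),
      Cod = (\<lambda>(A, W, B). B),
      Ident = (\<lambda>A. zigzag_class C S A [] A),
      Cmp = (\<lambda>(B', W, D) (A, V, B).
        (A, {u. \<exists>v \<in> V. \<exists>w \<in> W. zigzag_eq C S A (v @ w) u D}, D))\<rparr>"


section \<open>Modules over a preadditive category\<close>

text \<open>Abelian groups are multiplicative HOL-Algebra groups whose carrier is a subset of the type
  \<open>'u\<close>, which plays the role of the universe.  The values of the fields outside of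
  the objects, arrows and carriers are irrelevant: two functors that differ only there are
  isomorphic by the identity.\<close>

record ('o, 'm, 'u) abfun =
  Fob :: "'o \<Rightarrow> 'u monoid"
  Fmap :: "'m \<Rightarrow> 'u \<Rightarrow> 'u"

definition additive_functor ::
  "('o, 'm) category \<Rightarrow> ('o \<Rightarrow> 'o \<Rightarrow> 'm monoid) \<Rightarrow> ('o, 'm, 'u) abfun \<Rightarrow> bool" where
  "additive_functor C G M \<longleftrightarrow>
     (\<forall>A \<in> Obj C. comm_group (Fob M A)) \<and>
     (\<forall>f \<in> Arr C. Fmap M f \<in> hom (Fob M (Dom C f)) (Fob M (Cod C f))) \<and>
     (\<forall>A \<in> Obj C. \<forall>m \<in> carrier (Fob M A). Fmap M (Ident C A) m = m) \<and>
     (\<forall>f \<in> Arr C. \<forall>g \<in> Arr C. Cod C f = Dom C g \<longrightarrow>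
        (\<forall>m \<in> carrier (Fob M (Dom C f)). Fmap M (g \<bullet>\<^bsub>C\<^esub> f) m = Fmap M g (Fmap M f m))) \<and>
     (\<forall>A \<in> Obj C. \<forall>B \<in> Obj C. \<forall>f \<in> homs C A B. \<forall>g \<in> homs C A B.
        \<forall>m \<in> carrier (Fob M A).
          Fmap M (f \<otimes>\<^bsub>G A B\<^esub> g) m = Fmap M f m \<otimes>\<^bsub>Fob M B\<^esub> Fmap M g m)"

type_synonym ('o, 'm, 'u) nat_arr =
  "('o, 'm, 'u) abfun \<times> ('o \<Rightarrow> 'u \<Rightarrow> 'u) \<times> ('o, 'm, 'u) abfun"

definition nat_trans ::
  "('o, 'm) category \<Rightarrow> ('o, 'm, 'u) abfun \<Rightarrow> ('o, 'm, 'u) abfun \<Rightarrow> ('o \<Rightarrow> 'u \<Rightarrow> 'u) set" where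
  "nat_trans C M N =
     {\<eta> \<in> extensional (Obj C).
        (\<forall>A \<in> Obj C. \<eta> A \<in> hom (Fob M A) (Fob N A) \<inter> extensional (carrier (Fob M A))) \<and>
        (\<forall>f \<in> Arr C. \<forall>m \<in> carrier (Fob M (Dom C f)).
           \<eta> (Cod C f) (Fmap M f m) = Fmap N f (\<eta> (Dom C f) m))}"

definition AddMod ::
  "('o, 'm) category \<Rightarrow> ('o \<Rightarrow> 'o \<Rightarrow> 'm monoid)
     \<Rightarrow> (('o, 'm, 'u) abfun, ('o, 'm, 'u) nat_arr) category" where
  "AddMod C G =
     \<lparr>Obj = {M. additive_functor C G M},
      Arr = {(M, \<eta>, N) | M \<eta> N.
        additive_functor C G M \<and> additive_functor C G N \<and> \<eta> \<in> nat_trans C M N},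
      Dom = (\<lambda>(M, \<eta>, N). M),
      Cod = (\<lambda>(M, \<eta>, N). N),
      Ident = (\<lambda>M. (M, (\<lambda>A \<in> Obj C. \<lambda>m \<in> carrier (Fob M A). m), M)),
      Cmp = (\<lambda>(N', \<theta>, P) (M, \<eta>, N).
        (M, (\<lambda>A \<in> Obj C. compose (carrier (Fob M A)) (\<theta> A) (\<eta> A)), P))\<rparr>"


section \<open>Filtered rings\<close>

locale ordered_group = group \<Gamma> for \<Gamma> :: "('g, 'a) monoid_scheme" (structure) +
  fixes leq :: "('g \<times> 'g) set"
  assumes partial_order: "partial_order_on (carrier \<Gamma>) leq"
    and mult_mono: "(\<alpha>, \<beta>) \<in> leq \<Longrightarrow> (\<gamma>, \<delta>) \<in> leq \<Longrightarrow> (\<alpha> \<otimes> \<gamma>, \<beta> \<otimes> \<delta>) \<in> leq"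

locale filtered_ring = ordered_group \<Gamma> leq + R: ring R
  for \<Gamma> :: "('g, 'a) monoid_scheme" and leq :: "('g \<times> 'g) set"
    and R :: "('r, 'b) ring_scheme" +
  fixes F :: "'g \<Rightarrow> 'r set"
  assumes filt_subgroup: "\<gamma> \<in> carrier \<Gamma> \<Longrightarrow> additive_subgroup (F \<gamma>) R"
    and filt_one: "\<one>\<^bsub>R\<^esub> \<in> F \<one>\<^bsub>\<Gamma>\<^esub>"
    and filt_mono: "(\<alpha>, \<beta>) \<in> leq \<Longrightarrow> F \<alpha> \<subseteq> F \<beta>"
    and filt_mult: "\<alpha> \<in> carrier \<Gamma> \<Longrightarrow> \<beta> \<in> carrier \<Gamma> \<Longrightarrow> x \<in> F \<alpha> \<Longrightarrow> y \<in> F \<beta>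
      \<Longrightarrow> x \<otimes>\<^bsub>R\<^esub> y \<in> F (\<alpha> \<otimes>\<^bsub>\<Gamma>\<^esub> \<beta>)"

datatype 'g point = Pt 'g | Infty

type_synonym ('g, 'r) filt_arr = "'g point \<times> 'r \<times> 'g point"

fun filt_homs ::
  "('g, 'a) monoid_scheme \<Rightarrow> ('g \<times> 'g) set \<Rightarrow> ('r, 'b) ring_scheme \<Rightarrow> ('g \<Rightarrow> 'r set)
     \<Rightarrow> 'g point \<Rightarrow> 'g point \<Rightarrow> 'r set" where
  "filt_homs \<Gamma> leq R F (Pt \<alpha>) (Pt \<beta>) =
     (if (\<alpha>, \<beta>) \<in> leq then F (\<beta> \<otimes>\<^bsub>\<Gamma>\<^esub> inv\<^bsub>\<Gamma>\<^esub> \<alpha>) else {\<zero>\<^bsub>R\<^esub>})"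
| "filt_homs \<Gamma> leq R F x Infty = carrier R"
| "filt_homs \<Gamma> leq R F Infty (Pt \<alpha>) = {\<zero>\<^bsub>R\<^esub>}"

definition filt_cat ::
  "('g, 'a) monoid_scheme \<Rightarrow> ('g \<times> 'g) set \<Rightarrow> ('r, 'b) ring_scheme \<Rightarrow> ('g \<Rightarrow> 'r set)
     \<Rightarrow> 'g set \<Rightarrow> ('g point, ('g, 'r) filt_arr) category" where
  "filt_cat \<Gamma> leq R F \<Lambda> =
     \<lparr>Obj = insert Infty (Pt ` \<Lambda>),
      Arr = {(x, r, y) | x r y. x \<in> insert Infty (Pt ` \<Lambda>) \<and> y \<in> insert Infty (Pt ` \<Lambda>) \<and>
        r \<in> filt_homs \<Gamma> leq R F x y},
      Dom = (\<lambda>(x, r, y). x),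
      Cod = (\<lambda>(x, r, y). y),
      Ident = (\<lambda>x. (x, \<one>\<^bsub>R\<^esub>, x)),
      Cmp = (\<lambda>(y', s, z) (x, r, y). (x, s \<otimes>\<^bsub>R\<^esub> r, z))\<rparr>"

definition filt_add ::
  "('g, 'a) monoid_scheme \<Rightarrow> ('g \<times> 'g) set \<Rightarrow> ('r, 'b) ring_scheme \<Rightarrow> ('g \<Rightarrow> 'r set)
     \<Rightarrow> 'g point \<Rightarrow> 'g point \<Rightarrow> ('g, 'r) filt_arr monoid" where
  "filt_add \<Gamma> leq R F x y =
     \<lparr>carrier = {(x, r, y) | r. r \<in> filt_homs \<Gamma> leq R F x y},
      monoid.mult = (\<lambda>(_, r, _) (_, s, _). (x, r \<oplus>\<^bsub>R\<^esub> s, y)),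
      one = (x, \<zero>\<^bsub>R\<^esub>, y)\<rparr>"


section \<open>Pregliders, gliders, and natural gliders\<close>

type_synonym ('g, 'r, 'u) filt_mod = "('g point, ('g, 'r) filt_arr, 'u) abfun"
type_synonym ('g, 'r, 'u) filt_mod_arr = "('g point, ('g, 'r) filt_arr, 'u) nat_arr"
type_synonym ('g, 'r, 'u) glid_arr =
  "(('g, 'r, 'u) filt_mod, ('g, 'r, 'u) filt_mod_arr) frac"

definition Preglid ::
  "('g, 'a) monoid_scheme \<Rightarrow> ('g \<times> 'g) set \<Rightarrow> ('r, 'b) ring_scheme \<Rightarrow> ('g \<Rightarrow> 'r set)
     \<Rightarrow> 'g set \<Rightarrow> (('g, 'r, 'u) filt_mod, ('g, 'r, 'u) filt_mod_arr) category" where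
  "Preglid \<Gamma> leq R F \<Lambda> =
     full_subcategory (AddMod (filt_cat \<Gamma> leq R F \<Lambda>) (filt_add \<Gamma> leq R F))
       {M. (\<forall>\<alpha> \<in> \<Lambda>. \<forall>\<beta> \<in> \<Lambda>. (\<alpha>, \<beta>) \<in> leq \<longrightarrow>
              Fmap M (Pt \<alpha>, \<one>\<^bsub>R\<^esub>, Pt \<beta>) \<in> mon (Fob M (Pt \<alpha>)) (Fob M (Pt \<beta>))) \<and>
           (\<forall>x \<in> insert Infty (Pt ` \<Lambda>).
              Fmap M (x, \<one>\<^bsub>R\<^esub>, Infty) \<in> mon (Fob M x) (Fob M Infty))}"

definition preglid_weq ::
  "('g, 'a) monoid_scheme \<Rightarrow> ('g \<times> 'g) set \<Rightarrow> ('r, 'b) ring_scheme \<Rightarrow> ('g \<Rightarrow> 'r set)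
     \<Rightarrow> 'g set \<Rightarrow> ('g, 'r, 'u) filt_mod_arr set" where
  "preglid_weq \<Gamma> leq R F \<Lambda> =
     {(M, \<eta>, N) \<in> Arr (Preglid \<Gamma> leq R F \<Lambda>).
        \<forall>\<alpha> \<in> \<Lambda>. \<eta> (Pt \<alpha>) \<in> iso (Fob M (Pt \<alpha>)) (Fob N (Pt \<alpha>))}"

definition Glid ::
  "('g, 'a) monoid_scheme \<Rightarrow> ('g \<times> 'g) set \<Rightarrow> ('r, 'b) ring_scheme \<Rightarrow> ('g \<Rightarrow> 'r set)
     \<Rightarrow> 'g set \<Rightarrow> (('g, 'r, 'u) filt_mod, ('g, 'r, 'u) glid_arr) category" where
  "Glid \<Gamma> leq R F \<Lambda> = localization (Preglid \<Gamma> leq R F \<Lambda>) (preglid_weq \<Gamma> leq R F \<Lambda>)"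

text \<open>In the following, \<open>z\<close> is the greatest element of \<open>\<Lambda>\<close>.  The functor \<open>n\<^sub>*\<close> on
  objects; that it is right adjoint to the restriction functor is shown in
  \<open>nat_preglid_couniversal\<close>.\<close>

definition nat_preglid ::
  "('g, 'a) monoid_scheme \<Rightarrow> ('r, 'b) ring_scheme \<Rightarrow> ('g \<Rightarrow> 'r set) \<Rightarrow> 'g
     \<Rightarrow> ('g, 'r, 'u) filt_mod \<Rightarrow> ('g, 'r, 'u) filt_mod" where
  "nat_preglid \<Gamma> R F z M =
     \<lparr>Fob = (\<lambda>x. case x of
        Infty \<Rightarrow> Fob M Infty
      | Pt \<alpha> \<Rightarrow> (Fob M Infty)
          \<lparr>carrier := {m \<in> carrier (Fob M Infty). \<forall>r \<in> F (z \<otimes>\<^bsub>\<Gamma>\<^esub> inv\<^bsub>\<Gamma>\<^esub> \<alpha>).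
             Fmap M (Infty, r, Infty) m \<in> Fmap M (Pt z, \<one>\<^bsub>R\<^esub>, Infty) ` carrier (Fob M (Pt z))}\<rparr>),
      Fmap = (\<lambda>(x, r, y). Fmap M (Infty, r, Infty))\<rparr>"

definition natural_pregliders ::
  "('g, 'a) monoid_scheme \<Rightarrow> ('g \<times> 'g) set \<Rightarrow> ('r, 'b) ring_scheme \<Rightarrow> ('g \<Rightarrow> 'r set)
     \<Rightarrow> 'g set \<Rightarrow> 'g \<Rightarrow> ('g, 'r, 'u) filt_mod set" where
  "natural_pregliders \<Gamma> leq R F \<Lambda> z =
     {N \<in> Obj (Preglid \<Gamma> leq R F \<Lambda>). \<exists>M \<in> Obj (Preglid \<Gamma> leq R F {z}).
        isomorphic (Preglid \<Gamma> leq R F \<Lambda>) N (nat_preglid \<Gamma> R F z M)}"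

definition natural_gliders ::
  "('g, 'a) monoid_scheme \<Rightarrow> ('g \<times> 'g) set \<Rightarrow> ('r, 'b) ring_scheme \<Rightarrow> ('g \<Rightarrow> 'r set)
     \<Rightarrow> 'g set \<Rightarrow> 'g \<Rightarrow> ('g, 'r, 'u) filt_mod set" where
  "natural_gliders \<Gamma> leq R F \<Lambda> z =
     {N \<in> Obj (Glid \<Gamma> leq R F \<Lambda>). \<exists>M \<in> natural_pregliders \<Gamma> leq R F \<Lambda> z.
        isomorphic (Glid \<Gamma> leq R F \<Lambda>) N M}"

definition NGlid ::
  "('g, 'a) monoid_scheme \<Rightarrow> ('g \<times> 'g) set \<Rightarrow> ('r, 'b) ring_scheme \<Rightarrow> ('g \<Rightarrow> 'r set)
     \<Rightarrow> 'g set \<Rightarrow> 'g \<Rightarrow> (('g, 'r, 'u) filt_mod, ('g, 'r, 'u) glid_arr) category" where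
  "NGlid \<Gamma> leq R F \<Lambda> z =
     full_subcategory (Glid \<Gamma> leq R F \<Lambda>) (natural_gliders \<Gamma> leq R F \<Lambda> z)"

definition glid_conflations ::
  "('g, 'a) monoid_scheme \<Rightarrow> ('g \<times> 'g) set \<Rightarrow> ('r, 'b) ring_scheme \<Rightarrow> ('g \<Rightarrow> 'r set)
     \<Rightarrow> 'g set \<Rightarrow> (('g, 'r, 'u) glid_arr \<times> ('g, 'r, 'u) glid_arr) set" where
  "glid_conflations \<Gamma> leq R F \<Lambda> = kernel_cokernel_pairs (Glid \<Gamma> leq R F \<Lambda>)"

definition nglid_conflations ::
  "('g, 'a) monoid_scheme \<Rightarrow> ('g \<times> 'g) set \<Rightarrow> ('r, 'b) ring_scheme \<Rightarrow> ('g \<Rightarrow> 'r set)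
     \<Rightarrow> 'g set \<Rightarrow> 'g \<Rightarrow> (('g, 'r, 'u) glid_arr \<times> ('g, 'r, 'u) glid_arr) set" where
  "nglid_conflations \<Gamma> leq R F \<Lambda> z = {(i, p) \<in> glid_conflations \<Gamma> leq R F \<Lambda>.
     i \<in> Arr (NGlid \<Gamma> leq R F \<Lambda> z) \<and> p \<in> Arr (NGlid \<Gamma> leq R F \<Lambda> z)}"


section \<open>The right adjoint of the restriction functor\<close>

text \<open>A functor on \<open>filt_cat \<Gamma> leq R F \<Lambda>\<close> is restricted to a full subcategory by reading the
  same record over fewer objects, so that restriction is the identity on the representing records
  and only acts on arrows.\<close>

definition preglid_restrict ::
  "'g set \<Rightarrow> ('g, 'r, 'u) filt_mod_arr \<Rightarrow> ('g, 'r, 'u) filt_mod_arr" where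
  "preglid_restrict \<Lambda> = (\<lambda>(M, \<eta>, N). (M, restrict \<eta> (insert Infty (Pt ` \<Lambda>)), N))"

lemma Preglid_simps:
  "Dom (Preglid \<Gamma> leq R F \<Lambda>) = (\<lambda>(M, \<eta>, N). M)"
  "Cod (Preglid \<Gamma> leq R F \<Lambda>) = (\<lambda>(M, \<eta>, N). N)"
  "Ident (Preglid \<Gamma> leq R F \<Lambda>) = Ident (AddMod (filt_cat \<Gamma> leq R F \<Lambda>) (filt_add \<Gamma> leq R F))"
  "Cmp (Preglid \<Gamma> leq R F \<Lambda>) = Cmp (AddMod (filt_cat \<Gamma> leq R F \<Lambda>) (filt_add \<Gamma> leq R F))"
  by (simp_all add: Preglid_def full_subcategory_def AddMod_def)

lemma filt_cat_Arr_ball: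
  "(\<forall>f \<in> Arr (filt_cat \<Gamma> leq R F \<Lambda>). Q f) \<longleftrightarrow>
    (\<forall>x \<in> insert Infty (Pt ` \<Lambda>). \<forall>y \<in> insert Infty (Pt ` \<Lambda>).
       \<forall>r \<in> filt_homs \<Gamma> leq R F x y. Q (x, r, y))"
  unfolding filt_cat_def category.simps by blast

lemma filt_cat_simps:
  "Dom (filt_cat \<Gamma> leq R F \<Lambda>) (x, r, y) = x"
  "Cod (filt_cat \<Gamma> leq R F \<Lambda>) (x, r, y) = y"
  by (simp_all add: filt_cat_def)

lemma Preglid_Obj_iff:
  fixes M :: "('g, 'r, 'u) filt_mod"
  defines "P \<equiv> \<lambda>\<Lambda>. insert Infty (Pt ` \<Lambda>)"
  shows "M \<in> Obj (Preglid \<Gamma> leq R F \<Lambda>) \<longleftrightarrow>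
    (\<forall>x \<in> P \<Lambda>. comm_group (Fob M x)) \<and>
    (\<forall>x \<in> P \<Lambda>. \<forall>y \<in> P \<Lambda>. \<forall>r \<in> filt_homs \<Gamma> leq R F x y.
       Fmap M (x, r, y) \<in> hom (Fob M x) (Fob M y)) \<and>
    (\<forall>x \<in> P \<Lambda>. \<forall>m \<in> carrier (Fob M x). Fmap M (x, \<one>\<^bsub>R\<^esub>, x) m = m) \<and>
    (\<forall>x \<in> P \<Lambda>. \<forall>y \<in> P \<Lambda>. \<forall>w \<in> P \<Lambda>. \<forall>r \<in> filt_homs \<Gamma> leq R F x y. \<forall>s \<in> filt_homs \<Gamma> leq R F y w.
       \<forall>m \<in> carrier (Fob M x). Fmap M (x, s \<otimes>\<^bsub>R\<^esub> r, w) m = Fmap M (y, s, w) (Fmap M (x, r, y) m)) \<and>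
    (\<forall>x \<in> P \<Lambda>. \<forall>y \<in> P \<Lambda>. \<forall>r \<in> filt_homs \<Gamma> leq R F x y. \<forall>s \<in> filt_homs \<Gamma> leq R F x y.
       \<forall>m \<in> carrier (Fob M x). Fmap M (x, r \<oplus>\<^bsub>R\<^esub> s, y) m
         = Fmap M (x, r, y) m \<otimes>\<^bsub>Fob M y\<^esub> Fmap M (x, s, y) m) \<and>
    (\<forall>\<alpha> \<in> \<Lambda>. \<forall>\<beta> \<in> \<Lambda>. (\<alpha>, \<beta>) \<in> leq \<longrightarrow>
       Fmap M (Pt \<alpha>, \<one>\<^bsub>R\<^esub>, Pt \<beta>) \<in> mon (Fob M (Pt \<alpha>)) (Fob M (Pt \<beta>))) \<and>
    (\<forall>x \<in> P \<Lambda>. Fmap M (x, \<one>\<^bsub>R\<^esub>, Infty) \<in> mon (Fob M x) (Fob M Infty))"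
    (is "?L \<longleftrightarrow> ?A \<and> ?B \<and> ?C \<and> ?D \<and> ?E \<and> ?G \<and> ?H")
proof -
  let ?K = "filt_cat \<Gamma> leq R F \<Lambda>"
  have O: "Obj ?K = P \<Lambda>" by (simp add: filt_cat_def P_def)
  have B: "(\<forall>f \<in> Arr ?K. Fmap M f \<in> hom (Fob M (Dom ?K f)) (Fob M (Cod ?K f))) = ?B"
    unfolding filt_cat_Arr_ball filt_cat_simps P_def ..
  have C: "(\<forall>A \<in> Obj ?K. \<forall>m \<in> carrier (Fob M A). Fmap M (Ident ?K A) m = m) = ?C"
    by (simp add: filt_cat_def P_def)
  have D: "(\<forall>f \<in> Arr ?K. \<forall>g \<in> Arr ?K. Cod ?K f = Dom ?K g \<longrightarrow>
        (\<forall>m \<in> carrier (Fob M (Dom ?K f)). Fmap M (g \<bullet>\<^bsub>?K\<^esub> f) m = Fmap M g (Fmap M f m))) = ?D"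
    (is "?D1 = ?D2")
  proof (rule iffI)
    assume D1: ?D1
    show ?D2
    proof (intro ballI)
      fix x y w r s m
      assume "x \<in> P \<Lambda>" "y \<in> P \<Lambda>" "w \<in> P \<Lambda>" "r \<in> filt_homs \<Gamma> leq R F x y"
        "s \<in> filt_homs \<Gamma> leq R F y w" "m \<in> carrier (Fob M x)"
      then show "Fmap M (x, s \<otimes>\<^bsub>R\<^esub> r, w) m = Fmap M (y, s, w) (Fmap M (x, r, y) m)"
        using D1[rule_format, of "(x,r,y)" "(y,s,w)" m] by (simp add: filt_cat_def P_def)
    qed
  next
    assume D2: ?D2
    show ?D1
    proof (intro ballI impI)
      fix f g m assume f: "f \<in> Arr ?K" and g: "g \<in> Arr ?K" and fg: "Cod ?K f = Dom ?K g"
        and m: "m \<in> carrier (Fob M (Dom ?K f))"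
      obtain x r y where f': "f = (x, r, y)" by (cases f)
      obtain y' s w where g': "g = (y', s, w)" by (cases g)
      show "Fmap M (g \<bullet>\<^bsub>?K\<^esub> f) m = Fmap M g (Fmap M f m)"
        using f g fg m D2[rule_format, of x y w r s m] unfolding f' g' by (simp add: filt_cat_def P_def)
    qed
  qed
  have E: "(\<forall>A \<in> Obj ?K. \<forall>B \<in> Obj ?K. \<forall>f \<in> homs ?K A B. \<forall>g \<in> homs ?K A B.
        \<forall>m \<in> carrier (Fob M A).
          Fmap M (f \<otimes>\<^bsub>filt_add \<Gamma> leq R F A B\<^esub> g) m = Fmap M f m \<otimes>\<^bsub>Fob M B\<^esub> Fmap M g m) = ?E"
    (is "?D1 = ?D2")
  proof (rule iffI)
    assume D1: ?D1
    show ?D2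
    proof (intro ballI)
      fix x y r s m
      assume "x \<in> P \<Lambda>" "y \<in> P \<Lambda>" "r \<in> filt_homs \<Gamma> leq R F x y"
        "s \<in> filt_homs \<Gamma> leq R F x y" "m \<in> carrier (Fob M x)"
      then show "Fmap M (x, r \<oplus>\<^bsub>R\<^esub> s, y) m
         = Fmap M (x, r, y) m \<otimes>\<^bsub>Fob M y\<^esub> Fmap M (x, s, y) m"
        using D1[rule_format, of x y "(x,r,y)" "(x,s,y)" m]
        by (simp add: filt_cat_def P_def homs_def filt_add_def)
    qed
  next
    assume D2: ?D2
    show ?D1
    proof (intro ballI)
      fix x y f g m assume x: "x \<in> Obj ?K" and y: "y \<in> Obj ?K"
        and f: "f \<in> homs ?K x y" and g: "g \<in> homs ?K x y"
        and m: "m \<in> carrier (Fob M x)"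
      obtain r where f': "f = (x, r, y)" using f by (auto simp: homs_def filt_cat_def)
      obtain s where g': "g = (x, s, y)" using g by (auto simp: homs_def filt_cat_def)
      show "Fmap M (f \<otimes>\<^bsub>filt_add \<Gamma> leq R F x y\<^esub> g) m = Fmap M f m \<otimes>\<^bsub>Fob M y\<^esub> Fmap M g m"
        using f g m D2[rule_format, of x y r s m] unfolding f' g'
        by (simp add: filt_cat_def P_def homs_def filt_add_def)
    qed
  qed
  have L: "?L = (additive_functor ?K (filt_add \<Gamma> leq R F) M \<and> ?G \<and> ?H)"
    by (simp add: Preglid_def full_subcategory_def AddMod_def P_def)
  show ?thesis unfolding L additive_functor_def B C D E unfolding O by (simp only: conj_assoc)
qed

lemma Preglid_homs_iff:
  fixes M :: "('g, 'r, 'u) filt_mod"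
  defines "P \<equiv> \<lambda>\<Lambda>. insert Infty (Pt ` \<Lambda>)"
  shows "f \<in> homs (Preglid \<Gamma> leq R F \<Lambda>) M N \<longleftrightarrow> (\<exists>\<eta>. f = (M, \<eta>, N) \<and>
    M \<in> Obj (Preglid \<Gamma> leq R F \<Lambda>) \<and> N \<in> Obj (Preglid \<Gamma> leq R F \<Lambda>) \<and>
    \<eta> \<in> extensional (P \<Lambda>) \<and>
    (\<forall>x \<in> P \<Lambda>. \<eta> x \<in> hom (Fob M x) (Fob N x) \<inter> extensional (carrier (Fob M x))) \<and>
    (\<forall>x \<in> P \<Lambda>. \<forall>y \<in> P \<Lambda>. \<forall>r \<in> filt_homs \<Gamma> leq R F x y. \<forall>m \<in> carrier (Fob M x).
       \<eta> y (Fmap M (x, r, y) m) = Fmap N (x, r, y) (\<eta> x m)))"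
proof -
  let ?K = "filt_cat \<Gamma> leq R F \<Lambda>"
  have "\<eta> \<in> nat_trans ?K M N \<longleftrightarrow> 
    \<eta> \<in> extensional (P \<Lambda>) \<and>
    (\<forall>x \<in> P \<Lambda>. \<eta> x \<in> hom (Fob M x) (Fob N x) \<inter> extensional (carrier (Fob M x))) \<and>
    (\<forall>x \<in> P \<Lambda>. \<forall>y \<in> P \<Lambda>. \<forall>r \<in> filt_homs \<Gamma> leq R F x y. \<forall>m \<in> carrier (Fob M x).
       \<eta> y (Fmap M (x, r, y) m) = Fmap N (x, r, y) (\<eta> x m))" (is "_ \<longleftrightarrow> ?R \<eta>") for \<eta>
  proof -
    have "(\<forall>f \<in> Arr ?K. \<forall>m \<in> carrier (Fob M (Dom ?K f)).
           \<eta> (Cod ?K f) (Fmap M f m) = Fmap N f (\<eta> (Dom ?K f) m)) \<longleftrightarrow>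
       (\<forall>x \<in> P \<Lambda>. \<forall>y \<in> P \<Lambda>. \<forall>r \<in> filt_homs \<Gamma> leq R F x y. \<forall>m \<in> carrier (Fob M x).
       \<eta> y (Fmap M (x, r, y) m) = Fmap N (x, r, y) (\<eta> x m))"
      unfolding filt_cat_Arr_ball filt_cat_simps P_def ..
    moreover have "Obj ?K = P \<Lambda>" by (simp add: filt_cat_def P_def)
    ultimately show ?thesis unfolding nat_trans_def by simp
  qed
  then show ?thesis
    by (auto simp: homs_def Preglid_def full_subcategory_def AddMod_def)
qed

lemma Preglid_ObjD:
  assumes "M \<in> Obj (Preglid \<Gamma> leq R F \<Lambda>)" and "x \<in> insert Infty (Pt ` \<Lambda>)"
  shows "comm_group (Fob M x)"
    and "y \<in> insert Infty (Pt ` \<Lambda>) \<Longrightarrow> r \<in> filt_homs \<Gamma> leq R F x y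
      \<Longrightarrow> Fmap M (x, r, y) \<in> hom (Fob M x) (Fob M y)"
    and "m \<in> carrier (Fob M x) \<Longrightarrow> Fmap M (x, \<one>\<^bsub>R\<^esub>, x) m = m"
    and "y \<in> insert Infty (Pt ` \<Lambda>) \<Longrightarrow> w \<in> insert Infty (Pt ` \<Lambda>)
      \<Longrightarrow> r \<in> filt_homs \<Gamma> leq R F x y \<Longrightarrow> s \<in> filt_homs \<Gamma> leq R F y w \<Longrightarrow> m \<in> carrier (Fob M x)
      \<Longrightarrow> Fmap M (y, s, w) (Fmap M (x, r, y) m) = Fmap M (x, s \<otimes>\<^bsub>R\<^esub> r, w) m"
    and "y \<in> insert Infty (Pt ` \<Lambda>) \<Longrightarrow> r \<in> filt_homs \<Gamma> leq R F x y
      \<Longrightarrow> s \<in> filt_homs \<Gamma> leq R F x y \<Longrightarrow> m \<in> carrier (Fob M x)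
      \<Longrightarrow> Fmap M (x, r \<oplus>\<^bsub>R\<^esub> s, y) m = Fmap M (x, r, y) m \<otimes>\<^bsub>Fob M y\<^esub> Fmap M (x, s, y) m"
    and "Fmap M (x, \<one>\<^bsub>R\<^esub>, Infty) \<in> mon (Fob M x) (Fob M Infty)"
  using assms unfolding Preglid_Obj_iff
  by (simp_all del: ball_simps insert_iff filt_homs.simps)

lemma Obj_Preglid_subset:
  assumes "\<Lambda>' \<subseteq> \<Lambda>"
  shows "Obj (Preglid \<Gamma> leq R F \<Lambda>) \<subseteq> Obj (Preglid \<Gamma> leq R F \<Lambda>')"
proof -
  have P: "insert Infty (Pt ` \<Lambda>') \<subseteq> insert Infty (Pt ` \<Lambda>)" using assms by blast
  show ?thesis
    by (rule subsetI, unfold Preglid_Obj_iff) (intro conjI ballI impI; use P assms in \<open>meson subsetD\<close>)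
qed

lemma preglid_restrict_homs:
  assumes "\<Lambda>' \<subseteq> \<Lambda>" and "f \<in> homs (Preglid \<Gamma> leq R F \<Lambda>) M N"
  shows "preglid_restrict \<Lambda>' f \<in> homs (Preglid \<Gamma> leq R F \<Lambda>') M N"
proof -
  have P: "insert Infty (Pt ` \<Lambda>') \<subseteq> insert Infty (Pt ` \<Lambda>)" using assms by blast
  from assms(2) obtain \<eta> where f: "f = (M, \<eta>, N)" 
    "M \<in> Obj (Preglid \<Gamma> leq R F \<Lambda>)" "N \<in> Obj (Preglid \<Gamma> leq R F \<Lambda>)"
    "\<forall>x \<in> insert Infty (Pt ` \<Lambda>). \<eta> x \<in> hom (Fob M x) (Fob N x) \<inter> extensional (carrier (Fob M x))"
    "\<forall>x \<in> insert Infty (Pt ` \<Lambda>). \<forall>y \<in> insert Infty (Pt ` \<Lambda>). \<forall>r \<in> filt_homs \<Gamma> leq R F x y.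
       \<forall>m \<in> carrier (Fob M x). \<eta> y (Fmap M (x, r, y) m) = Fmap N (x, r, y) (\<eta> x m)"
    unfolding Preglid_homs_iff by blast
  show ?thesis
    unfolding Preglid_homs_iff preglid_restrict_def f(1)
  proof (intro exI[of _ "restrict \<eta> (insert Infty (Pt ` \<Lambda>'))"] conjI ballI)
    fix x assume "x \<in> insert Infty (Pt ` \<Lambda>')"
    then show "restrict \<eta> (insert Infty (Pt ` \<Lambda>')) x
        \<in> hom (Fob M x) (Fob N x) \<inter> extensional (carrier (Fob M x))"
      using f(4) P by (subst restrict_apply') blast+
  next
    fix x y r m assume "x \<in> insert Infty (Pt ` \<Lambda>')" "y \<in> insert Infty (Pt ` \<Lambda>')"
      "r \<in> filt_homs \<Gamma> leq R F x y" "m \<in> carrier (Fob M x)"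
    then show "restrict \<eta> (insert Infty (Pt ` \<Lambda>')) y (Fmap M (x, r, y) m)
        = Fmap N (x, r, y) (restrict \<eta> (insert Infty (Pt ` \<Lambda>')) x m)"
      using f(5) P by (subst (1 2) restrict_apply') blast+
  qed (use f(2,3) Obj_Preglid_subset[OF assms(1), of \<Gamma> leq R F] in auto)
qed

lemma subgroup_comm_group:
  assumes "comm_group G" "subgroup H G"
  shows "comm_group (G\<lparr>carrier := H\<rparr>)"
proof -
  interpret comm_group G by fact
  have g: "group (G\<lparr>carrier := H\<rparr>)" using assms(2) subgroup.subgroup_is_group is_group by blast
  show ?thesis
    by (rule group.group_comm_groupI[OF g]) (use subgroup.subset[OF assms(2)] in \<open>auto intro: m_comm\<close>)
qed

text \<open>The counit at \<open>M\<close> is couniversal, for every \<open>M\<close>.\<close>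

lemma nat_preglid_couniversal:
  fixes \<Gamma> :: "('g, 'a) monoid_scheme" and R :: "('r, 'b) ring_scheme"
    and M :: "('g, 'r, 'u) filt_mod"
  assumes "filtered_ring \<Gamma> leq R F" and \<Lambda>: "\<Lambda> \<subseteq> carrier \<Gamma>"
    and z: "z \<in> \<Lambda>" and greatest: "\<And>\<alpha>. \<alpha> \<in> \<Lambda> \<Longrightarrow> (\<alpha>, z) \<in> leq"
    and M: "M \<in> Obj (Preglid \<Gamma> leq R F {z})"
  shows "nat_preglid \<Gamma> R F z M \<in> Obj (Preglid \<Gamma> leq R F \<Lambda>)"
    and "\<exists>\<epsilon> \<in> homs (Preglid \<Gamma> leq R F {z}) (nat_preglid \<Gamma> R F z M) M.
      \<forall>N \<in> Obj (Preglid \<Gamma> leq R F \<Lambda>). \<forall>\<phi> \<in> homs (Preglid \<Gamma> leq R F {z}) N M.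
        \<exists>!\<psi>. \<psi> \<in> homs (Preglid \<Gamma> leq R F \<Lambda>) N (nat_preglid \<Gamma> R F z M) \<and>
          \<epsilon> \<bullet>\<^bsub>Preglid \<Gamma> leq R F {z}\<^esub> preglid_restrict {z} \<psi> = \<phi>"
proof -
  interpret filtered_ring \<Gamma> leq R F by fact
  let ?P = "insert Infty (Pt ` \<Lambda>)" and ?Q = "insert Infty (Pt ` {z})"
  let ?H = "filt_homs \<Gamma> leq R F"
  let ?Om = "Fob M Infty"
  let ?N = "nat_preglid \<Gamma> R F z M"
  define act where "act r = Fmap M (Infty, r, Infty)" for r
  define j where "j = Fmap M (Pt z, \<one>\<^bsub>R\<^esub>, Infty)"
  define S where "S = j ` carrier (Fob M (Pt z))"
  define c where "c \<alpha> = {m \<in> carrier ?Om. \<forall>r \<in> F (z \<otimes>\<^bsub>\<Gamma>\<^esub> inv\<^bsub>\<Gamma>\<^esub> \<alpha>). act r m \<in> S}" for \<alpha>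
  have FR: "F \<gamma> \<subseteq> carrier R" if "\<gamma> \<in> carrier \<Gamma>" for \<gamma>
    using additive_subgroup.a_subset[OF filt_subgroup[OF that]] .
  have zG: "z \<in> carrier \<Gamma>" using \<Lambda> z by blast
  have F1: "\<one>\<^bsub>R\<^esub> \<in> F (\<beta> \<otimes>\<^bsub>\<Gamma>\<^esub> inv\<^bsub>\<Gamma>\<^esub> \<alpha>)" if "(\<alpha>, \<beta>) \<in> leq" "\<alpha> \<in> carrier \<Gamma>" "\<beta> \<in> carrier \<Gamma>" for \<alpha> \<beta>
  proof -
    have "(inv\<^bsub>\<Gamma>\<^esub> \<alpha>, inv\<^bsub>\<Gamma>\<^esub> \<alpha>) \<in> leq"
      using partial_order_onD(1)[OF partial_order] that by (auto simp: refl_on_def)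
    then have "(\<alpha> \<otimes>\<^bsub>\<Gamma>\<^esub> inv\<^bsub>\<Gamma>\<^esub> \<alpha>, \<beta> \<otimes>\<^bsub>\<Gamma>\<^esub> inv\<^bsub>\<Gamma>\<^esub> \<alpha>) \<in> leq" using mult_mono that by blast
    then have "F \<one>\<^bsub>\<Gamma>\<^esub> \<subseteq> F (\<beta> \<otimes>\<^bsub>\<Gamma>\<^esub> inv\<^bsub>\<Gamma>\<^esub> \<alpha>)" using filt_mono that by simp
    then show ?thesis using filt_one by blast
  qed
  have HR: "r \<in> carrier R" if "r \<in> ?H x y" "x \<in> ?P" "y \<in> ?P" for r x y
  proof -
    have "F (\<beta> \<otimes>\<^bsub>\<Gamma>\<^esub> inv\<^bsub>\<Gamma>\<^esub> \<alpha>) \<subseteq> carrier R" if "\<alpha> \<in> \<Lambda>" "\<beta> \<in> \<Lambda>" for \<alpha> \<beta>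
      by (rule FR) (use that \<Lambda> in auto)
    then show ?thesis using that by (cases x; cases y) (auto split: if_splits)
  qed
  have zz: "(z, z) \<in> leq" using greatest z by blast
  have one_inf: "\<one>\<^bsub>R\<^esub> \<in> ?H x Infty" for x by simp
  have R_inf: "r \<in> ?H x Infty" if "r \<in> carrier R" for r x using that by simp
  note MD = Preglid_ObjD[OF M]
  interpret Om: comm_group ?Om using MD(1)[of Infty] by simp
  interpret Mz: comm_group "Fob M (Pt z)" using MD(1)[of "Pt z"] by simp
  have act_hom: "act r \<in> hom ?Om ?Om" if "r \<in> carrier R" for r
    unfolding act_def using MD(2)[of Infty Infty r] that by simp
  have act_closed: "act r m \<in> carrier ?Om" if "r \<in> carrier R" "m \<in> carrier ?Om" for r m
    using act_hom that unfolding hom_def by blast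
  have act_one: "act \<one>\<^bsub>R\<^esub> m = m" if "m \<in> carrier ?Om" for m
    unfolding act_def using MD(3)[of Infty m] that by simp
  have act_mult: "act (s \<otimes>\<^bsub>R\<^esub> r) m = act s (act r m)"
    if "r \<in> carrier R" "s \<in> carrier R" "m \<in> carrier ?Om" for r s m
    unfolding act_def using MD(4)[of Infty Infty Infty r s m] that by simp
  have act_add: "act (r \<oplus>\<^bsub>R\<^esub> s) m = act r m \<otimes>\<^bsub>?Om\<^esub> act s m"
    if "r \<in> carrier R" "s \<in> carrier R" "m \<in> carrier ?Om" for r s m
    unfolding act_def using MD(5)[of Infty Infty r s m] that by simp
  have act_zero: "act \<zero>\<^bsub>R\<^esub> m = \<one>\<^bsub>?Om\<^esub>" if "m \<in> carrier ?Om" for m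
    using act_add[of "\<zero>\<^bsub>R\<^esub>" "\<zero>\<^bsub>R\<^esub>" m] act_closed[of "\<zero>\<^bsub>R\<^esub>" m] that by simp
  have j_mon: "j \<in> mon (Fob M (Pt z)) ?Om" unfolding j_def using MD(6)[of "Pt z"] by simp
  then have j_hom: "j \<in> hom (Fob M (Pt z)) ?Om" and j_inj: "inj_on j (carrier (Fob M (Pt z)))"
    by (auto simp: mon_def)
  interpret j: group_hom "Fob M (Pt z)" ?Om j using j_hom by unfold_locales
  have S: "subgroup S ?Om" unfolding S_def by (rule j.img_is_subgroup)
  have act_j: "act r (j m) = Fmap M (Pt z, r, Infty) m"
    if "r \<in> carrier R" "m \<in> carrier (Fob M (Pt z))" for r m
    unfolding act_def j_def using MD(4)[of "Pt z" Infty Infty "\<one>\<^bsub>R\<^esub>" r m] that by simp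
  have act_j': "act r (j m) = j (Fmap M (Pt z, r, Pt z) m)" and
    Fe_closed: "Fmap M (Pt z, r, Pt z) m \<in> carrier (Fob M (Pt z))"
    if r: "r \<in> F (z \<otimes>\<^bsub>\<Gamma>\<^esub> inv\<^bsub>\<Gamma>\<^esub> z)" and m: "m \<in> carrier (Fob M (Pt z))" for r m
  proof -
    have rR: "r \<in> carrier R" using r FR[of "z \<otimes>\<^bsub>\<Gamma>\<^esub> inv\<^bsub>\<Gamma>\<^esub> z"] zG by auto
    have rH: "r \<in> ?H (Pt z) (Pt z)" using zz r by simp
    show "act r (j m) = j (Fmap M (Pt z, r, Pt z) m)"
      unfolding act_j[OF rR m]
      unfolding j_def using MD(4)[of "Pt z" "Pt z" Infty r "\<one>\<^bsub>R\<^esub>" m] m rH rR by simp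
    show "Fmap M (Pt z, r, Pt z) m \<in> carrier (Fob M (Pt z))"
      using MD(2)[of "Pt z" "Pt z" r] rH m by (auto simp: hom_def)
  qed
  have c_sub: "subgroup (c \<alpha>) ?Om" if "\<alpha> \<in> \<Lambda>" for \<alpha>
  proof -
    have rR: "r \<in> carrier R" if "r \<in> F (z \<otimes>\<^bsub>\<Gamma>\<^esub> inv\<^bsub>\<Gamma>\<^esub> \<alpha>)" for r
      using FR[of "z \<otimes>\<^bsub>\<Gamma>\<^esub> inv\<^bsub>\<Gamma>\<^esub> \<alpha>"] zG \<Lambda> \<open>\<alpha> \<in> \<Lambda>\<close> that by auto
    have gh: "group_hom ?Om ?Om (act r)" if "r \<in> carrier R" for r
      using act_hom[OF that] Om.is_group by (simp add: group_hom_def group_hom_axioms_def)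
    show ?thesis
    proof (rule Om.subgroupI)
      show "c \<alpha> \<subseteq> carrier ?Om" by (auto simp: c_def)
      have "\<one>\<^bsub>?Om\<^esub> \<in> c \<alpha>"
        using group_hom.hom_one[OF gh] rR subgroup.one_closed[OF S] by (auto simp: c_def)
      then show "c \<alpha> \<noteq> {}" by blast
      show "inv\<^bsub>?Om\<^esub> a \<in> c \<alpha>" if "a \<in> c \<alpha>" for a
        using that group_hom.hom_inv[OF gh] rR subgroup.m_inv_closed[OF S] by (auto simp: c_def)
      show "a \<otimes>\<^bsub>?Om\<^esub> b \<in> c \<alpha>" if "a \<in> c \<alpha>" "b \<in> c \<alpha>" for a b
        using that group_hom.hom_mult[OF gh] rR subgroup.m_closed[OF S] by (auto simp: c_def)
    qed
  qed
  define d where "d x = (case x of Infty \<Rightarrow> carrier ?Om | Pt \<alpha> \<Rightarrow> c \<alpha>)" for x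
  have Fob_N: "Fob ?N x = ?Om\<lparr>carrier := d x\<rparr>" for x
    by (cases x) (simp_all add: nat_preglid_def d_def c_def S_def j_def act_def)
  have Fmap_N: "Fmap ?N (x, r, y) = act r" for x r y
    by (simp add: nat_preglid_def act_def)
  have d_sub: "subgroup (d x) ?Om" if "x \<in> ?P" for x
    using that c_sub Om.subgroup_self by (cases x) (auto simp: d_def)
  have d_carrier: "m \<in> carrier ?Om" if "m \<in> d x" for m x
    using that by (cases x) (auto simp: d_def c_def)
  have d_act: "act r m \<in> d y" if x: "x \<in> ?P" and y: "y \<in> ?P" and r: "r \<in> ?H x y" and m: "m \<in> d x"
    for x y r m
  proof (cases y)
    case Infty
    then show ?thesis using act_closed d_carrier m HR[OF r x y] by (simp add: d_def)
  next
    case y': (Pt \<beta>)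
    have \<beta>: "\<beta> \<in> \<Lambda>" "\<beta> \<in> carrier \<Gamma>" using y y' \<Lambda> by auto
    show ?thesis
    proof (cases "r = \<zero>\<^bsub>R\<^esub>")
      case True
      then show ?thesis
        using act_zero[OF d_carrier[OF m]] subgroup.one_closed[OF d_sub[OF y]] by simp
    next
      case False
      then obtain \<alpha> where x': "x = Pt \<alpha>" and le: "(\<alpha>, \<beta>) \<in> leq" 
        and r': "r \<in> F (\<beta> \<otimes>\<^bsub>\<Gamma>\<^esub> inv\<^bsub>\<Gamma>\<^esub> \<alpha>)"
        using r y' by (cases x) (auto split: if_splits)
      have \<alpha>: "\<alpha> \<in> carrier \<Gamma>" using x x' \<Lambda> by auto
      have rR: "r \<in> carrier R" using HR[OF r x y] .
      have "act s (act r m) \<in> S" if s: "s \<in> F (z \<otimes>\<^bsub>\<Gamma>\<^esub> inv\<^bsub>\<Gamma>\<^esub> \<beta>)" for s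
      proof -
        have sR: "s \<in> carrier R" using FR[of "z \<otimes>\<^bsub>\<Gamma>\<^esub> inv\<^bsub>\<Gamma>\<^esub> \<beta>"] s zG \<beta> by auto
        have "s \<otimes>\<^bsub>R\<^esub> r \<in> F ((z \<otimes>\<^bsub>\<Gamma>\<^esub> inv\<^bsub>\<Gamma>\<^esub> \<beta>) \<otimes>\<^bsub>\<Gamma>\<^esub> (\<beta> \<otimes>\<^bsub>\<Gamma>\<^esub> inv\<^bsub>\<Gamma>\<^esub> \<alpha>))"
          using filt_mult s r' zG \<alpha> \<beta> by simp
        also have "(z \<otimes>\<^bsub>\<Gamma>\<^esub> inv\<^bsub>\<Gamma>\<^esub> \<beta>) \<otimes>\<^bsub>\<Gamma>\<^esub> (\<beta> \<otimes>\<^bsub>\<Gamma>\<^esub> inv\<^bsub>\<Gamma>\<^esub> \<alpha>) = z \<otimes>\<^bsub>\<Gamma>\<^esub> inv\<^bsub>\<Gamma>\<^esub> \<alpha>"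
          using zG \<alpha> \<beta> by (metis inv_closed m_assoc m_closed l_inv l_one)
        finally have "act (s \<otimes>\<^bsub>R\<^esub> r) m \<in> S" using m by (simp add: x' d_def c_def)
        then show ?thesis using act_mult[OF rR sR d_carrier[OF m]] by simp
      qed
      then show ?thesis using act_closed[OF rR d_carrier[OF m]] by (simp add: y' d_def c_def)
    qed
  qed
  have act_hom_N: "act r \<in> hom (Fob ?N x) (Fob ?N y)" if "x \<in> ?P" "y \<in> ?P" "r \<in> ?H x y" for x y r
    using that d_act d_carrier act_hom[OF HR[OF that(3,1,2)]] by (auto simp: Fob_N hom_def)
  have one_H: "\<one>\<^bsub>R\<^esub> \<in> ?H (Pt \<alpha>) (Pt \<beta>)" if "\<alpha> \<in> \<Lambda>" "\<beta> \<in> \<Lambda>" "(\<alpha>, \<beta>) \<in> leq" for \<alpha> \<beta>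
    using F1 that \<Lambda> by auto
  have one_mon: "act \<one>\<^bsub>R\<^esub> \<in> mon (Fob ?N x) (Fob ?N y)" if "x \<in> ?P" "y \<in> ?P" "\<one>\<^bsub>R\<^esub> \<in> ?H x y" for x y
    using act_hom_N[OF that] act_one d_carrier by (auto simp: mon_def inj_on_def Fob_N)
  show N_obj: "?N \<in> Obj (Preglid \<Gamma> leq R F \<Lambda>)"
    unfolding Preglid_Obj_iff
  proof (intro conjI ballI impI)
    show "comm_group (Fob ?N x)" if "x \<in> ?P" for x
      unfolding Fob_N by (rule subgroup_comm_group[OF Om.comm_group_axioms d_sub[OF that]])
    show "Fmap ?N (x, r, y) \<in> hom (Fob ?N x) (Fob ?N y)" if "x \<in> ?P" "y \<in> ?P" "r \<in> ?H x y" for x y r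
      unfolding Fmap_N using act_hom_N that by blast
    show "Fmap ?N (x, \<one>\<^bsub>R\<^esub>, x) m = m" if "m \<in> carrier (Fob ?N x)" for x m
      using that act_one d_carrier by (simp add: Fmap_N Fob_N)
    show "Fmap ?N (x, s \<otimes>\<^bsub>R\<^esub> r, w) m = Fmap ?N (y, s, w) (Fmap ?N (x, r, y) m)"
      if "x \<in> ?P" "y \<in> ?P" "w \<in> ?P" "r \<in> ?H x y" "s \<in> ?H y w" "m \<in> carrier (Fob ?N x)" for x y w r s m
      using act_mult[OF HR[OF that(4,1,2)] HR[OF that(5,2,3)]] d_carrier that(6)
      by (simp add: Fmap_N Fob_N)
    show "Fmap ?N (x, r \<oplus>\<^bsub>R\<^esub> s, y) m = Fmap ?N (x, r, y) m \<otimes>\<^bsub>Fob ?N y\<^esub> Fmap ?N (x, s, y) m"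
      if "x \<in> ?P" "y \<in> ?P" "r \<in> ?H x y" "s \<in> ?H x y" "m \<in> carrier (Fob ?N x)" for x y r s m
      using act_add[OF HR[OF that(3,1,2)] HR[OF that(4,1,2)]] d_carrier that(5)
      by (simp add: Fmap_N Fob_N)
    show "Fmap ?N (Pt \<alpha>, \<one>\<^bsub>R\<^esub>, Pt \<beta>) \<in> mon (Fob ?N (Pt \<alpha>)) (Fob ?N (Pt \<beta>))"
      if "\<alpha> \<in> \<Lambda>" "\<beta> \<in> \<Lambda>" "(\<alpha>, \<beta>) \<in> leq" for \<alpha> \<beta>
      unfolding Fmap_N by (rule one_mon) (use one_H that in auto)
    show "Fmap ?N (x, \<one>\<^bsub>R\<^esub>, Infty) \<in> mon (Fob ?N x) (Fob ?N Infty)" if "x \<in> ?P" for x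
      unfolding Fmap_N by (rule one_mon) (use that in auto)
  qed
  have QP: "?Q \<subseteq> ?P" using z by auto
  have N_obj': "?N \<in> Obj (Preglid \<Gamma> leq R F {z})"
    using N_obj Obj_Preglid_subset[of "{z}" \<Lambda>] z by blast
  define k where "k = the_inv_into (carrier (Fob M (Pt z))) j"
  have k_j: "k (j m) = m" if "m \<in> carrier (Fob M (Pt z))" for m
    unfolding k_def by (rule the_inv_into_f_f[OF j_inj that])
  have d_z: "d (Pt z) = S"
  proof
    show "d (Pt z) \<subseteq> S"
      using act_one F1[OF zz zG zG] by (fastforce simp: d_def c_def)
    show "S \<subseteq> d (Pt z)"
      using act_j' Fe_closed by (auto simp: d_def c_def S_def)
  qed
  define e where "e = (\<lambda>x \<in> ?Q. case x of
      Infty \<Rightarrow> (\<lambda>m \<in> carrier ?Om. m) | Pt \<alpha> \<Rightarrow> restrict k S)"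
  have e_simps: "m \<in> carrier ?Om \<Longrightarrow> e Infty m = m" "m \<in> carrier (Fob M (Pt z)) \<Longrightarrow> e (Pt z) (j m) = m" for m
    by (simp_all add: e_def S_def k_j)
  have M_zero: "Fmap M (Infty, \<zero>\<^bsub>R\<^esub>, Pt z) m = \<one>\<^bsub>Fob M (Pt z)\<^esub>" if "m \<in> carrier ?Om" for m
  proof -
    have "Fmap M (Infty, \<zero>\<^bsub>R\<^esub>, Pt z) m \<in> carrier (Fob M (Pt z))"
      using MD(2)[of Infty "Pt z" "\<zero>\<^bsub>R\<^esub>"] that by (auto simp: hom_def)
    then show ?thesis using MD(5)[of Infty "Pt z" "\<zero>\<^bsub>R\<^esub>" "\<zero>\<^bsub>R\<^esub>" m] that by simp
  qed
  have e_nat: "e y (act r m) = Fmap M (x, r, y) (e x m)"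
    if x: "x \<in> ?Q" and y: "y \<in> ?Q" and r: "r \<in> ?H x y" and m: "m \<in> d x" for x y r m
  proof -
    have rR: "r \<in> carrier R" using HR[OF r] x y QP by blast
    consider "x = Infty" "y = Infty" | "x = Pt z" "y = Infty" | "x = Pt z" "y = Pt z" 
      | "x = Infty" "y = Pt z" using x y by blast
    then show ?thesis
    proof cases
      case 1
      then show ?thesis using act_closed[OF rR] d_carrier[OF m] by (simp add: e_simps act_def)
    next
      case 2
      then obtain n where n: "n \<in> carrier (Fob M (Pt z))" "m = j n" using m d_z by (auto simp: S_def)
      then show ?thesis
        using 2 act_closed[OF rR d_carrier[OF m]] act_j[OF rR n(1)] by (simp add: e_simps)
    next
      case 3
      then obtain n where n: "n \<in> carrier (Fob M (Pt z))" "m = j n" using m d_z by (auto simp: S_def)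
      have "r \<in> F (z \<otimes>\<^bsub>\<Gamma>\<^esub> inv\<^bsub>\<Gamma>\<^esub> z)" using 3 r zz by simp
      from act_j'[OF this n(1)] Fe_closed[OF this n(1)] show ?thesis
        using 3 n by (simp add: e_simps)
    next
      case 4
      have "e (Pt z) (\<one>\<^bsub>?Om\<^esub>) = \<one>\<^bsub>Fob M (Pt z)\<^esub>"
        using e_simps(2)[of "\<one>\<^bsub>Fob M (Pt z)\<^esub>"] by simp
      then show ?thesis using 4 r d_carrier[OF m] by (simp add: act_zero e_simps M_zero)
    qed
  qed
  have k_hom: "k a \<in> carrier (Fob M (Pt z))" "k (a \<otimes>\<^bsub>?Om\<^esub> b) = k a \<otimes>\<^bsub>Fob M (Pt z)\<^esub> k b"
    if aS: "a \<in> S" and bS: "b \<in> S" for a b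
  proof -
    obtain a' b' where ab: "a = j a'" "b = j b'" "a' \<in> carrier (Fob M (Pt z))" "b' \<in> carrier (Fob M (Pt z))"
      using aS bS by (auto simp: S_def)
    show "k a \<in> carrier (Fob M (Pt z))" using ab by (simp add: k_j)
    have "k (j (a' \<otimes>\<^bsub>Fob M (Pt z)\<^esub> b')) = a' \<otimes>\<^bsub>Fob M (Pt z)\<^esub> b'" using ab by (simp add: k_j del: j.hom_mult)
    then show "k (a \<otimes>\<^bsub>?Om\<^esub> b) = k a \<otimes>\<^bsub>Fob M (Pt z)\<^esub> k b" using ab by (simp add: k_j)
  qed
  have e_ext: "e \<in> extensional ?Q" by (simp add: e_def)
  have e_hom: "e x \<in> hom (Fob ?N x) (Fob M x) \<inter> extensional (carrier (Fob ?N x))" if "x \<in> ?Q" for x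
  proof (cases x)
    case Infty
    then show ?thesis by (simp add: e_def Fob_N d_def hom_def)
  next
    case (Pt \<alpha>)
    then have x: "x = Pt z" using that by auto
    show ?thesis using k_hom subgroup.m_closed[OF S] unfolding x
      by (auto simp: e_def Fob_N d_z hom_def)
  qed
  let ?e = "(?N, e, M)"
  have e_mem: "?e \<in> homs (Preglid \<Gamma> leq R F {z}) ?N M"
    unfolding Preglid_homs_iff using N_obj' M e_ext e_hom e_nat
    by (intro exI[of _ e] conjI ballI) (simp_all add: Fob_N Fmap_N)
  have cmp: "?e \<bullet>\<^bsub>Preglid \<Gamma> leq R F {z}\<^esub> preglid_restrict {z} (N, \<theta>, ?N)
      = (N, (\<lambda>x \<in> ?Q. compose (carrier (Fob N x)) (e x) (restrict \<theta> ?Q x)), M)" for N \<theta>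
    by (simp add: Preglid_simps AddMod_def preglid_restrict_def filt_cat_def)
  show "\<exists>\<epsilon> \<in> homs (Preglid \<Gamma> leq R F {z}) ?N M.
      \<forall>N \<in> Obj (Preglid \<Gamma> leq R F \<Lambda>). \<forall>\<phi> \<in> homs (Preglid \<Gamma> leq R F {z}) N M.
        \<exists>!\<psi>. \<psi> \<in> homs (Preglid \<Gamma> leq R F \<Lambda>) N ?N \<and>
          \<epsilon> \<bullet>\<^bsub>Preglid \<Gamma> leq R F {z}\<^esub> preglid_restrict {z} \<psi> = \<phi>"
  proof (intro bexI[OF _ e_mem] ballI)
    fix N \<phi> assume N: "N \<in> Obj (Preglid \<Gamma> leq R F \<Lambda>)" and phi: "\<phi> \<in> homs (Preglid \<Gamma> leq R F {z}) N M"
    note ND = Preglid_ObjD[OF N]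
    obtain \<eta> where \<phi>: "\<phi> = (N, \<eta>, M)" and ext: "\<eta> \<in> extensional ?Q"
      and hom: "\<And>x. x \<in> ?Q \<Longrightarrow> \<eta> x \<in> hom (Fob N x) (Fob M x) \<inter> extensional (carrier (Fob N x))"
      and nat: "\<And>x y r m. x \<in> ?Q \<Longrightarrow> y \<in> ?Q \<Longrightarrow> r \<in> ?H x y \<Longrightarrow> m \<in> carrier (Fob N x) \<Longrightarrow>
        \<eta> y (Fmap N (x, r, y) m) = Fmap M (x, r, y) (\<eta> x m)"
      using phi unfolding Preglid_homs_iff by blast
    have \<eta>_hom: "\<eta> x \<in> hom (Fob N x) (Fob M x)" if "x \<in> ?Q" for x using hom[OF that] by blast
    define \<theta> where "\<theta> = (\<lambda>x \<in> ?P. \<lambda>m \<in> carrier (Fob N x). \<eta> Infty (Fmap N (x, \<one>\<^bsub>R\<^esub>, Infty) m))"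
    have inc_hom: "Fmap N (x, \<one>\<^bsub>R\<^esub>, Infty) \<in> hom (Fob N x) (Fob N Infty)" if "x \<in> ?P" for x
      using ND(2)[OF that, of Infty] by simp
    have inc: "Fmap N (x, \<one>\<^bsub>R\<^esub>, Infty) m \<in> carrier (Fob N Infty)" if "x \<in> ?P" "m \<in> carrier (Fob N x)" for x m
      using inc_hom that unfolding hom_def by blast
    have comm: "\<eta> Infty (Fmap N (y, \<one>\<^bsub>R\<^esub>, Infty) (Fmap N (x, r, y) m))
        = act r (\<eta> Infty (Fmap N (x, \<one>\<^bsub>R\<^esub>, Infty) m))"
      if x: "x \<in> ?P" and y: "y \<in> ?P" and r: "r \<in> ?H x y" and m: "m \<in> carrier (Fob N x)" for x y r m
    proof -
      have rR: "r \<in> carrier R" using HR[OF r x y] .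
      have "Fmap N (y, \<one>\<^bsub>R\<^esub>, Infty) (Fmap N (x, r, y) m) = Fmap N (x, r, Infty) m"
        using ND(4)[OF x y _ r one_inf m] rR by simp
      also have "\<dots> = Fmap N (Infty, r, Infty) (Fmap N (x, \<one>\<^bsub>R\<^esub>, Infty) m)"
        using ND(4)[OF x _ _ one_inf R_inf[OF rR] m] rR by simp
      finally show ?thesis
        using nat[of Infty Infty r, OF _ _ R_inf[OF rR] inc[OF x m]] by (simp add: act_def)
    qed
    have \<theta>_d: "\<eta> Infty (Fmap N (x, \<one>\<^bsub>R\<^esub>, Infty) m) \<in> d x" if x: "x \<in> ?P" and m: "m \<in> carrier (Fob N x)" for x m
    proof (cases x)
      case Infty
      then show ?thesis using \<eta>_hom[of Infty] inc[OF x m] by (auto simp: d_def hom_def)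
    next
      case (Pt \<alpha>)
      then have \<alpha>: "\<alpha> \<in> \<Lambda>" using x by auto
      have "act r (\<eta> Infty (Fmap N (x, \<one>\<^bsub>R\<^esub>, Infty) m)) \<in> S" if r: "r \<in> F (z \<otimes>\<^bsub>\<Gamma>\<^esub> inv\<^bsub>\<Gamma>\<^esub> \<alpha>)" for r
      proof -
        have rH: "r \<in> ?H x (Pt z)" using r greatest[OF \<alpha>] by (simp add: Pt)
        have zP: "Pt z \<in> ?P" using z by simp
        have cl: "Fmap N (x, r, Pt z) m \<in> carrier (Fob N (Pt z))"
          using ND(2)[OF x zP rH] m by (auto simp: hom_def)
        have "act r (\<eta> Infty (Fmap N (x, \<one>\<^bsub>R\<^esub>, Infty) m))
            = \<eta> Infty (Fmap N (Pt z, \<one>\<^bsub>R\<^esub>, Infty) (Fmap N (x, r, Pt z) m))"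
          using comm[OF x zP rH m] by simp
        also have "\<dots> = j (\<eta> (Pt z) (Fmap N (x, r, Pt z) m))"
          using nat[of "Pt z" Infty "\<one>\<^bsub>R\<^esub>", OF _ _ one_inf cl] by (simp add: j_def)
        also have "\<dots> \<in> S" using \<eta>_hom[of "Pt z"] cl by (auto simp: S_def hom_def)
        finally show ?thesis .
      qed
      moreover have "\<eta> Infty (Fmap N (x, \<one>\<^bsub>R\<^esub>, Infty) m) \<in> carrier ?Om"
        using \<eta>_hom[of Infty] inc[OF x m] by (auto simp: hom_def)
      ultimately show ?thesis by (simp add: Pt d_def c_def)
    qed
    have \<theta>_mem: "(N, \<theta>, ?N) \<in> homs (Preglid \<Gamma> leq R F \<Lambda>) N ?N"
      unfolding Preglid_homs_iff
    proof (intro exI[of _ \<theta>] conjI ballI)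
      show "\<theta> x \<in> hom (Fob N x) (Fob ?N x) \<inter> extensional (carrier (Fob N x))" if x: "x \<in> ?P" for x
      proof -
        interpret Nx: comm_group "Fob N x" using ND(1)[OF x] .
        show ?thesis
          using x \<theta>_d[OF x] hom_mult[OF inc_hom[OF x]] inc[OF x] hom_mult[OF \<eta>_hom[of Infty]]
          by (auto simp: \<theta>_def hom_def Fob_N)
      qed
      show "\<theta> y (Fmap N (x, r, y) m) = Fmap ?N (x, r, y) (\<theta> x m)"
        if "x \<in> ?P" "y \<in> ?P" "r \<in> ?H x y" "m \<in> carrier (Fob N x)" for x y r m
      proof -
        have "Fmap N (x, r, y) m \<in> carrier (Fob N y)"
          using ND(2)[OF that(1-3)] that(4) by (auto simp: hom_def)
        then show ?thesis using comm[OF that] that by (simp add: \<theta>_def Fmap_N)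
      qed
    qed (use N N_obj in \<open>simp_all add: \<theta>_def\<close>)
    have \<theta>_eq: "compose (carrier (Fob N x)) (e x) (restrict \<theta> ?Q x) m = \<eta> x m" 
      if x: "x \<in> ?Q" for x m
    proof (cases "m \<in> carrier (Fob N x)")
      case m: True
      have xP: "x \<in> ?P" using x QP by blast
      consider "x = Infty" | "x = Pt z" using x by blast
      then show ?thesis
      proof cases
        case 1
        then have "Fmap N (Infty, \<one>\<^bsub>R\<^esub>, Infty) m = m" using ND(3)[of Infty m] m by simp
        moreover have "\<eta> Infty m \<in> carrier ?Om" using \<eta>_hom[of Infty] m 1 by (auto simp: hom_def)
        ultimately show ?thesis using 1 m by (simp add: compose_def \<theta>_def e_simps)
      next
        case 2
        then have "\<eta> Infty (Fmap N (Pt z, \<one>\<^bsub>R\<^esub>, Infty) m) = j (\<eta> (Pt z) m)"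
          using nat[of "Pt z" Infty "\<one>\<^bsub>R\<^esub>" m, OF _ _ one_inf] m by (simp add: j_def)
        moreover have "\<eta> (Pt z) m \<in> carrier (Fob M (Pt z))" using \<eta>_hom[of "Pt z"] m 2 by (auto simp: hom_def)
        ultimately show ?thesis using 2 m z by (simp add: compose_def \<theta>_def e_simps)
      qed
    next
      case False
      then show ?thesis using hom[OF x] by (auto simp: compose_def extensional_def)
    qed
    show "\<exists>!\<psi>. \<psi> \<in> homs (Preglid \<Gamma> leq R F \<Lambda>) N ?N \<and>
          ?e \<bullet>\<^bsub>Preglid \<Gamma> leq R F {z}\<^esub> preglid_restrict {z} \<psi> = \<phi>"
    proof (intro ex1I[of _ "(N, \<theta>, ?N)"] conjI)
      show "(N, \<theta>, ?N) \<in> homs (Preglid \<Gamma> leq R F \<Lambda>) N ?N" by (rule \<theta>_mem)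
      have "(\<lambda>x \<in> ?Q. compose (carrier (Fob N x)) (e x) (restrict \<theta> ?Q x)) = \<eta>"
      proof
        fix x show "(\<lambda>x \<in> ?Q. compose (carrier (Fob N x)) (e x) (restrict \<theta> ?Q x)) x = \<eta> x"
        proof (cases "x \<in> ?Q")
          case True
          then show ?thesis using \<theta>_eq[OF True] by (subst restrict_apply) (simp add: fun_eq_iff)
        next
          case False
          then show ?thesis using ext by (subst restrict_apply) (auto simp: extensional_def)
        qed
      qed
      then show "?e \<bullet>\<^bsub>Preglid \<Gamma> leq R F {z}\<^esub> preglid_restrict {z} (N, \<theta>, ?N) = \<phi>"
        unfolding cmp \<phi> by simp
    next
      fix \<psi> assume A: "\<psi> \<in> homs (Preglid \<Gamma> leq R F \<Lambda>) N ?N \<and>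
          ?e \<bullet>\<^bsub>Preglid \<Gamma> leq R F {z}\<^esub> preglid_restrict {z} \<psi> = \<phi>"
      then obtain \<theta>' where \<psi>: "\<psi> = (N, \<theta>', ?N)" and ext': "\<theta>' \<in> extensional ?P"
        and hom': "\<And>x. x \<in> ?P \<Longrightarrow> \<theta>' x \<in> hom (Fob N x) (Fob ?N x) \<inter> extensional (carrier (Fob N x))"
        and nat': "\<And>x y r m. x \<in> ?P \<Longrightarrow> y \<in> ?P \<Longrightarrow> r \<in> ?H x y \<Longrightarrow> m \<in> carrier (Fob N x) \<Longrightarrow>
          \<theta>' y (Fmap N (x, r, y) m) = Fmap ?N (x, r, y) (\<theta>' x m)"
        unfolding Preglid_homs_iff by blast
      have in_d: "\<theta>' x m \<in> d x" if "x \<in> ?P" "m \<in> carrier (Fob N x)" for x m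
        using hom'[OF that(1)] that(2) by (auto simp: hom_def Fob_N)
      have "(\<lambda>x \<in> ?Q. compose (carrier (Fob N x)) (e x) (restrict \<theta>' ?Q x)) = \<eta>"
        using A unfolding \<psi> cmp \<phi> by simp
      then have "compose (carrier (Fob N Infty)) (e Infty) (\<theta>' Infty) = \<eta> Infty"
        by (auto dest: fun_cong[of _ _ Infty])
      then have inf: "\<theta>' Infty m = \<eta> Infty m" if "m \<in> carrier (Fob N Infty)" for m
        using that in_d[of Infty m] by (auto simp: compose_def d_def e_simps dest!: fun_cong[of _ _ m])
      have eq: "\<theta>' x m = \<theta> x m" if x: "x \<in> ?P" and m: "m \<in> carrier (Fob N x)" for x m
      proof -
        have "\<theta>' x m = act \<one>\<^bsub>R\<^esub> (\<theta>' x m)" using act_one d_carrier in_d[OF x m] by simp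
        also have "\<dots> = \<theta>' Infty (Fmap N (x, \<one>\<^bsub>R\<^esub>, Infty) m)"
          using nat'[OF x _ one_inf m] by (simp add: Fmap_N)
        also have "\<dots> = \<theta> x m" using inf[OF inc[OF x m]] x m by (simp add: \<theta>_def)
        finally show ?thesis .
      qed
      have "\<theta>' = \<theta>"
      proof (intro HOL.ext)
        fix x m
        show "\<theta>' x m = \<theta> x m"
          using eq[of x m] hom'[of x] ext' by (cases "x \<in> ?P"; cases "m \<in> carrier (Fob N x)")
            (auto simp: \<theta>_def extensional_def)
      qed
      then show "\<psi> = (N, \<theta>, ?N)" using \<psi> by simp
    qed
  qed
qed

end

theory Submission
  imports Defs
begin

text \<open>An arrow \<open>A \<rightarrow> B\<close> of \<open>Glid\<close> is the same thing as a \<open>\<Lambda>\<close>-linear map, that is, a natural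
  transformation \<open>\<phi>\<close> of the restrictions of \<open>A\<close> and \<open>B\<close> to \<open>\<Lambda>\<close>: it is realized by the roof
  \<open>A \<leftarrow> P \<rightarrow> B\<close> where \<open>P\<close> has the value \<open>A(\<infinity>) \<times> B(\<infinity>)\<close> at \<open>\<infinity>\<close> and the graph of \<open>\<phi>\<close> on \<open>\<Lambda>\<close>,
  and every zigzag is equal to the roof of its \<open>\<Lambda>\<close>-linear map.  Since the image of an arrow is
  again a glider, cokernels are surjective at every point of \<open>\<Lambda>\<close>, so that the kernel-cokernel
  pairs of \<open>Glid\<close> are the pointwise short exact sequences.  A glider is natural iff it is isomorphic
  to a saturated preglider \<open>A\<close>, one in which \<open>A(\<lambda>)\<close> contains every \<open>m \<in> A(\<infinity>)\<close> that is mapped into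
  \<open>A(0)\<close> by \<open>F\<^bsub>0\<lambda>\<^sup>-\<^sup>1\<^esub>R\<close>.  Kernels in \<open>Glid\<close> of arrows out of saturated pregliders and products
  of saturated pregliders are saturated.  Hence the deflations of \<open>NGlid\<close> are its pointwise
  surjective arrows, and these are stable under composition and pullback.\<close>

section \<open>Categories of filtered groups with partial operators\<close>

text \<open>Only what happens over \<Lambda> survives the localization, and there R does not act as
  a ring: an element of \<open>F (\<beta> \<otimes> inv \<alpha>)\<close> leads from the value at
  \<alpha> to the value at \<beta>. Since 0 is greatest, all values embed in the value at 0, and an
  arrow is a single map there. Hence groups with partial operators, for which exactness is proved
  once and used twice: in NGlid, and in Glid because the conflations of NGlid are by definition
  kernel-cokernel pairs of Glid. Recognising these takes images, which are formed in Glid without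
  asking them to be natural. Saturation refers to A(\<infinity>) and is not invariant under
  isomorphism in Glid. For k[x] filtered by degree and \<Lambda> = {-1, 0}, let A(0) = k and A(-1) =
  0: with A(\<infinity>) = k[x] this is saturated, with A(\<infinity>) = k[x]/(x) it is not, and the
  quotient map is inverted in Glid. So kernels and products in NGlid are formed for saturated
  representatives and transported.\<close>

context category
begin

lemma homs_obj: "f \<in> homs C A B \<Longrightarrow> A \<in> Obj C" "f \<in> homs C A B \<Longrightarrow> B \<in> Obj C"
  using dom_obj cod_obj by (auto simp: homs_def)

lemma homs_self: "f \<in> Arr C \<Longrightarrow> f \<in> homs C (Dom C f) (Cod C f)"
  by (simp add: homs_def)

lemma homs_arr: "f \<in> homs C A B \<Longrightarrow> f \<in> Arr C" "f \<in> homs C A B \<Longrightarrow> Dom C f = A"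
    "f \<in> homs C A B \<Longrightarrow> Cod C f = B"
  by (simp_all add: homs_def)

lemma homs_full_subcategory:
  "homs (full_subcategory C S) A B = (if A \<in> S \<and> B \<in> S then homs C A B else {})"
  by (auto simp: homs_def full_subcategory_def)

lemma category_full_subcategory: "category (full_subcategory C S)"
proof -
  have [simp]: "Cmp (full_subcategory C S) = Cmp C" "Ident (full_subcategory C S) = Ident C"
      "Obj (full_subcategory C S) = Obj C \<inter> S"
    by (auto simp: full_subcategory_def)
  show ?thesis
  proof (unfold_locales, unfold homs_full_subcategory)
    fix f assume "f \<in> Arr (full_subcategory C S)"
    then show "Dom (full_subcategory C S) f \<in> Obj (full_subcategory C S)"
        "Cod (full_subcategory C S) f \<in> Obj (full_subcategory C S)"
      using dom_obj cod_obj by (auto simp: full_subcategory_def)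
  next
    fix f g k A B D E
    assume "f \<in> (if A \<in> S \<and> B \<in> S then homs C A B else {})"
      "g \<in> (if B \<in> S \<and> D \<in> S then homs C B D else {})"
      "k \<in> (if D \<in> S \<and> E \<in> S then homs C D E else {})"
    then show "(k \<bullet>\<^bsub>full_subcategory C S\<^esub> g) \<bullet>\<^bsub>full_subcategory C S\<^esub> f
        = k \<bullet>\<^bsub>full_subcategory C S\<^esub> (g \<bullet>\<^bsub>full_subcategory C S\<^esub> f)"
      using cmp_assoc by (auto split: if_splits)
  qed (auto split: if_splits intro: ident_hom cmp_hom cmp_ident_left cmp_ident_right)
qed

end

text \<open>Abstracts the part of a glider over \<Lambda>: \<open>T A i\<close> are the values,
  realised inside the value at the greatest point \<open>top\<close>, and \<open>K i j\<close> holds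
  the operators leading from level i to level j. An operator is controlled only on the levels named
  by its membership in some \<open>K i j\<close>; elsewhere \<open>act A r\<close> is
  arbitrary.\<close>

locale operator_groups =
  fixes Ob :: "'o set" and Gr :: "'o \<Rightarrow> 'u monoid" and I :: "'i set" and top :: 'i
    and T :: "'o \<Rightarrow> 'i \<Rightarrow> 'u set" and K :: "'i \<Rightarrow> 'i \<Rightarrow> 'r set" and act :: "'o \<Rightarrow> 'r \<Rightarrow> 'u \<Rightarrow> 'u"
  assumes Gr_comm: "A \<in> Ob \<Longrightarrow> comm_group (Gr A)"
    and top_in: "top \<in> I"
    and T_top: "A \<in> Ob \<Longrightarrow> T A top = carrier (Gr A)"
    and T_sub: "A \<in> Ob \<Longrightarrow> i \<in> I \<Longrightarrow> subgroup (T A i) (Gr A)"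
    and act_closed: "A \<in> Ob \<Longrightarrow> i \<in> I \<Longrightarrow> j \<in> I \<Longrightarrow> r \<in> K i j \<Longrightarrow> m \<in> T A i \<Longrightarrow> act A r m \<in> T A j"
    and act_mult: "A \<in> Ob \<Longrightarrow> i \<in> I \<Longrightarrow> j \<in> I \<Longrightarrow> r \<in> K i j \<Longrightarrow> m \<in> T A i \<Longrightarrow> n \<in> T A i
      \<Longrightarrow> act A r (m \<otimes>\<^bsub>Gr A\<^esub> n) = act A r m \<otimes>\<^bsub>Gr A\<^esub> act A r n"
begin

definition op_linear :: "'o \<Rightarrow> 'o \<Rightarrow> ('u \<Rightarrow> 'u) \<Rightarrow> bool" where
  "op_linear A B \<phi> \<longleftrightarrow> \<phi> \<in> hom (Gr A) (Gr B) \<and> (\<forall>i \<in> I. \<forall>m \<in> T A i. \<phi> m \<in> T B i) \<and>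
     (\<forall>i \<in> I. \<forall>j \<in> I. \<forall>r \<in> K i j. \<forall>m \<in> T A i. \<phi> (act A r m) = act B r (\<phi> m))"

lemma op_linearI:
  assumes "\<And>m n. m \<in> carrier (Gr A) \<Longrightarrow> n \<in> carrier (Gr A) \<Longrightarrow> \<phi> (m \<otimes>\<^bsub>Gr A\<^esub> n) = \<phi> m \<otimes>\<^bsub>Gr B\<^esub> \<phi> n"
    and "\<And>i m. i \<in> I \<Longrightarrow> m \<in> T A i \<Longrightarrow> \<phi> m \<in> T B i"
    and "\<And>i j r m. i \<in> I \<Longrightarrow> j \<in> I \<Longrightarrow> r \<in> K i j \<Longrightarrow> m \<in> T A i \<Longrightarrow> \<phi> (act A r m) = act B r (\<phi> m)"
    and "A \<in> Ob" "B \<in> Ob"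
  shows "op_linear A B \<phi>"
proof -
  have "\<phi> m \<in> carrier (Gr B)" if "m \<in> carrier (Gr A)" for m
    using assms(2)[OF top_in] T_top assms(4,5) that by simp
  then show ?thesis unfolding op_linear_def hom_def using assms(1-3) by blast
qed

lemma op_linear_T: "op_linear A B \<phi> \<Longrightarrow> i \<in> I \<Longrightarrow> m \<in> T A i \<Longrightarrow> \<phi> m \<in> T B i"
  and op_linear_act: "op_linear A B \<phi> \<Longrightarrow> i \<in> I \<Longrightarrow> j \<in> I \<Longrightarrow> r \<in> K i j \<Longrightarrow> m \<in> T A i
    \<Longrightarrow> \<phi> (act A r m) = act B r (\<phi> m)"
  and op_linear_hom: "op_linear A B \<phi> \<Longrightarrow> \<phi> \<in> hom (Gr A) (Gr B)"
  and op_linear_closed: "op_linear A B \<phi> \<Longrightarrow> m \<in> carrier (Gr A) \<Longrightarrow> \<phi> m \<in> carrier (Gr B)"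
  and op_linear_mult: "op_linear A B \<phi> \<Longrightarrow> m \<in> carrier (Gr A) \<Longrightarrow> n \<in> carrier (Gr A)
    \<Longrightarrow> \<phi> (m \<otimes>\<^bsub>Gr A\<^esub> n) = \<phi> m \<otimes>\<^bsub>Gr B\<^esub> \<phi> n"
  unfolding op_linear_def hom_def by auto

lemma op_linear_group_hom:
  assumes "op_linear A B \<phi>" "A \<in> Ob" "B \<in> Ob" shows "group_hom (Gr A) (Gr B) \<phi>"
  using assms Gr_comm op_linear_hom
  by (simp add: group_hom_def group_hom_axioms_def comm_group.axioms(2))

lemma T_carrier: "A \<in> Ob \<Longrightarrow> i \<in> I \<Longrightarrow> m \<in> T A i \<Longrightarrow> m \<in> carrier (Gr A)"
  using T_sub subgroup.subset by blast

lemma act_one: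
  assumes "A \<in> Ob" "i \<in> I" "j \<in> I" "r \<in> K i j" shows "act A r \<one>\<^bsub>Gr A\<^esub> = \<one>\<^bsub>Gr A\<^esub>"
proof -
  interpret comm_group "Gr A" using Gr_comm assms(1) .
  have one: "\<one>\<^bsub>Gr A\<^esub> \<in> T A i" using subgroup.one_closed[OF T_sub] assms by blast
  have "act A r \<one>\<^bsub>Gr A\<^esub> \<in> carrier (Gr A)" using T_carrier act_closed one assms by blast
  moreover have "act A r \<one>\<^bsub>Gr A\<^esub> \<otimes>\<^bsub>Gr A\<^esub> act A r \<one>\<^bsub>Gr A\<^esub> = act A r \<one>\<^bsub>Gr A\<^esub>"
    using act_mult[OF assms one one] by simp
  ultimately show ?thesis by simp
qed

lemma op_linear_id: "A \<in> Ob \<Longrightarrow> op_linear A A (\<lambda>m. m)"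
  by (rule op_linearI) auto

lemma op_linear_one: "A \<in> Ob \<Longrightarrow> B \<in> Ob \<Longrightarrow> op_linear A B (\<lambda>_. \<one>\<^bsub>Gr B\<^esub>)"
proof (rule op_linearI, goal_cases)
  case 1
  interpret comm_group "Gr B" using Gr_comm 1 by blast
  show ?case by simp
next
  case 2
  then show ?case using subgroup.one_closed[OF T_sub] by blast
next
  case 3
  then show ?case using act_one by metis
qed

lemma op_linear_prod:
  assumes "op_linear A B \<phi>" "op_linear A B \<psi>" "A \<in> Ob" "B \<in> Ob"
  shows "op_linear A B (\<lambda>m. \<phi> m \<otimes>\<^bsub>Gr B\<^esub> \<psi> m)"
proof -
  interpret comm_group "Gr B" using Gr_comm assms by blast
  show ?thesis
  proof (rule op_linearI)
    fix m n assume mn: "m \<in> carrier (Gr A)" "n \<in> carrier (Gr A)"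
    have cl: "\<phi> m \<in> carrier (Gr B)" "\<phi> n \<in> carrier (Gr B)" "\<psi> m \<in> carrier (Gr B)" "\<psi> n \<in> carrier (Gr B)"
      using op_linear_closed assms mn by auto
    have "\<phi> (m \<otimes>\<^bsub>Gr A\<^esub> n) = \<phi> m \<otimes>\<^bsub>Gr B\<^esub> \<phi> n" "\<psi> (m \<otimes>\<^bsub>Gr A\<^esub> n) = \<psi> m \<otimes>\<^bsub>Gr B\<^esub> \<psi> n"
      using op_linear_mult assms(1,2) mn by auto
    then show "\<phi> (m \<otimes>\<^bsub>Gr A\<^esub> n) \<otimes>\<^bsub>Gr B\<^esub> \<psi> (m \<otimes>\<^bsub>Gr A\<^esub> n)
        = (\<phi> m \<otimes>\<^bsub>Gr B\<^esub> \<psi> m) \<otimes>\<^bsub>Gr B\<^esub> (\<phi> n \<otimes>\<^bsub>Gr B\<^esub> \<psi> n)"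
      using cl by (simp add: m_ac)
  next
    fix i m assume "i \<in> I" "m \<in> T A i"
    then show "\<phi> m \<otimes>\<^bsub>Gr B\<^esub> \<psi> m \<in> T B i"
      using subgroup.m_closed[OF T_sub] op_linear_T assms by metis
  next
    fix i j r m assume "i \<in> I" "j \<in> I" "r \<in> K i j" "m \<in> T A i"
    then show "\<phi> (act A r m) \<otimes>\<^bsub>Gr B\<^esub> \<psi> (act A r m) = act B r (\<phi> m \<otimes>\<^bsub>Gr B\<^esub> \<psi> m)"
      by (simp add: op_linear_act[OF assms(1)] op_linear_act[OF assms(2)]
        act_mult[OF assms(4) _ _ _ op_linear_T[OF assms(1)] op_linear_T[OF assms(2)]])
  qed (use assms in auto)
qed

lemma act_inv:
  assumes "A \<in> Ob" "i \<in> I" "j \<in> I" "r \<in> K i j" "m \<in> T A i"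
  shows "act A r (inv\<^bsub>Gr A\<^esub> m) = inv\<^bsub>Gr A\<^esub> (act A r m)"
proof -
  interpret comm_group "Gr A" using Gr_comm assms(1) .
  have im: "inv\<^bsub>Gr A\<^esub> m \<in> T A i" using subgroup.m_inv_closed[OF T_sub] assms by blast
  have "act A r (inv\<^bsub>Gr A\<^esub> m) \<otimes>\<^bsub>Gr A\<^esub> act A r m = \<one>\<^bsub>Gr A\<^esub>"
    using act_mult[OF assms(1-4) im assms(5)] act_one[OF assms(1-4)] T_carrier assms by simp
  then show ?thesis
    using inv_equality T_carrier act_closed[OF assms(1-4)] im assms by (metis (no_types))
qed

lemma op_linear_inv:
  assumes "op_linear A B \<phi>" "A \<in> Ob" "B \<in> Ob"
  shows "op_linear A B (\<lambda>m. inv\<^bsub>Gr B\<^esub> \<phi> m)"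
proof -
  interpret comm_group "Gr B" using Gr_comm assms by blast
  show ?thesis
  proof (rule op_linearI)
    fix m n assume mn: "m \<in> carrier (Gr A)" "n \<in> carrier (Gr A)"
    then show "inv\<^bsub>Gr B\<^esub> \<phi> (m \<otimes>\<^bsub>Gr A\<^esub> n) = inv\<^bsub>Gr B\<^esub> \<phi> m \<otimes>\<^bsub>Gr B\<^esub> inv\<^bsub>Gr B\<^esub> \<phi> n"
      using op_linear_mult[OF assms(1)] op_linear_closed[OF assms(1)] by (simp add: inv_mult)
  next
    fix i m assume "i \<in> I" "m \<in> T A i"
    then show "inv\<^bsub>Gr B\<^esub> \<phi> m \<in> T B i"
      using subgroup.m_inv_closed[OF T_sub] op_linear_T assms by metis
  next
    fix i j r m assume "i \<in> I" "j \<in> I" "r \<in> K i j" "m \<in> T A i"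
    then show "inv\<^bsub>Gr B\<^esub> \<phi> (act A r m) = act B r (inv\<^bsub>Gr B\<^esub> \<phi> m)"
      by (simp add: op_linear_act[OF assms(1)] act_inv[OF assms(3) _ _ _ op_linear_T[OF assms(1)]])
  qed (use assms in auto)
qed

lemma op_linear_comp:
  assumes "op_linear A B \<phi>" "op_linear B D \<psi>" "A \<in> Ob" "B \<in> Ob" "D \<in> Ob"
  shows "op_linear A D (\<lambda>m. \<psi> (\<phi> m))"
proof (rule op_linearI)
  fix m n assume "m \<in> carrier (Gr A)" "n \<in> carrier (Gr A)"
  then show "\<psi> (\<phi> (m \<otimes>\<^bsub>Gr A\<^esub> n)) = \<psi> (\<phi> m) \<otimes>\<^bsub>Gr D\<^esub> \<psi> (\<phi> n)"
    using op_linear_mult op_linear_closed assms(1,2) by metis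
next
  fix i m assume "i \<in> I" "m \<in> T A i" then show "\<psi> (\<phi> m) \<in> T D i" using op_linear_T assms(1,2) by metis
next
  fix i j r m assume "i \<in> I" "j \<in> I" "r \<in> K i j" "m \<in> T A i"
  then show "\<psi> (\<phi> (act A r m)) = act D r (\<psi> (\<phi> m))" using op_linear_act op_linear_T assms(1,2) by metis
qed (use assms in auto)

text \<open>Maps matter only on the carrier. A class of zigzags is evaluated through a chosen
  representative, whose map may differ from the given one off the carrier.\<close>

lemma op_linear_cong:
  assumes "op_linear A B \<phi>" "A \<in> Ob" "B \<in> Ob" "\<And>m. m \<in> carrier (Gr A) \<Longrightarrow> \<psi> m = \<phi> m"
  shows "op_linear A B \<psi>"
proof -
  interpret comm_group "Gr A" using Gr_comm assms by blast
  have *: "\<psi> m = \<phi> m" if "i \<in> I" "m \<in> T A i" for i m using T_carrier that assms by blast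
  show ?thesis
  proof (rule op_linearI)
    fix m n assume "m \<in> carrier (Gr A)" "n \<in> carrier (Gr A)"
    then show "\<psi> (m \<otimes>\<^bsub>Gr A\<^esub> n) = \<psi> m \<otimes>\<^bsub>Gr B\<^esub> \<psi> n"
      using assms(4) op_linear_mult[OF assms(1)] by simp
  next
    fix i m assume "i \<in> I" "m \<in> T A i"
    then show "\<psi> m \<in> T B i" using * op_linear_T[OF assms(1)] by simp
  next
    fix i j r m assume ij: "i \<in> I" "j \<in> I" "r \<in> K i j" "m \<in> T A i"
    show "\<psi> (act A r m) = act B r (\<psi> m)"
      using *[OF ij(1,4)] *[OF ij(2) act_closed[OF assms(2) ij]] op_linear_act[OF assms(1) ij] by simp
  qed (use assms in auto)
qed

text \<open>Every identity demanded of \<open>u\<close> holds after applying the injective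
  \<open>k\<close>, hence holds. The condition on images is imposed at each level because
  \<open>k\<close> may map an element outside \<open>T A i\<close> into \<open>T D i\<close>, so a
  factorization at the top alone would not preserve levels.\<close>

lemma op_linear_factor_mono:
  assumes A: "A \<in> Ob" and B: "B \<in> Ob" and D: "D \<in> Ob"
    and k: "op_linear A D k" "inj_on k (carrier (Gr A))" and h: "op_linear B D h"
    and im: "\<And>i. i \<in> I \<Longrightarrow> h ` T B i \<subseteq> k ` T A i"
    and u: "\<And>m. m \<in> carrier (Gr B) \<Longrightarrow> u m \<in> carrier (Gr A)"
      "\<And>m. m \<in> carrier (Gr B) \<Longrightarrow> k (u m) = h m"
  shows "op_linear B A u"
proof -
  interpret GA: comm_group "Gr A" using Gr_comm A .
  interpret GB: comm_group "Gr B" using Gr_comm B .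
  have eqI: "m = n" if "k m = k n" "m \<in> carrier (Gr A)" "n \<in> carrier (Gr A)" for m n
    using k(2) that by (auto dest: inj_onD)
  have uT: "u m \<in> T A i" if i: "i \<in> I" and mi: "m \<in> T B i" for i m
  proof -
    have m: "m \<in> carrier (Gr B)" using that T_carrier B by blast
    obtain n where n: "n \<in> T A i" "h m = k n" using im[OF i] mi by blast
    then have "u m = n" using eqI u m T_carrier[OF A i] by metis
    then show ?thesis using n by simp
  qed
  show ?thesis
  proof (rule op_linearI)
    fix m n assume "m \<in> carrier (Gr B)" "n \<in> carrier (Gr B)"
    then show "u (m \<otimes>\<^bsub>Gr B\<^esub> n) = u m \<otimes>\<^bsub>Gr A\<^esub> u n"
      using eqI u op_linear_mult[OF h] op_linear_mult[OF k(1)] by (metis GA.m_closed GB.m_closed)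
  next
    fix i j r m assume ij: "i \<in> I" "j \<in> I" "r \<in> K i j" "m \<in> T B i"
    have "act B r m \<in> carrier (Gr B)" "act A r (u m) \<in> carrier (Gr A)" "m \<in> carrier (Gr B)"
      using ij act_closed T_carrier A B uT by blast+
    moreover have "h (act B r m) = k (act A r (u m))"
      using ij op_linear_act[OF h] op_linear_act[OF k(1) ij(1-3)] uT u T_carrier[OF B] by metis
    ultimately show "u (act B r m) = act A r (u m)" using eqI u by metis
  qed (use A B uT in auto)
qed

text \<open>Each element of level i lifts along \<open>p\<close> to the same level, and the
  identities for \<open>u\<close> are those of \<open>h\<close> on the lifts.\<close>

lemma op_linear_factor_epi:
  assumes A: "A \<in> Ob" and B: "B \<in> Ob" and D: "D \<in> Ob"
    and p: "op_linear A B p" "\<And>i. i \<in> I \<Longrightarrow> p ` T A i = T B i" and h: "op_linear A D h"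
    and u: "\<And>m. m \<in> carrier (Gr A) \<Longrightarrow> u (p m) = h m"
  shows "op_linear B D u"
proof -
  interpret GA: comm_group "Gr A" using Gr_comm A .
  have lift: "\<exists>n \<in> T A i. p n = m" if "i \<in> I" "m \<in> T B i" for i m
    using p(2)[OF that(1)] that(2) by (metis imageE)
  have lift': "\<exists>n \<in> carrier (Gr A). p n = m" if "m \<in> carrier (Gr B)" for m
    using lift[OF top_in] T_top A B that by simp
  show ?thesis
  proof (rule op_linearI)
    fix m n assume "m \<in> carrier (Gr B)" "n \<in> carrier (Gr B)"
    then obtain m' n' where "m' \<in> carrier (Gr A)" "n' \<in> carrier (Gr A)" "p m' = m" "p n' = n"
      using lift' by metis
    then show "u (m \<otimes>\<^bsub>Gr B\<^esub> n) = u m \<otimes>\<^bsub>Gr D\<^esub> u n"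
      using u op_linear_mult[OF h] op_linear_mult[OF p(1)] by (metis GA.m_closed)
  next
    fix i m assume "i \<in> I" "m \<in> T B i"
    then show "u m \<in> T D i" using lift u op_linear_T[OF h] T_carrier[OF A] by metis
  next
    fix i j r m assume ij: "i \<in> I" "j \<in> I" "r \<in> K i j" "m \<in> T B i"
    obtain n where n: "n \<in> T A i" "p n = m" using lift ij by blast
    have "u m = h n" using u T_carrier[OF A ij(1)] n by blast
    moreover have "u (act B r m) = h (act A r n)"
      using op_linear_act[OF p(1) ij(1-3)] n u T_carrier[OF A ij(2)] act_closed[OF A ij(1-3)] by metis
    ultimately show "u (act B r m) = act D r (u m)" using op_linear_act[OF h ij(1-3)] n by simp
  qed (use B D in auto)
qed

end

text \<open>\<open>ev\<close> describes the arrows faithfully and completely by linear maps. All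
  later arguments see the category through it, so it does no harm that arrows of the localization
  are classes of zigzags. Functions are compared on carriers only, as \<open>ev f\<close> has no
  prescribed values elsewhere.\<close>

locale operator_group_category = category C + operator_groups "Obj C" Gr I top T K act
  for C :: "('o, 'm) category" (structure) and Gr :: "'o \<Rightarrow> 'u monoid" and I :: "'i set" and top
    and T and K :: "'i \<Rightarrow> 'i \<Rightarrow> 'r set" and act +
  fixes ev :: "'m \<Rightarrow> 'u \<Rightarrow> 'u"
  assumes ev_linear: "f \<in> homs C A B \<Longrightarrow> op_linear A B (ev f)"
    and ev_ex: "A \<in> Obj C \<Longrightarrow> B \<in> Obj C \<Longrightarrow> op_linear A B \<phi>
      \<Longrightarrow> \<exists>f \<in> homs C A B. \<forall>m \<in> carrier (Gr A). ev f m = \<phi> m"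
    and ev_inj: "f \<in> homs C A B \<Longrightarrow> g \<in> homs C A B
      \<Longrightarrow> (\<And>m. m \<in> carrier (Gr A) \<Longrightarrow> ev f m = ev g m) \<Longrightarrow> f = g"
    and ev_ident: "A \<in> Obj C \<Longrightarrow> m \<in> carrier (Gr A) \<Longrightarrow> ev (Ident C A) m = m"
    and ev_cmp: "f \<in> homs C A B \<Longrightarrow> g \<in> homs C B D \<Longrightarrow> m \<in> carrier (Gr A)
      \<Longrightarrow> ev (g \<bullet> f) m = ev g (ev f m)"
begin

lemmas ev_T = op_linear_T[OF ev_linear]
lemmas ev_closed = op_linear_closed[OF ev_linear]
lemmas ev_group_hom = op_linear_group_hom[OF ev_linear _ homs_obj(2)]

lemma ev_one: "f \<in> homs C A B \<Longrightarrow> ev f \<one>\<^bsub>Gr A\<^esub> = \<one>\<^bsub>Gr B\<^esub>"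
  using group_hom.hom_one[OF ev_group_hom] homs_obj by blast

lemma one_carrier: "A \<in> Obj C \<Longrightarrow> \<one>\<^bsub>Gr A\<^esub> \<in> carrier (Gr A)"
  using subgroup.one_closed[OF T_sub[OF _ top_in]] T_top by auto

lemma factor_mono:
  assumes k: "k \<in> homs C A D" "inj_on (ev k) (carrier (Gr A))" and h: "h \<in> homs C B D"
    and im: "\<And>i. i \<in> I \<Longrightarrow> ev h ` T B i \<subseteq> ev k ` T A i"
  shows "\<exists>!u. u \<in> homs C B A \<and> k \<bullet> u = h"
proof -
  have O: "A \<in> Obj C" "B \<in> Obj C" "D \<in> Obj C" using homs_obj k h by blast+
  let ?u = "\<lambda>m. inv_into (carrier (Gr A)) (ev k) (ev h m)"
  have im': "ev h m \<in> ev k ` carrier (Gr A)" if "m \<in> carrier (Gr B)" for m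
    using im[OF top_in] T_top O that by blast
  have u: "?u m \<in> carrier (Gr A)" "ev k (?u m) = ev h m" if "m \<in> carrier (Gr B)" for m
    using inv_into_into[OF im'] f_inv_into_f[OF im'] that by simp_all
  have "op_linear B A ?u"
    by (rule op_linear_factor_mono[OF O(1,2,3) ev_linear[OF k(1)] k(2) ev_linear[OF h] im u])
  then obtain v where v: "v \<in> homs C B A" "\<forall>m \<in> carrier (Gr B). ev v m = ?u m"
    using ev_ex O by blast
  show ?thesis
  proof (rule ex1I[of _ v])
    show "v \<in> homs C B A \<and> k \<bullet> v = h"
      using v u ev_inj[OF cmp_hom[OF v(1) k(1)] h] ev_cmp[OF v(1) k(1)] by simp
    fix w assume w: "w \<in> homs C B A \<and> k \<bullet> w = h"
    show "w = v"
    proof (rule ev_inj[OF _ v(1)])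
      fix m assume m: "m \<in> carrier (Gr B)"
      have "ev k (ev w m) = ev k (ev v m)"
        using ev_cmp[OF _ k(1) m, of w] w v(2) u(2)[OF m] m by metis
      then show "ev w m = ev v m"
        using inj_onD[OF k(2)] ev_closed m w v(1) by blast
    qed (use w in auto)
  qed
qed

lemma factor_epi:
  assumes p: "p \<in> homs C A B" "\<And>i. i \<in> I \<Longrightarrow> ev p ` T A i = T B i" and h: "h \<in> homs C A D"
    and ker: "\<And>m. m \<in> carrier (Gr A) \<Longrightarrow> ev p m = \<one>\<^bsub>Gr B\<^esub> \<Longrightarrow> ev h m = \<one>\<^bsub>Gr D\<^esub>"
  shows "\<exists>!u. u \<in> homs C B D \<and> u \<bullet> p = h"
proof -
  have O: "A \<in> Obj C" "B \<in> Obj C" "D \<in> Obj C" using homs_obj p h by blast+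
  let ?s = "inv_into (carrier (Gr A)) (ev p)"
  let ?u = "\<lambda>m. ev h (?s m)"
  interpret p: group_hom "Gr A" "Gr B" "ev p" using ev_group_hom p O by blast
  interpret h: group_hom "Gr A" "Gr D" "ev h" using ev_group_hom h O by blast
  have surj: "ev p ` carrier (Gr A) = carrier (Gr B)" using p(2)[OF top_in] T_top O by simp
  have s: "?s m \<in> carrier (Gr A)" "ev p (?s m) = m" if "m \<in> carrier (Gr B)" for m
    using that surj inv_into_into[of m "ev p"] f_inv_into_f[of m "ev p"] by auto
  \<comment> \<open>Elements with the same image under \<open>p\<close> differ by an element of its
    kernel, which \<open>h\<close> kills. This makes the choice of preimages by \<open>?s\<close>
    immaterial.\<close>
  have eq: "ev h m = ev h n" if "m \<in> carrier (Gr A)" "n \<in> carrier (Gr A)" "ev p m = ev p n" for m n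
  proof -
    have "ev h (m \<otimes>\<^bsub>Gr A\<^esub> inv\<^bsub>Gr A\<^esub> n) = \<one>\<^bsub>Gr D\<^esub>" using ker that by simp
    then show ?thesis using that by (simp add: h.H.inv_solve_right' h.H.r_cancel_one)
  qed
  have u: "?u (ev p m) = ev h m" if "m \<in> carrier (Gr A)" for m
    by (rule eq) (use that s in auto)
  have "op_linear B D ?u"
    by (rule op_linear_factor_epi[OF O ev_linear[OF p(1)] p(2) ev_linear[OF h] u])
  then obtain v where v: "v \<in> homs C B D" "\<forall>m \<in> carrier (Gr B). ev v m = ?u m"
    using ev_ex O by blast
  show ?thesis
  proof (rule ex1I[of _ v])
    show "v \<in> homs C B D \<and> v \<bullet> p = h"
      using v u ev_inj[OF cmp_hom[OF p(1) v(1)] h] ev_cmp[OF p(1) v(1)] by simp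
    fix w assume w: "w \<in> homs C B D \<and> w \<bullet> p = h"
    show "w = v"
    proof (rule ev_inj[OF _ v(1)])
      fix m assume m: "m \<in> carrier (Gr B)"
      have "ev w (ev p (?s m)) = ev v (ev p (?s m))"
        using ev_cmp[OF p(1) _ s(1)[OF m], of w] w v(2) s[OF m] m by metis
      then show "ev w m = ev v m" using s m by simp
    qed (use w in auto)
  qed
qed

text \<open>An inverse has to preserve the levels, so surjectivity is asked at each of them.
  Injectivity at the top covers all levels because they lie in the carrier.\<close>

lemma iso_arr_iff:
  assumes f: "f \<in> homs C A B"
  shows "iso_arr C f \<longleftrightarrow> inj_on (ev f) (carrier (Gr A)) \<and> (\<forall>i \<in> I. ev f ` T A i = T B i)"
proof
  have O: "A \<in> Obj C" "B \<in> Obj C" using homs_obj f by blast+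
  assume "iso_arr C f"
  then obtain g where g: "g \<in> homs C B A" "g \<bullet> f = Ident C A" "f \<bullet> g = Ident C B"
    unfolding iso_arr_def using homs_arr[OF f] by auto
  have gf: "ev g (ev f m) = m" if "m \<in> carrier (Gr A)" for m
    using ev_cmp[OF f g(1)] ev_ident g O that by simp
  have fg: "ev f (ev g m) = m" if "m \<in> carrier (Gr B)" for m
    using ev_cmp[OF g(1) f] ev_ident g O that by simp
  have "m \<in> ev f ` T A i" if "i \<in> I" "m \<in> T B i" for i m
    using ev_T[OF g(1) that] fg T_carrier[OF O(2) that] by (metis imageI)
  then show "inj_on (ev f) (carrier (Gr A)) \<and> (\<forall>i \<in> I. ev f ` T A i = T B i)"
    using gf ev_T[OF f] by (auto intro: inj_on_inverseI)
next
  have O: "A \<in> Obj C" "B \<in> Obj C" using homs_obj f by blast+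
  assume *: "inj_on (ev f) (carrier (Gr A)) \<and> (\<forall>i \<in> I. ev f ` T A i = T B i)"
  have "ev (Ident C B) ` T B i \<subseteq> ev f ` T A i" if "i \<in> I" for i
    using * that ev_ident T_carrier O by auto
  then obtain g where g: "g \<in> homs C B A" "f \<bullet> g = Ident C B"
    using factor_mono[OF f, of "Ident C B" B] ident_hom O * by blast
  have "g \<bullet> f = Ident C A"
  proof (rule ev_inj[OF cmp_hom[OF f g(1)] ident_hom[OF O(1)]])
    fix m assume m: "m \<in> carrier (Gr A)"
    have "ev f (ev g (ev f m)) = ev f m"
      using ev_cmp[OF g(1) f ev_closed[OF f m]] g(2) ev_ident[OF O(2)] ev_closed[OF f m] by simp
    then have "ev g (ev f m) = m"
      using * inj_onD ev_closed[OF g(1)] ev_closed[OF f] m by metis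
    then show "ev (g \<bullet> f) m = ev (Ident C A) m" using ev_cmp[OF f g(1) m] ev_ident O m by simp
  qed
  then show "iso_arr C f" unfolding iso_arr_def using g homs_arr[OF f] by auto
qed

text \<open>Every clause speaks of hom sets between given objects, so the same \<open>ev\<close>
  serves a full subcategory. In this way natural gliders inherit the calculus of Glid.\<close>

lemma operator_group_category_full_subcategory:
  "operator_group_category (full_subcategory C S) Gr I top T K act ev"
proof -
  have [simp]: "Cmp (full_subcategory C S) = Cmp C" "Ident (full_subcategory C S) = Ident C"
      "Obj (full_subcategory C S) = Obj C \<inter> S"
    by (auto simp: full_subcategory_def)
  interpret S: operator_groups "Obj (full_subcategory C S)" Gr I top T K act
    by (rule operator_groups.intro)
      (auto simp: Gr_comm top_in T_top act_mult intro: T_sub act_closed)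
  show ?thesis
  proof (intro operator_group_category.intro operator_group_category_axioms.intro,
      unfold homs_full_subcategory)
    show "category (full_subcategory C S)" by (rule category_full_subcategory)
    show "operator_groups (Obj (full_subcategory C S)) Gr I top T K act"
      by (rule S.operator_groups_axioms)
    show "\<exists>f \<in> if A \<in> S \<and> B \<in> S then homs C A B else {}. \<forall>m \<in> carrier (Gr A). ev f m = \<phi> m"
      if "A \<in> Obj (full_subcategory C S)" "B \<in> Obj (full_subcategory C S)" "op_linear A B \<phi>" for A B \<phi>
      using ev_ex that by auto
  qed (auto split: if_splits simp: ev_linear ev_ident ev_cmp intro: ev_inj)
qed

lemma isomorphicI:
  assumes O: "A \<in> Obj C" "B \<in> Obj C" and \<phi>: "op_linear A B \<phi>"
    and inj: "inj_on \<phi> (T A top)" and im: "\<And>i. i \<in> I \<Longrightarrow> \<phi> ` T A i = T B i"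
  shows "isomorphic C A B"
proof -
  obtain f where f: "f \<in> homs C A B" "\<forall>m \<in> carrier (Gr A). ev f m = \<phi> m" using ev_ex[OF O \<phi>] by blast
  have "inj_on (ev f) (carrier (Gr A))"
    using inj f(2) T_top[OF O(1)] by (simp add: inj_on_def)
  moreover have "ev f ` T A i = T B i" if i: "i \<in> I" for i
    using im[OF i] f(2) T_carrier[OF O(1) i] by (metis (no_types, lifting) image_cong)
  ultimately show ?thesis unfolding isomorphic_def using f(1) iso_arr_iff[OF f(1)] by blast
qed

lemma isomorphic_sym: "isomorphic C A B \<Longrightarrow> isomorphic C B A"
proof -
  assume "isomorphic C A B"
  then obtain f where f: "f \<in> homs C A B" "iso_arr C f" by (auto simp: isomorphic_def)
  then obtain g where g: "g \<in> homs C B A" "g \<bullet> f = Ident C A" "f \<bullet> g = Ident C B"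
    using homs_arr[OF f(1)] by (auto simp: iso_arr_def)
  then have "iso_arr C g" unfolding iso_arr_def using f(1) homs_arr[OF g(1)] by auto
  then show ?thesis using g(1) by (auto simp: isomorphic_def)
qed

lemma isomorphic_trans: "isomorphic C A B \<Longrightarrow> isomorphic C B D \<Longrightarrow> isomorphic C A D"
proof -
  assume "isomorphic C A B" "isomorphic C B D"
  then obtain f g where f: "f \<in> homs C A B" "iso_arr C f" and g: "g \<in> homs C B D" "iso_arr C g"
    by (auto simp: isomorphic_def)
  have O: "A \<in> Obj C" "B \<in> Obj C" "D \<in> Obj C" using homs_obj f(1) g(1) by blast+
  have F: "inj_on (ev f) (T A top)" "\<And>i. i \<in> I \<Longrightarrow> ev f ` T A i = T B i"
    and G: "inj_on (ev g) (T B top)" "\<And>i. i \<in> I \<Longrightarrow> ev g ` T B i = T D i"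
    using iso_arr_iff[OF f(1)] iso_arr_iff[OF g(1)] f(2) g(2) T_top[OF O(1)] T_top[OF O(2)] by auto
  show ?thesis
  proof (rule isomorphicI[OF O(1,3) op_linear_comp[OF ev_linear[OF f(1)] ev_linear[OF g(1)] O]])
    show "inj_on (\<lambda>m. ev g (ev f m)) (T A top)"
      using comp_inj_on[OF F(1), of "ev g"] G(1) F(2)[OF top_in] by (simp add: comp_def)
    show "(\<lambda>m. ev g (ev f m)) ` T A i = T D i" if "i \<in> I" for i
      using F(2)[OF that] G(2)[OF that] by (simp add: image_image[symmetric])
  qed
qed

end

section \<open>Universal properties and the exact structure of levelwise exact pairs\<close>

lemma is_pullback_factor:
  assumes "is_pullback C p f p' f'" "a \<in> homs C W (Dom C p)" "b \<in> homs C W (Dom C f)"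
    and "p \<bullet>\<^bsub>C\<^esub> a = f \<bullet>\<^bsub>C\<^esub> b"
  obtains u where "u \<in> homs C W (Dom C p')" "f' \<bullet>\<^bsub>C\<^esub> u = a" "p' \<bullet>\<^bsub>C\<^esub> u = b"
proof -
  note univ = assms(1)[unfolded is_pullback_def, THEN conjunct2, THEN conjunct2, THEN conjunct2,
      THEN conjunct2, THEN conjunct2, THEN conjunct2, THEN conjunct2, THEN conjunct2, THEN conjunct2,
      THEN bspec, THEN bspec, THEN mp, THEN ex1_implies_ex]
  have "\<exists>u. u \<in> homs C (Dom C a) (Dom C p') \<and> f' \<bullet>\<^bsub>C\<^esub> u = a \<and> p' \<bullet>\<^bsub>C\<^esub> u = b"
    by (rule univ) (use assms(2-) in \<open>simp_all add: homs_def\<close>)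
  then show ?thesis using that assms(2) by (auto simp: homs_def)
qed

lemma is_kernel_factor:
  assumes "is_kernel C k f" "h \<in> homs C W (Dom C f)" "zero_arr C (f \<bullet>\<^bsub>C\<^esub> h)"
  shows "\<exists>!u. u \<in> homs C W (Dom C k) \<and> k \<bullet>\<^bsub>C\<^esub> u = h"
proof -
  note univ = assms(1)[unfolded is_kernel_def, THEN conjunct2, THEN conjunct2, THEN conjunct2,
      THEN conjunct2, THEN bspec, THEN mp]
  have "\<exists>!u. u \<in> homs C (Dom C h) (Dom C k) \<and> k \<bullet>\<^bsub>C\<^esub> u = h"
    by (rule univ) (use assms(2-) in \<open>simp_all add: homs_def\<close>)
  then show ?thesis using assms(2) by (simp add: homs_def)
qed

lemma is_cokernel_factor:
  assumes "is_cokernel C c f" "h \<in> homs C (Cod C f) W" "zero_arr C (h \<bullet>\<^bsub>C\<^esub> f)"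
  shows "\<exists>!u. u \<in> homs C (Cod C c) W \<and> u \<bullet>\<^bsub>C\<^esub> c = h"
proof -
  note univ = assms(1)[unfolded is_cokernel_def, THEN conjunct2, THEN conjunct2, THEN conjunct2,
      THEN conjunct2, THEN bspec, THEN mp]
  have "\<exists>!u. u \<in> homs C (Cod C c) (Cod C h) \<and> u \<bullet>\<^bsub>C\<^esub> c = h"
    by (rule univ) (use assms(2-) in \<open>simp_all add: homs_def\<close>)
  then show ?thesis using assms(2) by (simp add: homs_def)
qed

text \<open>Kernels and products are asked to be levelwise. Cokernels are absent on purpose: by
  \<open>factor_epi\<close> a levelwise surjection is the cokernel of its kernel, so a full
  subcategory only has to be closed under kernels, products and a zero object.\<close>

locale kernel_operator_group_category = operator_group_category C Gr I top T K act ev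
  for C :: "('o, 'm) category" (structure) and Gr :: "'o \<Rightarrow> 'u monoid" and I :: "'i set" and top
    and T and K :: "'i \<Rightarrow> 'i \<Rightarrow> 'r set" and act and ev +
  assumes zero_ex: "\<exists>Z \<in> Obj C. carrier (Gr Z) = {\<one>\<^bsub>Gr Z\<^esub>}"
    and kernel_ex: "f \<in> homs C A B \<Longrightarrow> \<exists>D. \<exists>k \<in> homs C D A. inj_on (ev k) (carrier (Gr D)) \<and>
      (\<forall>i \<in> I. ev k ` T D i = {m \<in> T A i. ev f m = \<one>\<^bsub>Gr B\<^esub>})"
    and product_ex: "A \<in> Obj C \<Longrightarrow> B \<in> Obj C \<Longrightarrow> \<exists>P. \<exists>p \<in> homs C P A. \<exists>q \<in> homs C P B.
      \<forall>i \<in> I. bij_betw (\<lambda>m. (ev p m, ev q m)) (T P i) (T A i \<times> T B i)"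
begin

lemma ev_const:
  assumes "f \<in> homs C A B" "g \<in> homs C A B"
    and "\<And>m. m \<in> carrier (Gr A) \<Longrightarrow> ev f m = \<one>\<^bsub>Gr B\<^esub>" "\<And>m. m \<in> carrier (Gr A) \<Longrightarrow> ev g m = \<one>\<^bsub>Gr B\<^esub>"
  shows "f = g"
  using assms by (intro ev_inj) auto

lemma trivial_hom_ex:
  assumes "A \<in> Obj C" "B \<in> Obj C"
  obtains f where "f \<in> homs C A B" "\<And>m. m \<in> carrier (Gr A) \<Longrightarrow> ev f m = \<one>\<^bsub>Gr B\<^esub>"
  using ev_ex[OF assms op_linear_one[OF assms]] by auto

text \<open>The identity of a zero object coincides with the trivial arrow, and evaluating both
  leaves a single element.\<close>

lemma zero_object_iff: "zero_object C Z \<longleftrightarrow> Z \<in> Obj C \<and> carrier (Gr Z) = {\<one>\<^bsub>Gr Z\<^esub>}"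
proof
  assume Z: "zero_object C Z"
  then have O: "Z \<in> Obj C" and u: "\<exists>!f. f \<in> homs C Z Z" by (auto simp: zero_object_def)
  obtain f where f: "f \<in> homs C Z Z" "\<And>m. m \<in> carrier (Gr Z) \<Longrightarrow> ev f m = \<one>\<^bsub>Gr Z\<^esub>"
    using trivial_hom_ex[OF O O] by blast
  have "f = Ident C Z" using u f(1) ident_hom[OF O] by blast
  then have "m = \<one>\<^bsub>Gr Z\<^esub>" if "m \<in> carrier (Gr Z)" for m using f(2) ev_ident O that by metis
  then show "Z \<in> Obj C \<and> carrier (Gr Z) = {\<one>\<^bsub>Gr Z\<^esub>}" using O one_carrier by blast
next
  assume Z: "Z \<in> Obj C \<and> carrier (Gr Z) = {\<one>\<^bsub>Gr Z\<^esub>}"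
  then have O: "Z \<in> Obj C" by blast
  have "\<exists>!f. f \<in> homs C A Z" if A: "A \<in> Obj C" for A
  proof -
    have "f = g" if "f \<in> homs C A Z" "g \<in> homs C A Z" for f g
      by (rule ev_const[OF that]) (use Z ev_closed that in blast)+
    then show ?thesis using trivial_hom_ex[OF A O] by metis
  qed
  moreover have "\<exists>!f. f \<in> homs C Z A" if A: "A \<in> Obj C" for A
  proof -
    have "f = g" if "f \<in> homs C Z A" "g \<in> homs C Z A" for f g
      by (rule ev_const[OF that]) (use Z ev_one that in auto)
    then show ?thesis using trivial_hom_ex[OF O A] by metis
  qed
  ultimately show "zero_object C Z" unfolding zero_object_def using O by blast
qed

lemma zero_arr_iff:
  assumes f: "f \<in> homs C A B"
  shows "zero_arr C f \<longleftrightarrow> (\<forall>m \<in> carrier (Gr A). ev f m = \<one>\<^bsub>Gr B\<^esub>)"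
proof
  assume "zero_arr C f"
  then obtain Z g h where Z: "zero_object C Z" and g: "g \<in> homs C A Z" and h: "h \<in> homs C Z B"
    and fgh: "f = h \<bullet> g"
    unfolding zero_arr_def using homs_arr[OF f] by auto
  have "ev f m = \<one>\<^bsub>Gr B\<^esub>" if m: "m \<in> carrier (Gr A)" for m
  proof -
    have "ev g m = \<one>\<^bsub>Gr Z\<^esub>" using ev_closed[OF g m] Z by (simp add: zero_object_iff)
    then show ?thesis using ev_cmp[OF g h m] ev_one[OF h] fgh by simp
  qed
  then show "\<forall>m \<in> carrier (Gr A). ev f m = \<one>\<^bsub>Gr B\<^esub>" by blast
next
  assume *: "\<forall>m \<in> carrier (Gr A). ev f m = \<one>\<^bsub>Gr B\<^esub>"
  have O: "A \<in> Obj C" "B \<in> Obj C" using homs_obj f by blast+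
  obtain Z where Z: "Z \<in> Obj C" "carrier (Gr Z) = {\<one>\<^bsub>Gr Z\<^esub>}" using zero_ex by blast
  obtain g where g: "g \<in> homs C A Z" "\<And>m. m \<in> carrier (Gr A) \<Longrightarrow> ev g m = \<one>\<^bsub>Gr Z\<^esub>"
    using trivial_hom_ex[OF O(1) Z(1)] by blast
  obtain h where h: "h \<in> homs C Z B" "\<And>m. m \<in> carrier (Gr Z) \<Longrightarrow> ev h m = \<one>\<^bsub>Gr B\<^esub>"
    using trivial_hom_ex[OF Z(1) O(2)] by blast
  have "f = h \<bullet> g"
    by (rule ev_const[OF f cmp_hom[OF g(1) h(1)]])
      (use * ev_cmp[OF g(1) h(1)] g(2) ev_one[OF h(1)] in auto)
  then show "zero_arr C f"
    unfolding zero_arr_def using homs_arr[OF f] Z zero_object_iff g(1) h(1) by auto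
qed

lemma zero_arr_cmp_iff:
  assumes "f \<in> homs C A B" "g \<in> homs C B D"
  shows "zero_arr C (g \<bullet> f) \<longleftrightarrow> (\<forall>m \<in> carrier (Gr A). ev g (ev f m) = \<one>\<^bsub>Gr D\<^esub>)"
  using zero_arr_iff[OF cmp_hom[OF assms]] ev_cmp[OF assms] by simp

text \<open>Short exactness at every level. Injectivity at the top gives it at all levels, whereas
  the image of \<open>k\<close> and the surjectivity of \<open>p\<close> are separate conditions for
  each level.\<close>

definition exact_pair :: "'m \<Rightarrow> 'm \<Rightarrow> bool" where
  "exact_pair k p \<longleftrightarrow> k \<in> Arr C \<and> p \<in> Arr C \<and> Cod C k = Dom C p \<and>
     inj_on (ev k) (carrier (Gr (Dom C k))) \<and>
     (\<forall>i \<in> I. ev k ` T (Dom C k) i = {m \<in> T (Dom C p) i. ev p m = \<one>\<^bsub>Gr (Cod C p)\<^esub>}) \<and>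
     (\<forall>i \<in> I. ev p ` T (Dom C p) i = T (Cod C p) i)"

lemma is_kernelI:
  assumes k: "k \<in> homs C D A" and f: "f \<in> homs C A B" and inj: "inj_on (ev k) (carrier (Gr D))"
    and im: "\<And>i. i \<in> I \<Longrightarrow> ev k ` T D i = {m \<in> T A i. ev f m = \<one>\<^bsub>Gr B\<^esub>}"
  shows "is_kernel C k f"
proof -
  have O: "A \<in> Obj C" "B \<in> Obj C" "D \<in> Obj C" using homs_obj k f by blast+
  have "ev f (ev k m) = \<one>\<^bsub>Gr B\<^esub>" if "m \<in> carrier (Gr D)" for m
    using im[OF top_in] T_top O that by blast
  then have z: "zero_arr C (f \<bullet> k)" using zero_arr_cmp_iff[OF k f] by simp
  have "\<exists>!u. u \<in> homs C W D \<and> k \<bullet> u = h"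
    if h: "h \<in> homs C W A" and zh: "zero_arr C (f \<bullet> h)" for W h
  proof (rule factor_mono[OF k inj h])
    fix i assume i: "i \<in> I"
    have W: "W \<in> Obj C" using homs_obj h by blast
    have "ev h m \<in> T A i \<and> ev f (ev h m) = \<one>\<^bsub>Gr B\<^esub>" if "m \<in> T W i" for m
      using ev_T[OF h i that] zh zero_arr_cmp_iff[OF h f] T_carrier[OF W i that] by blast
    then show "ev h ` T W i \<subseteq> ev k ` T D i" unfolding im[OF i] by blast
  qed
  then show ?thesis unfolding is_kernel_def using z homs_arr[OF k] homs_arr[OF f] homs_self by metis
qed

text \<open>To factor \<open>h\<close> through \<open>p\<close> as a map it suffices that
  \<open>h\<close> vanishes on the kernel of \<open>p\<close> at the top, which \<open>im\<close>
  provides; the levels enter through \<open>surj\<close>, which makes the factor respect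
  them.\<close>

lemma is_cokernelI:
  assumes k: "k \<in> homs C D A" and p: "p \<in> homs C A B"
    and im: "ev k ` carrier (Gr D) = {m \<in> carrier (Gr A). ev p m = \<one>\<^bsub>Gr B\<^esub>}"
    and surj: "\<And>i. i \<in> I \<Longrightarrow> ev p ` T A i = T B i"
  shows "is_cokernel C p k"
proof -
  have O: "A \<in> Obj C" "B \<in> Obj C" "D \<in> Obj C" using homs_obj k p by blast+
  have z: "zero_arr C (p \<bullet> k)" using zero_arr_cmp_iff[OF k p] im by blast
  have "\<exists>!u. u \<in> homs C B W \<and> u \<bullet> p = h"
    if h: "h \<in> homs C A W" and zh: "zero_arr C (h \<bullet> k)" for W h
  proof (rule factor_epi[OF p surj h])
    fix m assume "m \<in> carrier (Gr A)" "ev p m = \<one>\<^bsub>Gr B\<^esub>"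
    then obtain n where "n \<in> carrier (Gr D)" "m = ev k n" using im by blast
    then show "ev h m = \<one>\<^bsub>Gr W\<^esub>" using zh zero_arr_cmp_iff[OF k h] by blast
  qed
  then show ?thesis unfolding is_cokernel_def using z homs_arr[OF k] homs_arr[OF p] homs_self by metis
qed

lemma exact_pair_kernel_cokernel:
  assumes "exact_pair k p" shows "(k, p) \<in> kernel_cokernel_pairs C"
proof -
  define D A B where "D = Dom C k" "A = Dom C p" "B = Cod C p"
  have k: "k \<in> homs C D A" and p: "p \<in> homs C A B"
    using assms by (auto simp: exact_pair_def homs_def D_A_B_def)
  have O: "A \<in> Obj C" "D \<in> Obj C" using homs_obj k by blast+
  have inj: "inj_on (ev k) (carrier (Gr D))"
    and im: "\<And>i. i \<in> I \<Longrightarrow> ev k ` T D i = {m \<in> T A i. ev p m = \<one>\<^bsub>Gr B\<^esub>}"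
    and surj: "\<And>i. i \<in> I \<Longrightarrow> ev p ` T A i = T B i"
    using assms by (auto simp: exact_pair_def D_A_B_def)
  have "is_kernel C k p" by (rule is_kernelI[OF k p inj im])
  moreover have "is_cokernel C p k"
    by (rule is_cokernelI[OF k p _ surj]) (use im[OF top_in] T_top O in simp)
  ultimately show ?thesis by (simp add: kernel_cokernel_pairs_def)
qed

text \<open>Compare with the levelwise kernel \<open>j\<close> from \<open>kernel_ex\<close>:
  \<open>k\<close> and \<open>j\<close> factor through each other. Since \<open>j\<close> is
  injective and \<open>u\<close> has a left inverse, \<open>k\<close> is injective; the two
  factorizations together give equal images at every level.\<close>

lemma kernel_unique:
  assumes k: "k \<in> homs C D A" and f: "f \<in> homs C A B" and ker: "is_kernel C k f"
  shows "inj_on (ev k) (carrier (Gr D))"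
    and "i \<in> I \<Longrightarrow> ev k ` T D i = {m \<in> T A i. ev f m = \<one>\<^bsub>Gr B\<^esub>}"
proof -
  obtain E j where j: "j \<in> homs C E A" "inj_on (ev j) (carrier (Gr E))"
    and im: "\<And>i. i \<in> I \<Longrightarrow> ev j ` T E i = {m \<in> T A i. ev f m = \<one>\<^bsub>Gr B\<^esub>}"
    using kernel_ex[OF f] by blast
  have O: "D \<in> Obj C" "E \<in> Obj C" using homs_obj k j by blast+
  have kj: "is_kernel C j f" by (rule is_kernelI[OF j(1) f j(2) im])
  have zk: "zero_arr C (f \<bullet> k)" and zj: "zero_arr C (f \<bullet> j)"
    using ker kj by (simp_all add: is_kernel_def)
  have k': "k \<in> homs C D (Dom C f)" and j': "j \<in> homs C E (Dom C f)" and dom: "Dom C j = E" "Dom C k = D"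
    using k j(1) homs_arr[OF k] homs_arr[OF f] homs_arr[OF j(1)] by simp_all
  obtain u where u: "u \<in> homs C D E" "j \<bullet> u = k"
    using is_kernel_factor[OF kj k' zk] unfolding dom by blast
  obtain v where v: "v \<in> homs C E D" "k \<bullet> v = j"
    using is_kernel_factor[OF ker j' zj] unfolding dom by blast
  have "k \<bullet> (v \<bullet> u) = k" using cmp_assoc[OF u(1) v(1) k] u v by simp
  then have "v \<bullet> u = Ident C D"
    using is_kernel_factor[OF ker k' zk] cmp_hom[OF u(1) v(1)] ident_hom[OF O(1)] cmp_ident_right[OF k]
    unfolding dom by blast
  then have vu: "ev v (ev u m) = m" if "m \<in> carrier (Gr D)" for m
    using ev_cmp[OF u(1) v(1) that] ev_ident[OF O(1) that] by simp
  have ju: "ev j (ev u m) = ev k m" if "m \<in> carrier (Gr D)" for m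
    using ev_cmp[OF u(1) j(1) that] u by simp
  have kv: "ev k (ev v m) = ev j m" if "m \<in> carrier (Gr E)" for m
    using ev_cmp[OF v(1) k that] v by simp
  show "inj_on (ev k) (carrier (Gr D))"
  proof (rule inj_onI)
    fix m n assume mn: "m \<in> carrier (Gr D)" "n \<in> carrier (Gr D)" "ev k m = ev k n"
    then have "ev j (ev u m) = ev j (ev u n)" using ju by simp
    then have "ev u m = ev u n" using inj_onD[OF j(2)] ev_closed[OF u(1)] mn by blast
    then show "m = n" using vu mn by metis
  qed
  show "ev k ` T D i = {m \<in> T A i. ev f m = \<one>\<^bsub>Gr B\<^esub>}" if i: "i \<in> I"
  proof -
    have "ev k m \<in> ev j ` T E i" if "m \<in> T D i" for m
      using ev_T[OF u(1) i that] ju[OF T_carrier[OF O(1) i that]] by (metis imageI)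
    moreover have "ev j m \<in> ev k ` T D i" if "m \<in> T E i" for m
      using ev_T[OF v(1) i that] kv[OF T_carrier[OF O(2) i that]] by (metis imageI)
    ultimately show ?thesis unfolding im[OF i, symmetric] by blast
  qed
qed

text \<open>A cokernel factors through its own image, and the factorization splits off that image.\<close>

lemma kernel_cokernel_exact_pair:
  assumes image_ex: "\<And>f A B. f \<in> homs C A B \<Longrightarrow> \<exists>D. \<exists>j \<in> homs C D B. inj_on (ev j) (carrier (Gr D)) \<and>
      (\<forall>i \<in> I. ev j ` T D i = ev f ` T A i)"
    and kp: "(k, p) \<in> kernel_cokernel_pairs C"
  shows "exact_pair k p"
proof -
  define D A B where "D = Dom C k" "A = Dom C p" "B = Cod C p"
  have ker: "is_kernel C k p" and cok: "is_cokernel C p k"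
    using kp by (auto simp: kernel_cokernel_pairs_def)
  have k: "k \<in> homs C D A" and p: "p \<in> homs C A B"
    using ker by (auto simp: is_kernel_def homs_def D_A_B_def)
  have B: "B \<in> Obj C" using homs_obj p by blast
  obtain E j where j: "j \<in> homs C E B" "inj_on (ev j) (carrier (Gr E))"
    and im: "\<forall>i \<in> I. ev j ` T E i = ev p ` T A i"
    using image_ex[OF p] by (elim exE bexE conjE)
  have O: "A \<in> Obj C" "D \<in> Obj C" "E \<in> Obj C" using homs_obj k j by blast+
  have dom: "Cod C k = A" "Cod C p = B" using homs_arr[OF k] homs_arr[OF p] by simp_all
  have zp: "zero_arr C (p \<bullet> k)" using cok by (simp add: is_cokernel_def)
  obtain u where u: "u \<in> homs C A E" "j \<bullet> u = p"
    using factor_mono[OF j p] im by (metis order_refl)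
  have "ev u (ev k m) = \<one>\<^bsub>Gr E\<^esub>" if m: "m \<in> carrier (Gr D)" for m
  proof -
    have "ev j (ev u (ev k m)) = ev p (ev k m)"
      using ev_cmp[OF u(1) j(1) ev_closed[OF k m]] u by simp
    also have "\<dots> = ev j \<one>\<^bsub>Gr E\<^esub>" using zp zero_arr_cmp_iff[OF k p] m ev_one[OF j(1)] by simp
    finally show ?thesis
      using inj_onD[OF j(2)] ev_closed[OF u(1)] ev_closed[OF k m] one_carrier[OF O(3)] by blast
  qed
  then have "zero_arr C (u \<bullet> k)" using zero_arr_cmp_iff[OF k u(1)] by blast
  then obtain v where v: "v \<in> homs C B E" "v \<bullet> p = u"
    using is_cokernel_factor[OF cok, of u E] u(1) unfolding dom by blast
  \<comment> \<open>Both \<open>j \<bullet> v\<close> and the identity of B are factorizations of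
    \<open>p\<close> through the cokernel \<open>p\<close>, so they agree. Thus \<open>j\<close> has
    a section that preserves levels, and the image of \<open>p\<close> fills every level of
    B.\<close>
  have "(j \<bullet> v) \<bullet> p = p" using cmp_assoc[OF p v(1) j(1)] u v by simp
  then have "j \<bullet> v = Ident C B"
    using is_cokernel_factor[OF cok, of p B] p zp cmp_hom[OF v(1) j(1)] ident_hom[OF B] cmp_ident_left[OF p]
    unfolding dom by blast
  then have jv: "ev j (ev v m) = m" if "m \<in> carrier (Gr B)" for m
    using ev_cmp[OF v(1) j(1) that] ev_ident[OF B that] by simp
  have "ev p ` T A i = T B i" if i: "i \<in> I" for i
  proof
    show "ev p ` T A i \<subseteq> T B i" using ev_T[OF p i] by blast
    show "T B i \<subseteq> ev p ` T A i"
      using jv T_carrier[OF B i] ev_T[OF v(1) i] unfolding im[rule_format, OF i, symmetric] by (metis imageI subsetI)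
  qed
  then show ?thesis
    unfolding exact_pair_def using kernel_unique[OF k p ker] homs_arr[OF k] homs_arr[OF p] by simp
qed

definition is_product :: "'o \<Rightarrow> 'o \<Rightarrow> 'o \<Rightarrow> 'm \<Rightarrow> 'm \<Rightarrow> bool" where
  "is_product A B P p q \<longleftrightarrow> p \<in> homs C P A \<and> q \<in> homs C P B \<and>
     (\<forall>i \<in> I. bij_betw (\<lambda>m. (ev p m, ev q m)) (T P i) (T A i \<times> T B i))"

lemma is_product_inj:
  assumes P: "is_product A B P p q" and "m \<in> carrier (Gr P)" "n \<in> carrier (Gr P)"
    and "ev p m = ev p n" "ev q m = ev q n"
  shows "m = n"
proof -
  have "P \<in> Obj C" using P homs_obj by (auto simp: is_product_def)
  then have "inj_on (\<lambda>m. (ev p m, ev q m)) (carrier (Gr P))"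
    using P T_top top_in by (auto simp: is_product_def bij_betw_def)
  then show ?thesis by (rule inj_onD) (use assms in auto)
qed

lemma is_product_surj:
  assumes P: "is_product A B P p q" and "i \<in> I" "a \<in> T A i" "b \<in> T B i"
  obtains m where "m \<in> T P i" "ev p m = a" "ev q m = b"
proof -
  have "(\<lambda>m. (ev p m, ev q m)) ` T P i = T A i \<times> T B i"
    using assms by (auto simp: is_product_def bij_betw_def)
  then have "(a, b) \<in> (\<lambda>m. (ev p m, ev q m)) ` T P i" using assms by blast
  then show ?thesis using that by auto
qed

lemma is_product_factor:
  assumes P: "is_product A B P p q" and a: "a \<in> homs C W A" and b: "b \<in> homs C W B"
  obtains u where "u \<in> homs C W P" "p \<bullet> u = a" "q \<bullet> u = b"
proof -
  have p: "p \<in> homs C P A" and q: "q \<in> homs C P B" using P by (auto simp: is_product_def)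
  have O: "P \<in> Obj C" "A \<in> Obj C" "B \<in> Obj C" "W \<in> Obj C" using homs_obj p q a by blast+
  define u where "u m = inv_into (carrier (Gr P)) (\<lambda>m. (ev p m, ev q m)) (ev a m, ev b m)" for m
  have "(ev a m, ev b m) \<in> (\<lambda>m. (ev p m, ev q m)) ` carrier (Gr P)" if m: "m \<in> carrier (Gr W)" for m
  proof -
    obtain n where "n \<in> T P top" "ev p n = ev a m" "ev q n = ev b m"
      using is_product_surj[OF P top_in] ev_closed[OF a m] ev_closed[OF b m] T_top O by metis
    then show ?thesis using T_top O by force
  qed
  note im = this
  have u: "u m \<in> carrier (Gr P)" "ev p (u m) = ev a m" "ev q (u m) = ev b m" if "m \<in> carrier (Gr W)" for m
    using inv_into_into[OF im[OF that]] f_inv_into_f[OF im[OF that]] by (simp_all add: u_def)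
  interpret GP: comm_group "Gr P" using Gr_comm O by blast
  interpret GW: comm_group "Gr W" using Gr_comm O by blast
  \<comment> \<open>\<open>u m\<close> was chosen at the top. Level i contains an element with the
    same coordinates, and coordinates determine elements at the top, so \<open>u m\<close> is that
    element.\<close>
  have uT: "u m \<in> T P i" if i: "i \<in> I" and m: "m \<in> T W i" for i m
  proof -
    have mW: "m \<in> carrier (Gr W)" using T_carrier[OF O(4) i m] .
    obtain n where n: "n \<in> T P i" "ev p n = ev a m" "ev q n = ev b m"
      using is_product_surj[OF P i ev_T[OF a i m] ev_T[OF b i m]] by blast
    have "u m = n"
      by (rule is_product_inj[OF P u(1)[OF mW] T_carrier[OF O(1) i n(1)]]) (use u[OF mW] n in auto)
    then show ?thesis using n by simp
  qed
  have "op_linear W P u"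
  proof (rule op_linearI)
    fix m n assume mn: "m \<in> carrier (Gr W)" "n \<in> carrier (Gr W)"
    note eqs = op_linear_mult[OF ev_linear[OF p] u(1)[OF mn(1)] u(1)[OF mn(2)]]
      op_linear_mult[OF ev_linear[OF q] u(1)[OF mn(1)] u(1)[OF mn(2)]]
      op_linear_mult[OF ev_linear[OF a] mn] op_linear_mult[OF ev_linear[OF b] mn]
    show "u (m \<otimes>\<^bsub>Gr W\<^esub> n) = u m \<otimes>\<^bsub>Gr P\<^esub> u n"
      by (rule is_product_inj[OF P]) (simp_all add: mn u eqs)
  next
    fix i j r m assume ij: "i \<in> I" "j \<in> I" "r \<in> K i j" "m \<in> T W i"
    have mW: "m \<in> carrier (Gr W)" "act W r m \<in> carrier (Gr W)"
      using T_carrier[OF O(4)] act_closed[OF O(4) ij] ij by blast+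
    note eqs = op_linear_act[OF ev_linear[OF p] ij(1-3) uT[OF ij(1,4)]]
      op_linear_act[OF ev_linear[OF q] ij(1-3) uT[OF ij(1,4)]]
      op_linear_act[OF ev_linear[OF a] ij] op_linear_act[OF ev_linear[OF b] ij]
    show "u (act W r m) = act P r (u m)"
      by (rule is_product_inj[OF P])
        (simp_all add: mW u eqs T_carrier[OF O(1) ij(2) act_closed[OF O(1) ij(1-3) uT[OF ij(1,4)]]])
  qed (use O uT in auto)
  then obtain v where v: "v \<in> homs C W P" "\<forall>m \<in> carrier (Gr W). ev v m = u m"
    using ev_ex[OF O(4,1)] by blast
  have "p \<bullet> v = a" by (rule ev_inj[OF cmp_hom[OF v(1) p] a]) (use ev_cmp[OF v(1) p] v u in auto)
  moreover have "q \<bullet> v = b" by (rule ev_inj[OF cmp_hom[OF v(1) q] b]) (use ev_cmp[OF v(1) q] v u in auto)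
  ultimately show ?thesis using that v(1) by blast
qed

text \<open>In the abstract setting an arrow cannot be built from its linear map, so it is selected;
  by \<open>ev_inj\<close> there is only one candidate.\<close>

definition lift :: "'o \<Rightarrow> 'o \<Rightarrow> ('u \<Rightarrow> 'u) \<Rightarrow> 'm" where
  "lift A B \<phi> = (SOME f. f \<in> homs C A B \<and> (\<forall>m \<in> carrier (Gr A). ev f m = \<phi> m))"

lemma lift:
  assumes "A \<in> Obj C" "B \<in> Obj C" "op_linear A B \<phi>"
  shows "lift A B \<phi> \<in> homs C A B" "m \<in> carrier (Gr A) \<Longrightarrow> ev (lift A B \<phi>) m = \<phi> m"
proof -
  have "\<exists>f. f \<in> homs C A B \<and> (\<forall>m \<in> carrier (Gr A). ev f m = \<phi> m)" using ev_ex[OF assms] by blast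
  from someI_ex[OF this] show "lift A B \<phi> \<in> homs C A B" "m \<in> carrier (Gr A) \<Longrightarrow> ev (lift A B \<phi>) m = \<phi> m"
    unfolding lift_def by blast+
qed

definition hom_group :: "'o \<Rightarrow> 'o \<Rightarrow> 'm monoid" where
  "hom_group A B = \<lparr>carrier = homs C A B,
     monoid.mult = (\<lambda>f g. lift A B (\<lambda>m. ev f m \<otimes>\<^bsub>Gr B\<^esub> ev g m)), one = lift A B (\<lambda>_. \<one>\<^bsub>Gr B\<^esub>)\<rparr>"

lemma hom_group_one:
  assumes "A \<in> Obj C" "B \<in> Obj C"
  shows "\<one>\<^bsub>hom_group A B\<^esub> \<in> homs C A B"
    "m \<in> carrier (Gr A) \<Longrightarrow> ev (\<one>\<^bsub>hom_group A B\<^esub>) m = \<one>\<^bsub>Gr B\<^esub>"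
  using lift[OF assms op_linear_one[OF assms]] by (simp_all add: hom_group_def)

lemma hom_group_mult:
  assumes "f \<in> homs C A B" "g \<in> homs C A B"
  shows "f \<otimes>\<^bsub>hom_group A B\<^esub> g \<in> homs C A B"
    "m \<in> carrier (Gr A) \<Longrightarrow> ev (f \<otimes>\<^bsub>hom_group A B\<^esub> g) m = ev f m \<otimes>\<^bsub>Gr B\<^esub> ev g m"
  using lift[OF homs_obj[OF assms(1)] op_linear_prod[OF ev_linear[OF assms(1)] ev_linear[OF assms(2)]
      homs_obj[OF assms(1)]]] by (simp_all add: hom_group_def)

lemma comm_group_hom_group:
  assumes O: "A \<in> Obj C" "B \<in> Obj C"
  shows "comm_group (hom_group A B)"
proof -
  interpret B: comm_group "Gr B" using Gr_comm O by blast
  have [simp]: "carrier (hom_group A B) = homs C A B" by (simp add: hom_group_def)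
  show ?thesis
  proof (rule comm_groupI)
    fix f assume "f \<in> carrier (hom_group A B)"
    then have f: "f \<in> homs C A B" by simp
    note inv = lift[OF O op_linear_inv[OF ev_linear[OF f] O]]
    have "lift A B (\<lambda>m. inv\<^bsub>Gr B\<^esub> ev f m) \<otimes>\<^bsub>hom_group A B\<^esub> f = \<one>\<^bsub>hom_group A B\<^esub>"
      by (rule ev_inj[OF hom_group_mult(1)[OF inv(1) f] hom_group_one(1)[OF O]])
        (simp add: hom_group_mult[OF inv(1) f] hom_group_one[OF O] inv ev_closed[OF f])
    then show "\<exists>y \<in> carrier (hom_group A B). y \<otimes>\<^bsub>hom_group A B\<^esub> f = \<one>\<^bsub>hom_group A B\<^esub>"
      using inv(1) by auto
    show "\<one>\<^bsub>hom_group A B\<^esub> \<otimes>\<^bsub>hom_group A B\<^esub> f = f"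
      by (rule ev_inj[OF hom_group_mult(1)[OF hom_group_one(1)[OF O] f] f])
        (simp add: hom_group_mult[OF hom_group_one(1)[OF O] f] hom_group_one[OF O] ev_closed[OF f])
  next
    fix f g assume "f \<in> carrier (hom_group A B)" "g \<in> carrier (hom_group A B)"
    then have fg: "f \<in> homs C A B" "g \<in> homs C A B" by simp_all
    show "f \<otimes>\<^bsub>hom_group A B\<^esub> g = g \<otimes>\<^bsub>hom_group A B\<^esub> f"
      by (rule ev_inj[OF hom_group_mult(1)[OF fg] hom_group_mult(1)[OF fg(2,1)]])
        (simp add: hom_group_mult fg B.m_comm ev_closed[OF fg(1)] ev_closed[OF fg(2)])
    show "f \<otimes>\<^bsub>hom_group A B\<^esub> g \<in> carrier (hom_group A B)" using hom_group_mult(1)[OF fg] by simp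
    fix h assume "h \<in> carrier (hom_group A B)"
    then have h: "h \<in> homs C A B" by simp
    note fgh = hom_group_mult[OF hom_group_mult(1)[OF fg] h]
      hom_group_mult[OF fg(1) hom_group_mult(1)[OF fg(2) h]]
    show "f \<otimes>\<^bsub>hom_group A B\<^esub> g \<otimes>\<^bsub>hom_group A B\<^esub> h = f \<otimes>\<^bsub>hom_group A B\<^esub> (g \<otimes>\<^bsub>hom_group A B\<^esub> h)"
      by (rule ev_inj[OF fgh(1,3)])
        (simp add: fgh hom_group_mult[OF fg] hom_group_mult[OF fg(2) h]
          B.m_assoc ev_closed[OF fg(1)] ev_closed[OF fg(2)] ev_closed[OF h])
  qed (use hom_group_one[OF O] in simp)
qed

lemma preadditive_hom_group: "preadditive C hom_group"
  unfolding preadditive_def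
proof (intro conjI ballI)
  show "category C" by (rule category_axioms)
  fix A B assume O: "A \<in> Obj C" "B \<in> Obj C"
  show "comm_group (hom_group A B)" by (rule comm_group_hom_group[OF O])
  show "carrier (hom_group A B) = homs C A B" by (simp add: hom_group_def)
  fix D f f' g g' assume f: "f \<in> homs C A B" "f' \<in> homs C A B" and g: "g \<in> homs C B D" "g' \<in> homs C B D"
  note c = cmp_hom[OF f(1) g(1)] cmp_hom[OF f(2) g(1)] cmp_hom[OF f(1) g(2)]
  note ff = hom_group_mult[OF f] and gg = hom_group_mult[OF g]
  show "g \<bullet> (f \<otimes>\<^bsub>hom_group A B\<^esub> f') = (g \<bullet> f) \<otimes>\<^bsub>hom_group A D\<^esub> (g \<bullet> f')"
    by (rule ev_inj[OF cmp_hom[OF ff(1) g(1)] hom_group_mult(1)[OF c(1,2)]])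
      (simp add: ev_cmp[OF ff(1) g(1)] hom_group_mult[OF c(1,2)] ev_cmp[OF f(1) g(1)] ev_cmp[OF f(2) g(1)]
        ff op_linear_mult[OF ev_linear[OF g(1)]] ev_closed[OF f(1)] ev_closed[OF f(2)])
  show "(g \<otimes>\<^bsub>hom_group B D\<^esub> g') \<bullet> f = (g \<bullet> f) \<otimes>\<^bsub>hom_group A D\<^esub> (g' \<bullet> f)"
    by (rule ev_inj[OF cmp_hom[OF f(1) gg(1)] hom_group_mult(1)[OF c(1,3)]])
      (simp add: ev_cmp[OF f(1) gg(1)] hom_group_mult[OF c(1,3)] ev_cmp[OF f(1) g(1)] ev_cmp[OF f(1) g(2)]
        gg ev_closed[OF f(1)])
qed

lemma biproduct_hom_group:
  assumes P: "is_product A B P p q"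
  shows "biproduct C hom_group A B P"
proof -
  have p: "p \<in> homs C P A" and q: "q \<in> homs C P B" using P by (auto simp: is_product_def)
  have O: "P \<in> Obj C" "A \<in> Obj C" "B \<in> Obj C" using homs_obj p q by blast+
  interpret A: comm_group "Gr A" using Gr_comm O by blast
  interpret B: comm_group "Gr B" using Gr_comm O by blast
  obtain i where i: "i \<in> homs C A P" "p \<bullet> i = Ident C A" "q \<bullet> i = \<one>\<^bsub>hom_group A B\<^esub>"
    using is_product_factor[OF P ident_hom[OF O(2)] hom_group_one(1)[OF O(2,3)]] by blast
  obtain j where j: "j \<in> homs C B P" "p \<bullet> j = \<one>\<^bsub>hom_group B A\<^esub>" "q \<bullet> j = Ident C B"
    using is_product_factor[OF P hom_group_one(1)[OF O(3,2)] ident_hom[OF O(3)]] by blast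
  note ip = cmp_hom[OF p i(1)] and jq = cmp_hom[OF q j(1)]
  note s = hom_group_mult[OF ip jq]
  have pi: "ev p (ev i m) = m" "ev q (ev i m) = \<one>\<^bsub>Gr B\<^esub>" if "m \<in> carrier (Gr A)" for m
    using ev_cmp[OF i(1) p that] ev_cmp[OF i(1) q that] i ev_ident[OF O(2) that] hom_group_one[OF O(2,3)] that
    by simp_all
  have qj: "ev q (ev j m) = m" "ev p (ev j m) = \<one>\<^bsub>Gr A\<^esub>" if "m \<in> carrier (Gr B)" for m
    using ev_cmp[OF j(1) q that] ev_cmp[OF j(1) p that] j ev_ident[OF O(3) that] hom_group_one[OF O(3,2)] that
    by simp_all
  have "(i \<bullet> p) \<otimes>\<^bsub>hom_group P P\<^esub> (j \<bullet> q) = Ident C P"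
  proof (rule ev_inj[OF s(1) ident_hom[OF O(1)]])
    fix m assume m: "m \<in> carrier (Gr P)"
    have pm: "ev p m \<in> carrier (Gr A)" "ev q m \<in> carrier (Gr B)" using ev_closed p q m by blast+
    have cl: "ev i (ev p m) \<in> carrier (Gr P)" "ev j (ev q m) \<in> carrier (Gr P)"
      using ev_closed[OF i(1) pm(1)] ev_closed[OF j(1) pm(2)] by blast+
    have "ev ((i \<bullet> p) \<otimes>\<^bsub>hom_group P P\<^esub> (j \<bullet> q)) m = ev i (ev p m) \<otimes>\<^bsub>Gr P\<^esub> ev j (ev q m)"
      by (simp add: s m ev_cmp[OF p i(1)] ev_cmp[OF q j(1)])
    also have "\<dots> = m"
    proof (rule is_product_inj[OF P _ m])
      interpret P: comm_group "Gr P" using Gr_comm O by blast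
      show "ev i (ev p m) \<otimes>\<^bsub>Gr P\<^esub> ev j (ev q m) \<in> carrier (Gr P)" using cl by simp
    qed (simp_all add: op_linear_mult[OF ev_linear[OF p] cl] op_linear_mult[OF ev_linear[OF q] cl] pi qj pm)
    finally show "ev ((i \<bullet> p) \<otimes>\<^bsub>hom_group P P\<^esub> (j \<bullet> q)) m = ev (Ident C P) m"
      using ev_ident[OF O(1) m] by simp
  qed
  then show ?thesis unfolding biproduct_def using O p q i j by blast
qed

lemma is_product_ex:
  assumes "A \<in> Obj C" "B \<in> Obj C" obtains P p q where "is_product A B P p q"
  using product_ex[OF assms] unfolding is_product_def by blast

lemma additive: "additive_category C"
proof -
  have "\<exists>Z. zero_object C Z" using zero_ex zero_object_iff by blast
  moreover have "\<exists>P. biproduct C hom_group A B P" if "A \<in> Obj C" "B \<in> Obj C" for A B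
    using is_product_ex[OF that] biproduct_hom_group by metis
  ultimately show ?thesis unfolding additive_category_def using preadditive_hom_group by blast
qed

text \<open>Every arrow has a levelwise kernel to be paired with, so a deflation is constrained by
  surjectivity at each level and by nothing else.\<close>

lemma deflation_iff:
  assumes p: "p \<in> homs C A B"
  shows "deflation {(k, p). exact_pair k p} p \<longleftrightarrow> (\<forall>i \<in> I. ev p ` T A i = T B i)"
proof
  assume "deflation {(k, p). exact_pair k p} p"
  then show "\<forall>i \<in> I. ev p ` T A i = T B i"
    using homs_arr[OF p] unfolding deflation_def exact_pair_def by blast
next
  assume *: "\<forall>i \<in> I. ev p ` T A i = T B i"
  obtain D k where "k \<in> homs C D A" "inj_on (ev k) (carrier (Gr D))"
      "\<forall>i \<in> I. ev k ` T D i = {m \<in> T A i. ev p m = \<one>\<^bsub>Gr B\<^esub>}"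
    using kernel_ex[OF p] by blast
  then have "exact_pair k p"
    using * homs_arr[OF p] homs_arr[of k D A] by (simp add: exact_pair_def)
  then show "deflation {(k, p). exact_pair k p} p" unfolding deflation_def by blast
qed

lemma deflation_arr:
  "deflation {(k, p). exact_pair k p} p \<Longrightarrow> p \<in> homs C (Dom C p) (Cod C p)"
  by (auto simp: deflation_def exact_pair_def homs_def)

text \<open>The pullback is the kernel of \<open>\<delta>\<close>, the difference of
  \<open>p \<bullet> a\<close> and \<open>f \<bullet> b\<close> on the product (written
  multiplicatively), so it exists for any two arrows with common target. Surjectivity of
  \<open>p\<close> passes to the pullback level by level: for y at level i lift
  \<open>ev f y\<close> to some x at level i; the element of the product with coordinates x and y is
  in level i and in the kernel.\<close>

lemma deflation_pullback_ex:
  assumes p: "p \<in> homs C A B" and f: "f \<in> homs C Y B"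
  obtains P p' f' where "is_pullback C p f p' f'" "p' \<in> homs C P Y" "f' \<in> homs C P A"
    "(\<forall>i \<in> I. ev p ` T A i = T B i) \<longrightarrow> (\<forall>i \<in> I. ev p' ` T P i = T Y i)"
proof -
  have O: "A \<in> Obj C" "B \<in> Obj C" "Y \<in> Obj C" using homs_obj p f by blast+
  interpret B: comm_group "Gr B" using Gr_comm O by blast
  obtain D a b where D: "is_product A Y D a b" using is_product_ex O by blast
  then have a: "a \<in> homs C D A" and b: "b \<in> homs C D Y" by (auto simp: is_product_def)
  have OD: "D \<in> Obj C" using homs_obj a by blast
  note pa = cmp_hom[OF a p] and fb = cmp_hom[OF b f]
  note lin = op_linear_prod[OF ev_linear[OF pa] op_linear_inv[OF ev_linear[OF fb] OD O(2)] OD O(2)]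
  note d = lift[OF OD O(2) lin]
  define \<delta> where "\<delta> = lift D B (\<lambda>m. ev (p \<bullet> a) m \<otimes>\<^bsub>Gr B\<^esub> inv\<^bsub>Gr B\<^esub> ev (f \<bullet> b) m)"
  have \<delta>: "\<delta> \<in> homs C D B" unfolding \<delta>_def by (rule d(1))
  have cl: "ev p (ev a m) \<in> carrier (Gr B)" "ev f (ev b m) \<in> carrier (Gr B)" if "m \<in> carrier (Gr D)" for m
    using ev_closed[OF p ev_closed[OF a that]] ev_closed[OF f ev_closed[OF b that]] by blast+
  have \<delta>0: "ev \<delta> m = \<one>\<^bsub>Gr B\<^esub> \<longleftrightarrow> ev p (ev a m) = ev f (ev b m)" if "m \<in> carrier (Gr D)" for m
    unfolding \<delta>_def d(2)[OF that] ev_cmp[OF a p that] ev_cmp[OF b f that]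
    using cl[OF that] by (metis B.inv_closed B.inv_equality B.inv_inv B.r_inv)
  obtain P k where k: "k \<in> homs C P D" "inj_on (ev k) (carrier (Gr P))"
    and im: "\<And>i. i \<in> I \<Longrightarrow> ev k ` T P i = {m \<in> T D i. ev \<delta> m = \<one>\<^bsub>Gr B\<^esub>}"
    using kernel_ex[OF \<delta>] by blast
  have OP: "P \<in> Obj C" using homs_obj k by blast
  note ak = cmp_hom[OF k(1) a] and bk = cmp_hom[OF k(1) b]
  have kd: "ev p (ev a (ev k m)) = ev f (ev b (ev k m))" if "m \<in> carrier (Gr P)" for m
  proof -
    have "ev k m \<in> ev k ` T P top" using that T_top OP by blast
    then have "ev \<delta> (ev k m) = \<one>\<^bsub>Gr B\<^esub>" using im[OF top_in] by blast
    then show ?thesis using \<delta>0[OF ev_closed[OF k(1) that]] by blast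
  qed
  have comm: "p \<bullet> (a \<bullet> k) = f \<bullet> (b \<bullet> k)"
    by (rule ev_inj[OF cmp_hom[OF ak p] cmp_hom[OF bk f]])
      (simp add: ev_cmp[OF ak p] ev_cmp[OF bk f] ev_cmp[OF k(1) a] ev_cmp[OF k(1) b] kd)
  have univ: "\<exists>!u. u \<in> homs C W P \<and> (a \<bullet> k) \<bullet> u = x \<and> (b \<bullet> k) \<bullet> u = y"
    if x: "x \<in> homs C W A" and y: "y \<in> homs C W Y" and xy: "p \<bullet> x = f \<bullet> y" for W x y
  proof -
    have W: "W \<in> Obj C" using homs_obj x by blast
    obtain v where v: "v \<in> homs C W D" "a \<bullet> v = x" "b \<bullet> v = y" using is_product_factor[OF D x y] .
    have "ev v m \<in> ev k ` T P i" if i: "i \<in> I" and m: "m \<in> T W i" for i m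
    proof -
      have mW: "m \<in> carrier (Gr W)" using T_carrier[OF W i m] .
      have "ev p (ev a (ev v m)) = ev f (ev b (ev v m))"
        using ev_cmp[OF v(1) a mW] ev_cmp[OF v(1) b mW] v ev_cmp[OF x p mW] ev_cmp[OF y f mW] xy by simp
      then show ?thesis unfolding im[OF i] using \<delta>0[OF ev_closed[OF v(1) mW]] ev_T[OF v(1) i m] by blast
    qed
    then have ex1: "\<exists>!u. u \<in> homs C W P \<and> k \<bullet> u = v" by (intro factor_mono[OF k v(1)]) blast
    then obtain u where u: "u \<in> homs C W P" "k \<bullet> u = v" by blast
    show ?thesis
    proof (rule ex1I[of _ u])
      show "u \<in> homs C W P \<and> (a \<bullet> k) \<bullet> u = x \<and> (b \<bullet> k) \<bullet> u = y"
        using u v cmp_assoc[OF u(1) k(1) a] cmp_assoc[OF u(1) k(1) b] by simp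
      fix w assume "w \<in> homs C W P \<and> (a \<bullet> k) \<bullet> w = x \<and> (b \<bullet> k) \<bullet> w = y"
      then have w: "w \<in> homs C W P" "a \<bullet> (k \<bullet> w) = x" "b \<bullet> (k \<bullet> w) = y"
        using cmp_assoc[OF _ k(1) a] cmp_assoc[OF _ k(1) b] by auto
      note kw = cmp_hom[OF w(1) k(1)]
      have "k \<bullet> w = v"
      proof (rule ev_inj[OF kw v(1)])
        fix m assume m: "m \<in> carrier (Gr W)"
        show "ev (k \<bullet> w) m = ev v m"
          by (rule is_product_inj[OF D ev_closed[OF kw m] ev_closed[OF v(1) m]])
            (use ev_cmp[OF kw a m] ev_cmp[OF kw b m] ev_cmp[OF v(1) a m] ev_cmp[OF v(1) b m] w v in simp_all)
      qed
      then show "w = u" using ex1 u w(1) by blast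
    qed
  qed
  have "is_pullback C p f (b \<bullet> k) (a \<bullet> k)"
    unfolding is_pullback_def using homs_arr[OF p] homs_arr[OF f] homs_arr[OF ak] homs_arr[OF bk] comm
  proof (intro conjI ballI impI)
    fix x y assume "x \<in> Arr C" "y \<in> Arr C"
      and "Dom C x = Dom C y \<and> Cod C x = Dom C p \<and> Cod C y = Dom C f \<and> p \<bullet> x = f \<bullet> y"
    then have "x \<in> homs C (Dom C x) A" "y \<in> homs C (Dom C x) Y" "p \<bullet> x = f \<bullet> y"
      using homs_arr[OF p] homs_arr[OF f] by (auto simp: homs_def)
    from univ[OF this] show "\<exists>!u. u \<in> homs C (Dom C x) (Dom C (b \<bullet> k)) \<and> (a \<bullet> k) \<bullet> u = x \<and> (b \<bullet> k) \<bullet> u = y"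
      using homs_arr[OF bk] by simp
  qed simp_all
  moreover have "\<forall>i \<in> I. ev (b \<bullet> k) ` T P i = T Y i" if surj: "\<forall>i \<in> I. ev p ` T A i = T B i"
  proof (intro ballI equalityI)
    fix i assume i: "i \<in> I"
    show "ev (b \<bullet> k) ` T P i \<subseteq> T Y i" using ev_T[OF bk i] by blast
    show "T Y i \<subseteq> ev (b \<bullet> k) ` T P i"
    proof
      fix y assume y: "y \<in> T Y i"
      have "ev f y \<in> ev p ` T A i" using surj i ev_T[OF f i y] by simp
      then obtain x where x: "x \<in> T A i" "ev p x = ev f y" by force
      obtain n where n: "n \<in> T D i" "ev a n = x" "ev b n = y" using is_product_surj[OF D i x(1) y] .
      have "ev \<delta> n = \<one>\<^bsub>Gr B\<^esub>" using \<delta>0[OF T_carrier[OF OD i n(1)]] n x by simp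
      then have "n \<in> ev k ` T P i" unfolding im[OF i] using n by simp
      then obtain m where m: "m \<in> T P i" "n = ev k m" by blast
      then have "ev (b \<bullet> k) m = y" using ev_cmp[OF k(1) b T_carrier[OF OP i m(1)]] n by simp
      then show "y \<in> ev (b \<bullet> k) ` T P i" using m by blast
    qed
  qed
  ultimately show ?thesis using that bk ak by blast
qed

lemma exact_pair_iso:
  assumes kp: "exact_pair k p" and k': "k' \<in> homs C D' A'" and p': "p' \<in> homs C A' B'"
    and a: "a \<in> homs C (Dom C k) D'" and b: "b \<in> homs C (Dom C p) A'" and c: "c \<in> homs C (Cod C p) B'"
    and iso: "iso_arr C a" "iso_arr C b" "iso_arr C c"
    and comm: "b \<bullet> k = k' \<bullet> a" "c \<bullet> p = p' \<bullet> b"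
  shows "exact_pair k' p'"
proof -
  define D A B where "D = Dom C k" "A = Dom C p" "B = Cod C p"
  have k: "k \<in> homs C D A" and p: "p \<in> homs C A B"
    using kp by (auto simp: exact_pair_def homs_def D_A_B_def)
  note abc = a[folded D_A_B_def] b[folded D_A_B_def] c[folded D_A_B_def]
  have O: "A \<in> Obj C" "B \<in> Obj C" "D \<in> Obj C" "D' \<in> Obj C" "A' \<in> Obj C" "B' \<in> Obj C"
    using homs_obj k p k' p' by blast+
  have inj: "inj_on (ev k) (carrier (Gr D))"
    and im: "\<And>i. i \<in> I \<Longrightarrow> ev k ` T D i = {m \<in> T A i. ev p m = \<one>\<^bsub>Gr B\<^esub>}"
    and surj: "\<And>i. i \<in> I \<Longrightarrow> ev p ` T A i = T B i"
    using kp by (auto simp: exact_pair_def D_A_B_def)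
  have ia: "inj_on (ev a) (carrier (Gr D))" "\<And>i. i \<in> I \<Longrightarrow> ev a ` T D i = T D' i"
    and ib: "inj_on (ev b) (carrier (Gr A))" "\<And>i. i \<in> I \<Longrightarrow> ev b ` T A i = T A' i"
    and ic: "inj_on (ev c) (carrier (Gr B))" "\<And>i. i \<in> I \<Longrightarrow> ev c ` T B i = T B' i"
    using iso iso_arr_iff[OF abc(1)] iso_arr_iff[OF abc(2)] iso_arr_iff[OF abc(3)] by blast+
  have bk: "ev b (ev k m) = ev k' (ev a m)" if "m \<in> carrier (Gr D)" for m
    using ev_cmp[OF k abc(2) that] ev_cmp[OF abc(1) k' that] comm by simp
  have cp: "ev c (ev p m) = ev p' (ev b m)" if "m \<in> carrier (Gr A)" for m
    using ev_cmp[OF p abc(3) that] ev_cmp[OF abc(2) p' that] comm by simp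
  have aD: "\<exists>n \<in> T D i. ev a n = m" if "i \<in> I" "m \<in> T D' i" for i m
    using ia(2)[OF that(1)] that(2) by (metis imageE)
  have "inj_on (ev k') (carrier (Gr D'))"
  proof (rule inj_onI)
    fix m n assume mn: "m \<in> carrier (Gr D')" "n \<in> carrier (Gr D')" "ev k' m = ev k' n"
    obtain m' n' where 1: "m' \<in> carrier (Gr D)" "ev a m' = m" "n' \<in> carrier (Gr D)" "ev a n' = n"
      using aD[OF top_in] mn(1,2) T_top O by metis
    then have "ev b (ev k m') = ev b (ev k n')" using bk mn by simp
    then have "ev k m' = ev k n'" using inj_onD[OF ib(1)] ev_closed[OF k] 1 by blast
    then show "m = n" using inj_onD[OF inj] 1 by blast
  qed
  moreover have "ev k' ` T D' i = {m \<in> T A' i. ev p' m = \<one>\<^bsub>Gr B'\<^esub>}" if i: "i \<in> I" for i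
  proof -
    have "ev k' ` T D' i = ev b ` ev k ` T D i"
      unfolding ia(2)[OF i, symmetric] image_image
      by (rule image_cong) (use bk T_carrier[OF O(3) i] in auto)
    also have "\<dots> = ev b ` {m \<in> T A i. ev p m = \<one>\<^bsub>Gr B\<^esub>}" unfolding im[OF i] ..
    also have "\<dots> = {m \<in> T A' i. ev p' m = \<one>\<^bsub>Gr B'\<^esub>}"
    proof -
      have "ev p m = \<one>\<^bsub>Gr B\<^esub> \<longleftrightarrow> ev p' (ev b m) = \<one>\<^bsub>Gr B'\<^esub>" if m: "m \<in> T A i" for m
      proof -
        have mA: "m \<in> carrier (Gr A)" using T_carrier[OF O(1) i m] .
        show ?thesis
          using cp[OF mA] ev_one[OF abc(3)] inj_onD[OF ic(1)] ev_closed[OF p mA] one_carrier[OF O(2)] by metis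
      qed
      then show ?thesis unfolding ib(2)[OF i, symmetric] by auto
    qed
    finally show ?thesis .
  qed
  moreover have "ev p' ` T A' i = T B' i" if i: "i \<in> I" for i
  proof -
    have "ev p' ` T A' i = ev c ` ev p ` T A i"
      unfolding ib(2)[OF i, symmetric] image_image
      by (rule image_cong) (use cp T_carrier[OF O(1) i] in auto)
    then show ?thesis by (simp add: surj ic i)
  qed
  ultimately show ?thesis
    unfolding exact_pair_def using homs_arr[OF k'] homs_arr[OF p'] by simp
qed

theorem deflation_exact: "deflation_exact_category C {(k, p). exact_pair k p}"
proof
  show "additive_category C" by (rule additive)
  show "{(k, p). exact_pair k p} \<subseteq> kernel_cokernel_pairs C"
    using exact_pair_kernel_cokernel by auto
next
  fix k p k' p' a b c
  assume "(k, p) \<in> {(k, p). exact_pair k p}" "k' \<in> Arr C" "p' \<in> Arr C" "Cod C k' = Dom C p'"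
    "a \<in> homs C (Dom C k) (Dom C k')" "b \<in> homs C (Dom C p) (Dom C p')" "c \<in> homs C (Cod C p) (Cod C p')"
    "iso_arr C a" "iso_arr C b" "iso_arr C c" "b \<bullet> k = k' \<bullet> a" "c \<bullet> p = p' \<bullet> b"
  then show "(k', p') \<in> {(k, p). exact_pair k p}"
    using exact_pair_iso[of k p k' "Dom C k'" "Dom C p'" p' "Cod C p'" a b c] by (simp add: homs_def)
next
  fix Z assume "zero_object C Z"
  then have Z: "Z \<in> Obj C" by (simp add: zero_object_def)
  have "ev (Ident C Z) ` T Z i = T Z i" if "i \<in> I" for i
    using ev_ident[OF Z T_carrier[OF Z that]] by (simp add: image_cong)
  then show "deflation {(k, p). exact_pair k p} (Ident C Z)"
    using deflation_iff[OF ident_hom[OF Z]] by blast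
next
  fix p q assume pq: "deflation {(k, p). exact_pair k p} p" "deflation {(k, p). exact_pair k p} q"
    "Cod C p = Dom C q"
  have p: "p \<in> homs C (Dom C p) (Dom C q)" and q: "q \<in> homs C (Dom C q) (Cod C q)"
    using deflation_arr[OF pq(1)] deflation_arr[OF pq(2)] pq(3) by simp_all
  have "ev (q \<bullet> p) ` T (Dom C p) i = T (Cod C q) i" if i: "i \<in> I" for i
  proof -
    have "ev (q \<bullet> p) ` T (Dom C p) i = ev q ` ev p ` T (Dom C p) i"
      unfolding image_image
      by (rule image_cong) (use ev_cmp[OF p q] T_carrier[OF homs_obj(1)[OF p] i] in auto)
    then show ?thesis
      using pq(1,2) i deflation_iff[OF p] deflation_iff[OF q] by simp
  qed
  then show "deflation {(k, p). exact_pair k p} (q \<bullet> p)" using deflation_iff[OF cmp_hom[OF p q]] by blast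
next
  fix p f assume "deflation {(k, p). exact_pair k p} p" "f \<in> Arr C" "Cod C f = Cod C p"
  then show "\<exists>p' f'. is_pullback C p f p' f'"
    using deflation_pullback_ex[of p "Dom C p" "Cod C p" f "Dom C f"] deflation_arr by (metis homs_self)
next
  fix p f p' f' assume d: "deflation {(k, p). exact_pair k p} p" and pb: "is_pullback C p f p' f'"
  have p: "p \<in> homs C (Dom C p) (Cod C p)" using deflation_arr[OF d] .
  have f: "f \<in> homs C (Dom C f) (Cod C p)" and p': "p' \<in> homs C (Dom C p') (Dom C f)"
    using pb by (auto simp: is_pullback_def homs_def)
  \<comment> \<open>The given pullback is arbitrary, so it is compared with the constructed one: the
    levelwise surjection \<open>q'\<close> factors through \<open>p'\<close>, which is therefore
    levelwise surjective too.\<close>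
  obtain P q' g' where Q: "is_pullback C p f q' g'" "q' \<in> homs C P (Dom C f)" "g' \<in> homs C P (Dom C p)"
    and surj: "(\<forall>i \<in> I. ev p ` T (Dom C p) i = T (Cod C p) i) \<longrightarrow> (\<forall>i \<in> I. ev q' ` T P i = T (Dom C f) i)"
    by (rule deflation_pullback_ex[OF p f])
  have "p \<bullet> g' = f \<bullet> q'" using Q(1) by (simp add: is_pullback_def)
  then obtain u where u: "u \<in> homs C P (Dom C p')" "p' \<bullet> u = q'"
    using is_pullback_factor[OF pb Q(3,2)] by blast
  have "ev p' ` T (Dom C p') i = T (Dom C f) i" if i: "i \<in> I" for i
  proof
    show "ev p' ` T (Dom C p') i \<subseteq> T (Dom C f) i" using ev_T[OF p' i] by blast
    have "ev q' m \<in> ev p' ` T (Dom C p') i" if "m \<in> T P i" for m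
      using ev_cmp[OF u(1) p' T_carrier[OF homs_obj(1)[OF u(1)] i that]] u(2) ev_T[OF u(1) i that] by auto
    moreover have "T (Dom C f) i = ev q' ` T P i" using surj d deflation_iff[OF p] i by simp
    ultimately show "T (Dom C f) i \<subseteq> ev p' ` T (Dom C p') i" by auto
  qed
  then show "deflation {(k, p). exact_pair k p} p'" using deflation_iff[OF p'] by blast
qed

end

section \<open>Pregliders\<close>

text \<open>A preglider in embedded form: all values are subsets of one module, and each structure
  map is the action of its ring element regardless of source and target. The structure maps of 1 are
  then inclusions.\<close>

definition preglid_of :: "'u monoid \<Rightarrow> ('r \<Rightarrow> 'u \<Rightarrow> 'u) \<Rightarrow> ('g point \<Rightarrow> 'u set) \<Rightarrow> ('g, 'r, 'u) filt_mod" where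
  "preglid_of G a S = \<lparr>Fob = (\<lambda>x. G\<lparr>carrier := S x\<rparr>), Fmap = (\<lambda>(x, r, y). a r)\<rparr>"

text \<open>A preglider \<open>A\<close> is determined up to isomorphism by the module \<open>Om A\<close> with its action
  \<open>act A\<close> and by the images \<open>sub A x\<close> of the groups \<open>A x\<close> in \<open>Om A\<close>.\<close>

abbreviation Om :: "('g, 'r, 'u) filt_mod \<Rightarrow> 'u monoid" where
  "Om A \<equiv> Fob A Infty"

definition act :: "('g, 'r, 'u) filt_mod \<Rightarrow> 'r \<Rightarrow> 'u \<Rightarrow> 'u" where
  "act A r = Fmap A (Infty, r, Infty)"

definition hinf :: "('g, 'r, 'u) filt_mod_arr \<Rightarrow> 'u \<Rightarrow> 'u" where
  "hinf f = fst (snd f) Infty"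

text \<open>\<open>pair\<close> codes pairs of elements of the universe by single elements, so that
  direct products and graphs of maps are again pregliders over the type \<open>'u\<close>.\<close>

locale glider_setup = filtered_ring \<Gamma> leq R F
  for \<Gamma> :: "('g, 'a) monoid_scheme" and leq :: "('g \<times> 'g) set"
    and R :: "('r, 'b) ring_scheme" and F :: "'g \<Rightarrow> 'r set" +
  fixes \<Lambda> :: "'g set" and z :: 'g and pair :: "'u \<times> 'u \<Rightarrow> 'u"
  assumes \<Lambda>_sub: "\<Lambda> \<subseteq> carrier \<Gamma>"
    and z: "z \<in> \<Lambda>" and greatest: "\<alpha> \<in> \<Lambda> \<Longrightarrow> (\<alpha>, z) \<in> leq"
    and pair_inj: "inj pair"
begin

abbreviation Pts where "Pts \<equiv> insert Infty (Pt ` \<Lambda>)"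
abbreviation H where "H \<equiv> filt_homs \<Gamma> leq R F"
abbreviation PG :: "(('g, 'r, 'u) filt_mod, ('g, 'r, 'u) filt_mod_arr) category" where
  "PG \<equiv> Preglid \<Gamma> leq R F \<Lambda>"

definition inc :: "('g, 'r, 'u) filt_mod \<Rightarrow> 'g point \<Rightarrow> 'u \<Rightarrow> 'u" where
  "inc A x = Fmap A (x, \<one>\<^bsub>R\<^esub>, Infty)"

definition sub :: "('g, 'r, 'u) filt_mod \<Rightarrow> 'g point \<Rightarrow> 'u set" where
  "sub A x = inc A x ` carrier (Fob A x)"

lemma F_carrier: "\<alpha> \<in> \<Lambda> \<Longrightarrow> \<beta> \<in> \<Lambda> \<Longrightarrow> r \<in> F (\<beta> \<otimes>\<^bsub>\<Gamma>\<^esub> inv\<^bsub>\<Gamma>\<^esub> \<alpha>) \<Longrightarrow> r \<in> carrier R"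
  using additive_subgroup.a_subset[OF filt_subgroup] \<Lambda>_sub by (meson inv_closed m_closed subset_iff)

lemma H_carrier: "x \<in> Pts \<Longrightarrow> y \<in> Pts \<Longrightarrow> r \<in> H x y \<Longrightarrow> r \<in> carrier R"
  using F_carrier by (cases x; cases y) (auto split: if_splits)

lemma H_Infty: "r \<in> carrier R \<Longrightarrow> r \<in> H x Infty"
  by simp

text \<open>Multiplying \<alpha> \<le> \<beta> by the inverse of \<alpha> shows that the degree
  \<open>\<beta> \<otimes> inv \<alpha>\<close> is at least the unit of \<Gamma>, where 1
  lives.\<close>

lemma one_F: "(\<alpha>, \<beta>) \<in> leq \<Longrightarrow> \<alpha> \<in> \<Lambda> \<Longrightarrow> \<beta> \<in> \<Lambda> \<Longrightarrow> \<one>\<^bsub>R\<^esub> \<in> F (\<beta> \<otimes>\<^bsub>\<Gamma>\<^esub> inv\<^bsub>\<Gamma>\<^esub> \<alpha>)"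
proof -
  assume \<alpha>\<beta>: "(\<alpha>, \<beta>) \<in> leq" "\<alpha> \<in> \<Lambda>" "\<beta> \<in> \<Lambda>"
  then have c: "\<alpha> \<in> carrier \<Gamma>" "\<beta> \<in> carrier \<Gamma>" using \<Lambda>_sub by blast+
  then have "(inv\<^bsub>\<Gamma>\<^esub> \<alpha>, inv\<^bsub>\<Gamma>\<^esub> \<alpha>) \<in> leq"
    using partial_order_onD(1)[OF partial_order] by (auto simp: refl_on_def)
  then have "(\<alpha> \<otimes>\<^bsub>\<Gamma>\<^esub> inv\<^bsub>\<Gamma>\<^esub> \<alpha>, \<beta> \<otimes>\<^bsub>\<Gamma>\<^esub> inv\<^bsub>\<Gamma>\<^esub> \<alpha>) \<in> leq" using mult_mono \<alpha>\<beta> by blast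
  then have "F \<one>\<^bsub>\<Gamma>\<^esub> \<subseteq> F (\<beta> \<otimes>\<^bsub>\<Gamma>\<^esub> inv\<^bsub>\<Gamma>\<^esub> \<alpha>)" using filt_mono c by simp
  then show ?thesis using filt_one by blast
qed

section \<open>Pregliders as modules with stable families of subgroups\<close>

definition rmod :: "'u monoid \<Rightarrow> ('r \<Rightarrow> 'u \<Rightarrow> 'u) \<Rightarrow> bool" where
  "rmod G a \<longleftrightarrow> comm_group G \<and>
     (\<forall>r \<in> carrier R. a r \<in> hom G G) \<and> (\<forall>m \<in> carrier G. a \<one>\<^bsub>R\<^esub> m = m) \<and>
     (\<forall>r \<in> carrier R. \<forall>s \<in> carrier R. \<forall>m \<in> carrier G. a (s \<otimes>\<^bsub>R\<^esub> r) m = a s (a r m)) \<and>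
     (\<forall>r \<in> carrier R. \<forall>s \<in> carrier R. \<forall>m \<in> carrier G. a (r \<oplus>\<^bsub>R\<^esub> s) m = a r m \<otimes>\<^bsub>G\<^esub> a s m)"

definition stable :: "'u monoid \<Rightarrow> ('r \<Rightarrow> 'u \<Rightarrow> 'u) \<Rightarrow> ('g point \<Rightarrow> 'u set) \<Rightarrow> bool" where
  "stable G a S \<longleftrightarrow> S Infty = carrier G \<and> (\<forall>x \<in> Pts. subgroup (S x) G) \<and>
     (\<forall>x \<in> Pts. \<forall>y \<in> Pts. \<forall>r \<in> H x y. \<forall>m \<in> S x. a r m \<in> S y)"

lemma rmodD:
  assumes "rmod G a"
  shows "comm_group G" "r \<in> carrier R \<Longrightarrow> a r \<in> hom G G" "m \<in> carrier G \<Longrightarrow> a \<one>\<^bsub>R\<^esub> m = m"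
    "r \<in> carrier R \<Longrightarrow> s \<in> carrier R \<Longrightarrow> m \<in> carrier G \<Longrightarrow> a (s \<otimes>\<^bsub>R\<^esub> r) m = a s (a r m)"
    "r \<in> carrier R \<Longrightarrow> s \<in> carrier R \<Longrightarrow> m \<in> carrier G \<Longrightarrow> a (r \<oplus>\<^bsub>R\<^esub> s) m = a r m \<otimes>\<^bsub>G\<^esub> a s m"
    "r \<in> carrier R \<Longrightarrow> m \<in> carrier G \<Longrightarrow> a r m \<in> carrier G"
    "r \<in> carrier R \<Longrightarrow> m \<in> carrier G \<Longrightarrow> n \<in> carrier G \<Longrightarrow> a r (m \<otimes>\<^bsub>G\<^esub> n) = a r m \<otimes>\<^bsub>G\<^esub> a r n"
  using assms unfolding rmod_def hom_def by blast+

lemma rmod_zero: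
  assumes "rmod G a" "m \<in> carrier G" shows "a \<zero>\<^bsub>R\<^esub> m = \<one>\<^bsub>G\<^esub>"
proof -
  interpret G: comm_group G using rmodD(1)[OF assms(1)] .
  have "a \<zero>\<^bsub>R\<^esub> m \<in> carrier G" using rmodD(6)[OF assms(1)] assms(2) by simp
  moreover have "a \<zero>\<^bsub>R\<^esub> m = a \<zero>\<^bsub>R\<^esub> m \<otimes>\<^bsub>G\<^esub> a \<zero>\<^bsub>R\<^esub> m"
    using rmodD(5)[OF assms(1), of "\<zero>\<^bsub>R\<^esub>" "\<zero>\<^bsub>R\<^esub>" m] assms(2) by simp
  ultimately show ?thesis by simp
qed

text \<open>The remaining arrows impose nothing: those into \<open>Infty\<close> land in the whole
  module, while an arrow from \<open>Infty\<close> to a point, or between points that are not in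
  order, is 0 and acts as the constant map to the unit.\<close>

lemma stableI:
  assumes "rmod G a" and S: "S Infty = carrier G" "\<And>\<alpha>. \<alpha> \<in> \<Lambda> \<Longrightarrow> subgroup (S (Pt \<alpha>)) G"
    and act: "\<And>\<alpha> \<beta> r m. \<alpha> \<in> \<Lambda> \<Longrightarrow> \<beta> \<in> \<Lambda> \<Longrightarrow> (\<alpha>, \<beta>) \<in> leq \<Longrightarrow> r \<in> F (\<beta> \<otimes>\<^bsub>\<Gamma>\<^esub> inv\<^bsub>\<Gamma>\<^esub> \<alpha>)
      \<Longrightarrow> m \<in> S (Pt \<alpha>) \<Longrightarrow> a r m \<in> S (Pt \<beta>)"
  shows "stable G a S"
proof -
  interpret G: comm_group G using rmodD(1)[OF assms(1)] .
  have sub: "subgroup (S x) G" if "x \<in> Pts" for x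
    using that S G.subgroup_self by auto
  have "a r m \<in> S y" if xy: "x \<in> Pts" "y \<in> Pts" and r: "r \<in> H x y" and m: "m \<in> S x" for x y r m
  proof -
    have mG: "m \<in> carrier G" using m subgroup.subset[OF sub[OF xy(1)]] by blast
    have zero: "a \<zero>\<^bsub>R\<^esub> m \<in> S y"
      using rmod_zero[OF assms(1) mG] subgroup.one_closed[OF sub[OF xy(2)]] by simp
    show ?thesis
    proof (cases y)
      case Infty
      then show ?thesis using rmodD(6)[OF assms(1) H_carrier[OF xy r] mG] S by simp
    next
      case y: (Pt \<beta>)
      show ?thesis
      proof (cases x)
        case Infty
        then show ?thesis using r zero y by simp
      next
        case (Pt \<alpha>)
        then show ?thesis using act[of \<alpha> \<beta> r m] xy r m zero y by (auto split: if_splits)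
      qed
    qed
  qed
  then show ?thesis unfolding stable_def using S(1) sub by blast
qed

lemma stableD:
  assumes "stable G a S"
  shows "S Infty = carrier G" "x \<in> Pts \<Longrightarrow> subgroup (S x) G"
    "x \<in> Pts \<Longrightarrow> y \<in> Pts \<Longrightarrow> r \<in> H x y \<Longrightarrow> m \<in> S x \<Longrightarrow> a r m \<in> S y"
    "x \<in> Pts \<Longrightarrow> m \<in> S x \<Longrightarrow> m \<in> carrier G"
  using assms subgroup.subset unfolding stable_def by blast+

lemma preglid_of_simps [simp]:
  "Fob (preglid_of G a S) x = G\<lparr>carrier := S x\<rparr>" "Fmap (preglid_of G a S) (x, r, y) = a r"
  "act (preglid_of G a S) = a" "inc (preglid_of G a S) x = a \<one>\<^bsub>R\<^esub>"
  by (simp_all add: preglid_of_def act_def inc_def fun_eq_iff)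

lemma Om_preglid_of: "stable G a S \<Longrightarrow> Om (preglid_of G a S) = G"
  by (simp add: stableD(1))

lemma sub_preglid_of:
  assumes "rmod G a" "stable G a S" "x \<in> Pts" shows "sub (preglid_of G a S) x = S x"
  using rmodD(3)[OF assms(1)] stableD(4)[OF assms(2,3)] by (simp add: sub_def)

lemma preglid_of_Obj:
  assumes G: "rmod G a" and S: "stable G a S"
  shows "preglid_of G a S \<in> Obj PG"
proof -
  let ?N = "preglid_of G a S"
  note car = stableD(4)[OF S]
  have hom: "a r \<in> hom (Fob ?N x) (Fob ?N y)" if "x \<in> Pts" "y \<in> Pts" "r \<in> H x y" for x y r
    using that stableD(3)[OF S that] car[OF that(1)] rmodD(7)[OF G H_carrier[OF that]] by (auto simp: hom_def)
  have one_H: "\<one>\<^bsub>R\<^esub> \<in> H (Pt \<alpha>) (Pt \<beta>)" if "\<alpha> \<in> \<Lambda>" "\<beta> \<in> \<Lambda>" "(\<alpha>, \<beta>) \<in> leq" for \<alpha> \<beta>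
    using one_F that by auto
  have one_mon: "a \<one>\<^bsub>R\<^esub> \<in> mon (Fob ?N x) (Fob ?N y)" if "x \<in> Pts" "y \<in> Pts" "\<one>\<^bsub>R\<^esub> \<in> H x y" for x y
    using hom[OF that] rmodD(3)[OF G] car[OF that(1)] by (simp add: mon_def inj_on_def)
  show ?thesis
    unfolding Preglid_Obj_iff
  proof (intro conjI ballI impI)
    show "comm_group (Fob ?N x)" if "x \<in> Pts" for x
      unfolding preglid_of_simps by (rule subgroup_comm_group[OF rmodD(1)[OF G] stableD(2)[OF S that]])
    show "Fmap ?N (x, r, y) \<in> hom (Fob ?N x) (Fob ?N y)" if "x \<in> Pts" "y \<in> Pts" "r \<in> H x y" for x y r
      using hom[OF that] by simp
    show "Fmap ?N (x, \<one>\<^bsub>R\<^esub>, x) m = m" if "x \<in> Pts" "m \<in> carrier (Fob ?N x)" for x m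
      using that rmodD(3)[OF G] car[OF that(1)] by simp
    show "Fmap ?N (x, s \<otimes>\<^bsub>R\<^esub> r, w) m = Fmap ?N (y, s, w) (Fmap ?N (x, r, y) m)"
      if "x \<in> Pts" "y \<in> Pts" "w \<in> Pts" "r \<in> H x y" "s \<in> H y w" "m \<in> carrier (Fob ?N x)" for x y w r s m
      using rmodD(4)[OF G H_carrier[OF that(1,2,4)] H_carrier[OF that(2,3,5)]] car[OF that(1)] that(6) by simp
    show "Fmap ?N (x, r \<oplus>\<^bsub>R\<^esub> s, y) m = Fmap ?N (x, r, y) m \<otimes>\<^bsub>Fob ?N y\<^esub> Fmap ?N (x, s, y) m"
      if "x \<in> Pts" "y \<in> Pts" "r \<in> H x y" "s \<in> H x y" "m \<in> carrier (Fob ?N x)" for x y r s m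
      using rmodD(5)[OF G H_carrier[OF that(1,2,3)] H_carrier[OF that(1,2,4)]] car[OF that(1)] that(5) by simp
    show "Fmap ?N (Pt \<alpha>, \<one>\<^bsub>R\<^esub>, Pt \<beta>) \<in> mon (Fob ?N (Pt \<alpha>)) (Fob ?N (Pt \<beta>))"
      if "\<alpha> \<in> \<Lambda>" "\<beta> \<in> \<Lambda>" "(\<alpha>, \<beta>) \<in> leq" for \<alpha> \<beta>
      unfolding preglid_of_simps(2) by (rule one_mon) (use one_H[OF that] that in auto)
    show "Fmap ?N (x, \<one>\<^bsub>R\<^esub>, Infty) \<in> mon (Fob ?N x) (Fob ?N Infty)" if "x \<in> Pts" for x
      unfolding preglid_of_simps(2) by (rule one_mon) (use that in auto)
  qed
qed

context
  fixes A assumes A: "A \<in> Obj PG"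
begin

lemma rmod_Obj: "rmod (Om A) (act A)"
  unfolding rmod_def act_def
  using Preglid_ObjD(1-5)[OF A, of Infty] by simp

lemma inc_hom: "x \<in> Pts \<Longrightarrow> inc A x \<in> hom (Fob A x) (Om A)"
  and inc_inj: "x \<in> Pts \<Longrightarrow> inj_on (inc A x) (carrier (Fob A x))"
  using Preglid_ObjD(6)[OF A] by (auto simp: mon_def inc_def)

lemma Fmap_hom: "x \<in> Pts \<Longrightarrow> y \<in> Pts \<Longrightarrow> r \<in> H x y \<Longrightarrow> Fmap A (x, r, y) \<in> hom (Fob A x) (Fob A y)"
  by (rule Preglid_ObjD(2)[OF A])

text \<open>Both sides are the structure map of r from x to \<open>Infty\<close>, since r = 1 r = r
  1. It turns the transition maps of A into multiplication by r inside \<open>Om A\<close>.\<close>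

lemma inc_Fmap:
  assumes "x \<in> Pts" "y \<in> Pts" "r \<in> H x y" "m \<in> carrier (Fob A x)"
  shows "inc A y (Fmap A (x, r, y) m) = act A r (inc A x m)"
proof -
  have r: "r \<in> carrier R" using H_carrier assms by blast
  have "inc A y (Fmap A (x, r, y) m) = Fmap A (x, \<one>\<^bsub>R\<^esub> \<otimes>\<^bsub>R\<^esub> r, Infty) m"
    unfolding inc_def by (rule Preglid_ObjD(4)[OF A]) (use assms in simp_all)
  moreover have "act A r (inc A x m) = Fmap A (x, r \<otimes>\<^bsub>R\<^esub> \<one>\<^bsub>R\<^esub>, Infty) m"
    unfolding inc_def act_def by (rule Preglid_ObjD(4)[OF A]) (use assms r in simp_all)
  ultimately show ?thesis using r by simp
qed

lemma inc_Infty: "m \<in> carrier (Om A) \<Longrightarrow> inc A Infty m = m"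
  unfolding inc_def by (rule Preglid_ObjD(3)[OF A]) auto

lemma sub_Infty: "sub A Infty = carrier (Om A)"
  using inc_Infty by (simp add: sub_def)

lemma group_hom_inc: "x \<in> Pts \<Longrightarrow> group_hom (Fob A x) (Om A) (inc A x)"
  using Preglid_ObjD(1)[OF A] inc_hom
  by (simp add: group_hom_def group_hom_axioms_def comm_group.axioms(2))

lemma stable_Obj: "stable (Om A) (act A) (sub A)"
  unfolding stable_def
proof (intro conjI ballI)
  show "sub A Infty = carrier (Om A)" by (rule sub_Infty)
  show "subgroup (sub A x) (Om A)" if "x \<in> Pts" for x
    unfolding sub_def by (rule group_hom.img_is_subgroup[OF group_hom_inc[OF that]])
  show "act A r m \<in> sub A y" if "x \<in> Pts" "y \<in> Pts" "r \<in> H x y" "m \<in> sub A x" for x y r m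
  proof -
    from that(4) obtain n where n: "n \<in> carrier (Fob A x)" "m = inc A x n" by (auto simp: sub_def)
    then have "act A r m = inc A y (Fmap A (x, r, y) n)" using inc_Fmap[OF that(1-3)] by simp
    then show ?thesis using hom_in_carrier[OF Fmap_hom[OF that(1-3)] n(1)] by (simp add: sub_def)
  qed
qed

end

section \<open>Morphisms of pregliders as maps at infinity\<close>

definition plin :: "('g, 'r, 'u) filt_mod \<Rightarrow> ('g, 'r, 'u) filt_mod \<Rightarrow> ('u \<Rightarrow> 'u) \<Rightarrow> bool" where
  "plin A B h \<longleftrightarrow> h \<in> hom (Om A) (Om B) \<and>
     (\<forall>r \<in> carrier R. \<forall>m \<in> carrier (Om A). h (act A r m) = act B r (h m)) \<and>
     (\<forall>x \<in> Pts. \<forall>m \<in> sub A x. h m \<in> sub B x)"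

lemma PG_homsD:
  assumes "f \<in> homs PG A B"
  defines "\<eta> \<equiv> fst (snd f)"
  shows "f = (A, \<eta>, B)" "A \<in> Obj PG" "B \<in> Obj PG" "\<eta> \<in> extensional Pts"
    "x \<in> Pts \<Longrightarrow> \<eta> x \<in> hom (Fob A x) (Fob B x)"
    "x \<in> Pts \<Longrightarrow> \<eta> x \<in> extensional (carrier (Fob A x))"
    "x \<in> Pts \<Longrightarrow> m \<in> carrier (Fob A x) \<Longrightarrow> inc B x (\<eta> x m) = \<eta> Infty (inc A x m)"
    "r \<in> carrier R \<Longrightarrow> n \<in> carrier (Om A) \<Longrightarrow> \<eta> Infty (act A r n) = act B r (\<eta> Infty n)"
proof -
  obtain \<theta> where \<theta>: "f = (A, \<theta>, B)" "A \<in> Obj PG" "B \<in> Obj PG" "\<theta> \<in> extensional Pts"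
    and hom: "\<forall>x \<in> Pts. \<theta> x \<in> hom (Fob A x) (Fob B x) \<inter> extensional (carrier (Fob A x))"
    and nat: "\<forall>x \<in> Pts. \<forall>y \<in> Pts. \<forall>r \<in> H x y. \<forall>m \<in> carrier (Fob A x).
       \<theta> y (Fmap A (x, r, y) m) = Fmap B (x, r, y) (\<theta> x m)"
    using assms(1) unfolding Preglid_homs_iff by blast
  have \<eta>: "\<eta> = \<theta>" by (simp add: \<eta>_def \<theta>(1))
  show "inc B x (\<eta> x m) = \<eta> Infty (inc A x m)" if "x \<in> Pts" "m \<in> carrier (Fob A x)"
    using nat[rule_format, OF that(1) insertI1 H_Infty[OF R.one_closed] that(2)] by (simp add: inc_def \<eta>)
  show "\<eta> Infty (act A r n) = act B r (\<eta> Infty n)" if "r \<in> carrier R" "n \<in> carrier (Om A)"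
    using nat[rule_format, OF insertI1 insertI1 H_Infty[OF that(1)] that(2)] by (simp add: act_def \<eta>)
  show "x \<in> Pts \<Longrightarrow> \<eta> x \<in> hom (Fob A x) (Fob B x)"
    "x \<in> Pts \<Longrightarrow> \<eta> x \<in> extensional (carrier (Fob A x))"
    using hom unfolding \<eta> by blast+
qed (use assms in \<open>auto simp: Preglid_homs_iff\<close>)

lemma PG_obj: "f \<in> homs PG A B \<Longrightarrow> A \<in> Obj PG" "f \<in> homs PG A B \<Longrightarrow> B \<in> Obj PG"
  using PG_homsD(2,3) by blast+

lemma plin_hinf:
  assumes "f \<in> homs PG A B" shows "plin A B (hinf f)"
proof -
  define \<eta> where "\<eta> = fst (snd f)"
  note \<eta> = PG_homsD[OF assms, folded \<eta>_def]
  have "\<eta> Infty m \<in> sub B x" if "x \<in> Pts" "m \<in> sub A x" for x m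
  proof -
    from that(2) obtain n where n: "n \<in> carrier (Fob A x)" "m = inc A x n" by (auto simp: sub_def)
    then have "\<eta> Infty m = inc B x (\<eta> x n)" using \<eta>(7)[OF that(1)] by simp
    then show ?thesis using hom_in_carrier[OF \<eta>(5)[OF that(1)] n(1)] by (simp add: sub_def)
  qed
  then show ?thesis using \<eta>(5,8) unfolding plin_def hinf_def \<eta>(1) by simp
qed

text \<open>The structure maps of B into \<open>Om B\<close> are injective, so the component at
  \<open>Infty\<close> determines the others. Equations between arrows of Preglid, such as the
  category laws below, are therefore checked at \<open>Infty\<close> alone.\<close>

lemma PG_inj:
  assumes f: "f \<in> homs PG A B" and g: "g \<in> homs PG A B"
    and eq: "\<And>m. m \<in> carrier (Om A) \<Longrightarrow> hinf f m = hinf g m"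
  shows "f = g"
proof -
  define \<eta> where "\<eta> = fst (snd f)"
  note \<eta> = PG_homsD[OF f, folded \<eta>_def]
  define \<theta> where "\<theta> = fst (snd g)"
  note \<theta> = PG_homsD[OF g, folded \<theta>_def]
  have "\<eta> x m = \<theta> x m" if x: "x \<in> Pts" and m: "m \<in> carrier (Fob A x)" for x m
  proof (rule inj_onD[OF inc_inj[OF \<eta>(3) x]])
    have "inc A x m \<in> carrier (Om A)" using hom_in_carrier[OF inc_hom[OF \<eta>(2) x] m] .
    then show "inc B x (\<eta> x m) = inc B x (\<theta> x m)"
      using \<eta>(7)[OF x m] \<theta>(7)[OF x m] eq by (simp add: hinf_def \<eta>(1) \<theta>(1))
  qed (use hom_in_carrier[OF \<eta>(5)[OF x] m] hom_in_carrier[OF \<theta>(5)[OF x] m] in auto)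
  then have "\<eta> x = \<theta> x" if "x \<in> Pts" for x
    using extensionalityI[OF \<eta>(6)[OF that] \<theta>(6)[OF that]] that by blast
  then have "\<eta> = \<theta>" using extensionalityI[OF \<eta>(4) \<theta>(4)] by blast
  then show ?thesis using \<eta>(1) \<theta>(1) by simp
qed

text \<open>The construction inverse to \<open>hinf\<close>: the component at x is h pulled back
  along the injections of the values at x into the modules at infinity.\<close>

definition parr :: "('g, 'r, 'u) filt_mod \<Rightarrow> ('g, 'r, 'u) filt_mod \<Rightarrow> ('u \<Rightarrow> 'u) \<Rightarrow> ('g, 'r, 'u) filt_mod_arr" where
  "parr A B h = (A, (\<lambda>x \<in> Pts. \<lambda>m \<in> carrier (Fob A x).
     inv_into (carrier (Fob B x)) (inc B x) (h (inc A x m))), B)"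

lemma parr:
  assumes A: "A \<in> Obj PG" and B: "B \<in> Obj PG" and h: "plin A B h"
  shows "parr A B h \<in> homs PG A B" and "m \<in> carrier (Om A) \<Longrightarrow> hinf (parr A B h) m = h m"
proof -
  define e where "e x m = inv_into (carrier (Fob B x)) (inc B x) (h (inc A x m))" for x m
  note incA = hom_in_carrier[OF inc_hom[OF A]]
  have e: "e x m \<in> carrier (Fob B x)" "inc B x (e x m) = h (inc A x m)"
    if x: "x \<in> Pts" and m: "m \<in> carrier (Fob A x)" for x m
  proof -
    have "h (inc A x m) \<in> inc B x ` carrier (Fob B x)"
      using h x m unfolding plin_def sub_def by blast
    then show "e x m \<in> carrier (Fob B x)" "inc B x (e x m) = h (inc A x m)"
      unfolding e_def by (rule inv_into_into, rule f_inv_into_f)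
  qed
  have eqI: "e x m = n"
    if "x \<in> Pts" "m \<in> carrier (Fob A x)" "n \<in> carrier (Fob B x)" "h (inc A x m) = inc B x n" for x m n
    using inj_onD[OF inc_inj[OF B that(1)]] e[OF that(1,2)] that(3,4) by simp
  have hact: "h (act A r m) = act B r (h m)" if "r \<in> carrier R" "m \<in> carrier (Om A)" for r m
    using h that by (simp add: plin_def)
  have hhom: "h \<in> hom (Om A) (Om B)" using h by (simp add: plin_def)
  define \<eta> where "\<eta> = (\<lambda>x \<in> Pts. \<lambda>m \<in> carrier (Fob A x). e x m)"
  have \<eta>: "\<eta> x m = e x m" if "x \<in> Pts" "m \<in> carrier (Fob A x)" for x m
    using that unfolding \<eta>_def by (subst restrict_apply') auto
  have parr: "parr A B h = (A, \<eta>, B)" by (simp add: parr_def \<eta>_def e_def)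
  have ext: "\<eta> \<in> extensional Pts" unfolding \<eta>_def by (rule restrict_extensional)
  show "parr A B h \<in> homs PG A B"
    unfolding Preglid_homs_iff parr
  proof (intro exI[of _ \<eta>] conjI ballI HOL.refl A B ext)
    fix x assume x: "x \<in> Pts"
    interpret Ax: comm_group "Fob A x" using Preglid_ObjD(1)[OF A x] .
    interpret Bx: comm_group "Fob B x" using Preglid_ObjD(1)[OF B x] .
    have "e x (m \<otimes>\<^bsub>Fob A x\<^esub> n) = e x m \<otimes>\<^bsub>Fob B x\<^esub> e x n"
      if mn: "m \<in> carrier (Fob A x)" "n \<in> carrier (Fob A x)" for m n
      by (rule eqI[OF x]) (use mn e[OF x] in \<open>simp_all add: hom_mult[OF inc_hom[OF A x]]
          hom_mult[OF inc_hom[OF B x]] hom_mult[OF hhom] incA[OF x]\<close>)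
    then have "\<eta> x \<in> hom (Fob A x) (Fob B x)"
      using e(1)[OF x] by (auto simp: hom_def \<eta>[OF x])
    moreover have "\<eta> x \<in> extensional (carrier (Fob A x))"
      using x unfolding \<eta>_def by (subst restrict_apply') auto
    ultimately show "\<eta> x \<in> hom (Fob A x) (Fob B x) \<inter> extensional (carrier (Fob A x))" by blast
  next
    fix x y r m assume xy: "x \<in> Pts" "y \<in> Pts" "r \<in> H x y" "m \<in> carrier (Fob A x)"
    have r: "r \<in> carrier R" using H_carrier xy by blast
    have c: "Fmap A (x, r, y) m \<in> carrier (Fob A y)" using hom_in_carrier[OF Fmap_hom[OF A xy(1-3)] xy(4)] .
    have "e y (Fmap A (x, r, y) m) = Fmap B (x, r, y) (e x m)"
    proof (rule eqI[OF xy(2) c])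
      show "Fmap B (x, r, y) (e x m) \<in> carrier (Fob B y)"
        using hom_in_carrier[OF Fmap_hom[OF B xy(1-3)]] e xy by blast
      show "h (inc A y (Fmap A (x, r, y) m)) = inc B y (Fmap B (x, r, y) (e x m))"
        using inc_Fmap[OF A xy] inc_Fmap[OF B xy(1-3)] e[OF xy(1,4)] hact[OF r incA[OF xy(1,4)]] by simp
    qed
    then show "\<eta> y (Fmap A (x, r, y) m) = Fmap B (x, r, y) (\<eta> x m)" using \<eta> xy c by simp
  qed
  show "hinf (parr A B h) m = h m" if m: "m \<in> carrier (Om A)"
    using \<eta>[of Infty m] eqI[of Infty m "h m"] m hom_in_carrier[OF hhom m]
    by (simp add: parr hinf_def inc_Infty[OF A] inc_Infty[OF B])
qed

lemma hinf_ident: "A \<in> Obj PG \<Longrightarrow> m \<in> carrier (Om A) \<Longrightarrow> hinf (Ident PG A) m = m"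
  by (simp add: hinf_def Preglid_simps AddMod_def filt_cat_def)

lemma PG_cmp:
  "f \<in> homs PG A B \<Longrightarrow> g \<in> homs PG B D \<Longrightarrow> g \<bullet>\<^bsub>PG\<^esub> f = (A, \<lambda>x \<in> Pts.
     compose (carrier (Fob A x)) (fst (snd g) x) (fst (snd f) x), D)"
  by (auto simp: Preglid_simps AddMod_def filt_cat_def Preglid_homs_iff)

lemma hinf_cmp:
  assumes "f \<in> homs PG A B" "g \<in> homs PG B D" "m \<in> carrier (Om A)"
  shows "hinf (g \<bullet>\<^bsub>PG\<^esub> f) m = hinf g (hinf f m)"
  using assms(3) unfolding PG_cmp[OF assms(1,2)] by (simp add: hinf_def compose_def)

lemma PG_ident: "A \<in> Obj PG \<Longrightarrow> Ident PG A \<in> homs PG A A"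
proof -
  assume A: "A \<in> Obj PG"
  have I: "Ident PG A = (A, (\<lambda>x \<in> Pts. \<lambda>m \<in> carrier (Fob A x). m), A)"
    by (simp add: Preglid_simps AddMod_def filt_cat_def)
  have \<eta>: "(\<lambda>x \<in> Pts. \<lambda>m \<in> carrier (Fob A x). m) x = (\<lambda>m \<in> carrier (Fob A x). m)" if "x \<in> Pts" for x
    using that by (subst restrict_apply') auto
  show ?thesis
    unfolding Preglid_homs_iff I
  proof (intro exI[of _ "\<lambda>x \<in> Pts. \<lambda>m \<in> carrier (Fob A x). m"] conjI ballI HOL.refl A restrict_extensional)
    fix x assume x: "x \<in> Pts"
    interpret Ax: comm_group "Fob A x" using Preglid_ObjD(1)[OF A x] .
    show "(\<lambda>x \<in> Pts. \<lambda>m \<in> carrier (Fob A x). m) x \<in> hom (Fob A x) (Fob A x) \<inter> extensional (carrier (Fob A x))"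
      unfolding \<eta>[OF x] by (auto simp: hom_def)
  next
    fix x y r m assume xy: "x \<in> Pts" "y \<in> Pts" "r \<in> H x y" "m \<in> carrier (Fob A x)"
    show "(\<lambda>x \<in> Pts. \<lambda>m \<in> carrier (Fob A x). m) y (Fmap A (x, r, y) m)
        = Fmap A (x, r, y) ((\<lambda>x \<in> Pts. \<lambda>m \<in> carrier (Fob A x). m) x m)"
      unfolding \<eta>[OF xy(1)] \<eta>[OF xy(2)] using xy hom_in_carrier[OF Fmap_hom[OF A xy(1-3)]] by simp
  qed
qed

lemma PG_cmp_hom:
  assumes f: "f \<in> homs PG A B" and g: "g \<in> homs PG B D"
  shows "g \<bullet>\<^bsub>PG\<^esub> f \<in> homs PG A D"
proof -
  obtain \<eta> where \<eta>: "f = (A, \<eta>, B)" "A \<in> Obj PG"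
    "\<forall>x \<in> Pts. \<eta> x \<in> hom (Fob A x) (Fob B x) \<inter> extensional (carrier (Fob A x))"
    "\<forall>x \<in> Pts. \<forall>y \<in> Pts. \<forall>r \<in> H x y. \<forall>m \<in> carrier (Fob A x).
       \<eta> y (Fmap A (x, r, y) m) = Fmap B (x, r, y) (\<eta> x m)"
    using f unfolding Preglid_homs_iff by blast
  obtain \<theta> where \<theta>: "g = (B, \<theta>, D)" "D \<in> Obj PG"
    "\<forall>x \<in> Pts. \<theta> x \<in> hom (Fob B x) (Fob D x) \<inter> extensional (carrier (Fob B x))"
    "\<forall>x \<in> Pts. \<forall>y \<in> Pts. \<forall>r \<in> H x y. \<forall>m \<in> carrier (Fob B x).
       \<theta> y (Fmap B (x, r, y) m) = Fmap D (x, r, y) (\<theta> x m)"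
    using g unfolding Preglid_homs_iff by blast
  let ?\<xi> = "\<lambda>x \<in> Pts. compose (carrier (Fob A x)) (\<theta> x) (\<eta> x)"
  have c: "g \<bullet>\<^bsub>PG\<^esub> f = (A, ?\<xi>, D)" unfolding PG_cmp[OF f g] by (simp add: \<eta>(1) \<theta>(1))
  have \<xi>: "?\<xi> x = compose (carrier (Fob A x)) (\<theta> x) (\<eta> x)" if "x \<in> Pts" for x
    using that by (subst restrict_apply') auto
  have \<eta>h: "\<eta> x \<in> hom (Fob A x) (Fob B x)" and \<theta>h: "\<theta> x \<in> hom (Fob B x) (Fob D x)" if "x \<in> Pts" for x
    using \<eta>(3) \<theta>(3) that by blast+
  show ?thesis
    unfolding Preglid_homs_iff c
  proof (intro exI[of _ ?\<xi>] conjI ballI HOL.refl \<eta>(2) \<theta>(2) restrict_extensional)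
    fix x assume x: "x \<in> Pts"
    interpret Ax: comm_group "Fob A x" using Preglid_ObjD(1)[OF \<eta>(2) x] .
    show "?\<xi> x \<in> hom (Fob A x) (Fob D x) \<inter> extensional (carrier (Fob A x))"
      unfolding \<xi>[OF x] using hom_in_carrier[OF \<eta>h[OF x]] hom_in_carrier[OF \<theta>h[OF x]]
        hom_mult[OF \<eta>h[OF x]] hom_mult[OF \<theta>h[OF x]] by (auto simp: hom_def compose_def)
  next
    fix x y r m assume xy: "x \<in> Pts" "y \<in> Pts" "r \<in> H x y" "m \<in> carrier (Fob A x)"
    have "Fmap A (x, r, y) m \<in> carrier (Fob A y)" using hom_in_carrier[OF Fmap_hom[OF \<eta>(2) xy(1-3)] xy(4)] .
    moreover have "\<theta> y (\<eta> y (Fmap A (x, r, y) m)) = Fmap D (x, r, y) (\<theta> x (\<eta> x m))"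
      using \<eta>(4)[rule_format, OF xy] \<theta>(4)[rule_format, OF xy(1-3) hom_in_carrier[OF \<eta>h[OF xy(1)] xy(4)]]
      by simp
    ultimately show "?\<xi> y (Fmap A (x, r, y) m) = Fmap D (x, r, y) (?\<xi> x m)"
      unfolding \<xi>[OF xy(1)] \<xi>[OF xy(2)] using xy(4) by (simp add: compose_def)
  qed
qed

lemma plin_closed: "plin A B h \<Longrightarrow> m \<in> carrier (Om A) \<Longrightarrow> h m \<in> carrier (Om B)"
  by (auto simp: plin_def hom_def)

sublocale PG: category PG
proof
  fix f assume "f \<in> Arr PG"
  then have "f \<in> homs PG (Dom PG f) (Cod PG f)" by (simp add: homs_def)
  then show "Dom PG f \<in> Obj PG" "Cod PG f \<in> Obj PG" using PG_obj by blast+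
next
  show "Ident PG A \<in> homs PG A A" if "A \<in> Obj PG" for A by (rule PG_ident[OF that])
  show "g \<bullet>\<^bsub>PG\<^esub> f \<in> homs PG A D" if "f \<in> homs PG A B" "g \<in> homs PG B D" for f g A B D
    by (rule PG_cmp_hom[OF that])
  fix f A B assume f: "f \<in> homs PG A B"
  note O = PG_obj[OF f]
  show "f \<bullet>\<^bsub>PG\<^esub> Ident PG A = f"
    by (rule PG_inj[OF PG_cmp_hom[OF PG_ident[OF O(1)] f] f])
      (simp add: hinf_cmp[OF PG_ident[OF O(1)] f] hinf_ident O)
  show "Ident PG B \<bullet>\<^bsub>PG\<^esub> f = f"
    by (rule PG_inj[OF PG_cmp_hom[OF f PG_ident[OF O(2)]] f])
      (simp add: hinf_cmp[OF f PG_ident[OF O(2)]] hinf_ident O plin_closed[OF plin_hinf[OF f]])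
  fix g h D E assume g: "g \<in> homs PG B D" and h: "h \<in> homs PG D E"
  note c = PG_cmp_hom[OF f g] PG_cmp_hom[OF g h]
  show "(h \<bullet>\<^bsub>PG\<^esub> g) \<bullet>\<^bsub>PG\<^esub> f = h \<bullet>\<^bsub>PG\<^esub> (g \<bullet>\<^bsub>PG\<^esub> f)"
    by (rule PG_inj[OF PG_cmp_hom[OF f c(2)] PG_cmp_hom[OF c(1) h]])
      (simp add: hinf_cmp[OF f c(2)] hinf_cmp[OF c(1) h] hinf_cmp[OF f g] hinf_cmp[OF g h]
        plin_closed[OF plin_hinf[OF f]])
qed

text \<open>\<open>inc A x\<close> and \<open>inc B x\<close> are bijections onto the embedded
  values, so invertibility of the component at a point can be read off from the map at
  infinity.\<close>

lemma weq_iff: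
  assumes f: "f \<in> homs PG A B"
  shows "f \<in> preglid_weq \<Gamma> leq R F \<Lambda> \<longleftrightarrow> (\<forall>\<alpha> \<in> \<Lambda>. bij_betw (hinf f) (sub A (Pt \<alpha>)) (sub B (Pt \<alpha>)))"
proof -
  define \<eta> where "\<eta> = fst (snd f)"
  note \<eta> = PG_homsD[OF f, folded \<eta>_def]
  have "bij_betw (\<eta> x) (carrier (Fob A x)) (carrier (Fob B x)) \<longleftrightarrow> bij_betw (hinf f) (sub A x) (sub B x)"
    if x: "x \<in> Pts" for x
  proof -
    have iA: "bij_betw (inc A x) (carrier (Fob A x)) (sub A x)"
      and iB: "bij_betw (inc B x) (carrier (Fob B x)) (sub B x)"
      using inc_inj[OF \<eta>(2) x] inc_inj[OF \<eta>(3) x] by (auto simp: bij_betw_def sub_def)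
    have "bij_betw (\<eta> x) (carrier (Fob A x)) (carrier (Fob B x))
        \<longleftrightarrow> bij_betw (inc B x \<circ> \<eta> x) (carrier (Fob A x)) (sub B x)"
      by (rule bij_betw_comp_iff2[OF iB]) (use hom_in_carrier[OF \<eta>(5)[OF x]] in blast)
    also have "\<dots> \<longleftrightarrow> bij_betw (hinf f \<circ> inc A x) (carrier (Fob A x)) (sub B x)"
      by (rule bij_betw_cong) (use \<eta>(7)[OF x] in \<open>simp add: hinf_def \<eta>(1)\<close>)
    also have "\<dots> \<longleftrightarrow> bij_betw (hinf f) (sub A x) (sub B x)"
      by (rule bij_betw_comp_iff[OF iA, symmetric])
    finally show ?thesis .
  qed
  moreover have "f \<in> Arr PG" using f by (simp add: homs_def)
  ultimately show ?thesis
    using \<eta>(5) by (auto simp: preglid_weq_def \<eta>(1) iso_def)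
qed

end

section \<open>Zigzags\<close>

context category
begin

lemma zigzag_obj: "zigzag C S A w B \<Longrightarrow> A \<in> Obj C \<and> B \<in> Obj C"
  by (induction rule: zigzag.induct) (auto dest: homs_obj)

lemma zigzag_append: "zigzag C S A v B \<Longrightarrow> zigzag C S B w D \<Longrightarrow> zigzag C S A (v @ w) D"
  by (induction rule: zigzag.induct) (auto intro: zigzag.intros)

lemma zigzag_Fwd: "f \<in> homs C A B \<Longrightarrow> zigzag C S A [Fwd f] B"
  by (meson homs_obj zigzag.intros)

lemma zigzag_Bwd: "s \<in> S \<Longrightarrow> s \<in> homs C B A \<Longrightarrow> zigzag C S A [Bwd s] B"
  by (meson homs_obj zigzag.intros)

lemma zigzag_eq_zigzag: "zigzag_eq C S A v w B \<Longrightarrow> zigzag C S A v B \<and> zigzag C S A w B"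
proof (induction rule: zigzag_eq.induct)
  case (append A v w B v' w' D)
  then show ?case using zigzag_append by blast
next
  case (ident A)
  show ?case using zigzag_Fwd[OF ident_hom[OF ident]] zigzag.empty[OF ident] by simp
next
  case (cmp f A B g D)
  show ?case using zigzag_append[OF zigzag_Fwd[OF cmp(1)] zigzag_Fwd[OF cmp(2)]] zigzag_Fwd[OF cmp_hom[OF cmp]] by simp
next
  case (fwd_bwd s A B)
  show ?case using zigzag_append[OF zigzag_Fwd[OF fwd_bwd(2)] zigzag_Bwd[OF fwd_bwd]]
      zigzag.empty[OF homs_obj(1)[OF fwd_bwd(2)]] by simp
next
  case (bwd_fwd s A B)
  show ?case using zigzag_append[OF zigzag_Bwd[OF bwd_fwd] zigzag_Fwd[OF bwd_fwd(2)]]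
      zigzag.empty[OF homs_obj(2)[OF bwd_fwd(2)]] by simp
qed auto

lemma zigzag_eq_ctx:
  assumes "zigzag C S A v A'" "zigzag_eq C S A' w w' B'" "zigzag C S B' x B"
  shows "zigzag_eq C S A (v @ w @ x) (v @ w' @ x) B"
  using assms by (intro zigzag_eq.append zigzag_eq.refl)

text \<open>Insert \<open>s\<close> and its formal inverse behind \<open>u\<close>, then cancel
  \<open>s \<bullet> u\<close> against its own formal inverse. What gets inverted is
  \<open>s\<close> and \<open>s \<bullet> u\<close>; the arrow \<open>u\<close> may be
  arbitrary.\<close>

lemma roof_refine:
  assumes s: "s \<in> S" "s \<in> homs C P A" and t: "t \<in> homs C P B" and u: "u \<in> homs C Q P"
    and s': "s \<bullet> u \<in> S"
  shows "zigzag_eq C S A [Bwd (s \<bullet> u), Fwd (t \<bullet> u)] [Bwd s, Fwd t] B"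
proof -
  note su = cmp_hom[OF u s(2)]
  have O: "P \<in> Obj C" "Q \<in> Obj C" "A \<in> Obj C" "B \<in> Obj C" using homs_obj s t u by blast+
  have 1: "zigzag_eq C S A [Bwd (s \<bullet> u), Fwd u, Fwd t] [Bwd (s \<bullet> u), Fwd (t \<bullet> u)] B"
    using zigzag_eq_ctx[OF zigzag_Bwd[OF s' su] zigzag_eq.cmp[OF u t] zigzag.empty[OF O(4)]] by simp
  have 2: "zigzag_eq C S A [Bwd (s \<bullet> u), Fwd u, Fwd s, Bwd s, Fwd t] [Bwd (s \<bullet> u), Fwd u, Fwd t] B"
    using zigzag_eq_ctx[OF zigzag_append[OF zigzag_Bwd[OF s' su] zigzag_Fwd[OF u]]
        zigzag_eq.fwd_bwd[OF s] zigzag_Fwd[OF t]] by simp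
  have 3: "zigzag_eq C S A [Bwd (s \<bullet> u), Fwd u, Fwd s, Bwd s, Fwd t] [Bwd (s \<bullet> u), Fwd (s \<bullet> u), Bwd s, Fwd t] B"
    using zigzag_eq_ctx[OF zigzag_Bwd[OF s' su] zigzag_eq.cmp[OF u s(2)]
        zigzag_append[OF zigzag_Bwd[OF s] zigzag_Fwd[OF t]]] by simp
  have 4: "zigzag_eq C S A [Bwd (s \<bullet> u), Fwd (s \<bullet> u), Bwd s, Fwd t] [Bwd s, Fwd t] B"
    using zigzag_eq_ctx[OF zigzag.empty[OF O(3)] zigzag_eq.bwd_fwd[OF s' su]
        zigzag_append[OF zigzag_Bwd[OF s] zigzag_Fwd[OF t]]] by simp
  show ?thesis by (meson 1 2 3 4 zigzag_eq.sym zigzag_eq.trans)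
qed

text \<open>The square \<open>s \<bullet> u = f \<bullet> s'\<close> is an instance of the Ore
  condition. It moves the forward step past the formal inverse and merges both into one
  roof.\<close>

lemma roof_Fwd:
  assumes f: "f \<in> homs C A B" and s: "s \<in> S" "s \<in> homs C P B" and t: "t \<in> homs C P D"
    and s': "s' \<in> S" "s' \<in> homs C Q A" and u: "u \<in> homs C Q P" and comm: "s \<bullet> u = f \<bullet> s'"
  shows "zigzag_eq C S A [Fwd f, Bwd s, Fwd t] [Bwd s', Fwd (t \<bullet> u)] D"
proof -
  have O: "A \<in> Obj C" "D \<in> Obj C" using homs_obj f t by blast+
  note st = zigzag_append[OF zigzag_Bwd[OF s] zigzag_Fwd[OF t]]
  have 1: "zigzag_eq C S A [Bwd s', Fwd s', Fwd f, Bwd s, Fwd t] [Fwd f, Bwd s, Fwd t] D"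
    using zigzag_eq_ctx[OF zigzag.empty[OF O(1)] zigzag_eq.bwd_fwd[OF s'] zigzag_append[OF zigzag_Fwd[OF f] st]]
    by simp
  have 2: "zigzag_eq C S A [Bwd s', Fwd s', Fwd f, Bwd s, Fwd t] [Bwd s', Fwd (f \<bullet> s'), Bwd s, Fwd t] D"
    using zigzag_eq_ctx[OF zigzag_Bwd[OF s'] zigzag_eq.cmp[OF s'(2) f] st] by simp
  have 3: "zigzag_eq C S A [Bwd s', Fwd u, Fwd s, Bwd s, Fwd t] [Bwd s', Fwd (f \<bullet> s'), Bwd s, Fwd t] D"
    using zigzag_eq_ctx[OF zigzag_Bwd[OF s'] zigzag_eq.cmp[OF u s(2)] st] comm by simp
  have 4: "zigzag_eq C S A [Bwd s', Fwd u, Fwd s, Bwd s, Fwd t] [Bwd s', Fwd u, Fwd t] D"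
    using zigzag_eq_ctx[OF zigzag_append[OF zigzag_Bwd[OF s'] zigzag_Fwd[OF u]]
        zigzag_eq.fwd_bwd[OF s] zigzag_Fwd[OF t]] by simp
  have 5: "zigzag_eq C S A [Bwd s', Fwd u, Fwd t] [Bwd s', Fwd (t \<bullet> u)] D"
    using zigzag_eq_ctx[OF zigzag_Bwd[OF s'] zigzag_eq.cmp[OF u t] zigzag.empty[OF O(2)]] by simp
  show ?thesis by (meson 1 2 3 4 5 zigzag_eq.sym zigzag_eq.trans)
qed

text \<open>Zigzags are read in the order of traversal, so going back along \<open>x\<close> and
  then along \<open>s\<close> is going back along \<open>x \<bullet> s\<close>. The proof appends
  \<open>x \<bullet> s\<close> with its formal inverse and cancels in the middle.\<close>

lemma Bwd_Bwd:
  assumes x: "x \<in> S" "x \<in> homs C B A" and s: "s \<in> S" "s \<in> homs C P B" and xs: "x \<bullet> s \<in> S"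
  shows "zigzag_eq C S A [Bwd x, Bwd s] [Bwd (x \<bullet> s)] P"
proof -
  note c = cmp_hom[OF s(2) x(2)]
  have O: "A \<in> Obj C" "P \<in> Obj C" using homs_obj x s by blast+
  have 1: "zigzag_eq C S A [Bwd x, Bwd s, Fwd (x \<bullet> s), Bwd (x \<bullet> s)] [Bwd x, Bwd s] P"
    using zigzag_eq_ctx[OF zigzag_append[OF zigzag_Bwd[OF x] zigzag_Bwd[OF s]] zigzag_eq.fwd_bwd[OF xs c]
        zigzag.empty[OF O(2)]] by simp
  have 2: "zigzag_eq C S A [Bwd x, Bwd s, Fwd s, Fwd x, Bwd (x \<bullet> s)] [Bwd x, Bwd s, Fwd (x \<bullet> s), Bwd (x \<bullet> s)] P"
    using zigzag_eq_ctx[OF zigzag_append[OF zigzag_Bwd[OF x] zigzag_Bwd[OF s]] zigzag_eq.cmp[OF s(2) x(2)]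
        zigzag_Bwd[OF xs c]] by simp
  have 3: "zigzag_eq C S A [Bwd x, Bwd s, Fwd s, Fwd x, Bwd (x \<bullet> s)] [Bwd x, Fwd x, Bwd (x \<bullet> s)] P"
    using zigzag_eq_ctx[OF zigzag_Bwd[OF x] zigzag_eq.bwd_fwd[OF s]
        zigzag_append[OF zigzag_Fwd[OF x(2)] zigzag_Bwd[OF xs c]]] by simp
  have 4: "zigzag_eq C S A [Bwd x, Fwd x, Bwd (x \<bullet> s)] [Bwd (x \<bullet> s)] P"
    using zigzag_eq_ctx[OF zigzag.empty[OF O(1)] zigzag_eq.bwd_fwd[OF x] zigzag_Bwd[OF xs c]] by simp
  show ?thesis by (meson 1 2 3 4 zigzag_eq.sym zigzag_eq.trans)
qed

lemma zigzag_class_eq_iff: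
  assumes "zigzag C S A w B"
  shows "zigzag_class C S A v B = zigzag_class C S A w B \<longleftrightarrow> zigzag_eq C S A v w B"
proof
  assume "zigzag_class C S A v B = zigzag_class C S A w B"
  then have "{x. zigzag_eq C S A v x B} = {x. zigzag_eq C S A w x B}" by (simp add: zigzag_class_def)
  then show "zigzag_eq C S A v w B" using zigzag_eq.refl[OF assms] by blast
next
  assume "zigzag_eq C S A v w B"
  then have "zigzag_eq C S A v x B \<longleftrightarrow> zigzag_eq C S A w x B" for x
    by (meson zigzag_eq.sym zigzag_eq.trans)
  then show "zigzag_class C S A v B = zigzag_class C S A w B" by (simp add: zigzag_class_def)
qed

lemma homs_localization:
  "homs (localization C S) A B = {zigzag_class C S A w B | w. zigzag C S A w B}"
  by (auto simp: homs_def localization_def zigzag_class_def)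

lemma localization_cmp:
  assumes v: "zigzag C S A v B" and w: "zigzag C S B w D"
  shows "zigzag_class C S B w D \<bullet>\<^bsub>localization C S\<^esub> zigzag_class C S A v B = zigzag_class C S A (v @ w) D"
proof -
  have "(\<exists>v' \<in> {x. zigzag_eq C S A v x B}. \<exists>w' \<in> {x. zigzag_eq C S B w x D}. zigzag_eq C S A (v' @ w') u D)
      \<longleftrightarrow> zigzag_eq C S A (v @ w) u D" (is "?L \<longleftrightarrow> ?R") for u
  proof
    assume ?L
    then obtain v' w' where "zigzag_eq C S A v v' B" "zigzag_eq C S B w w' D" "zigzag_eq C S A (v' @ w') u D"
      by blast
    then show ?R by (rule zigzag_eq.trans[OF zigzag_eq.append])
  next
    assume ?R
    then show ?L using zigzag_eq.refl[OF v] zigzag_eq.refl[OF w] by blast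
  qed
  then show ?thesis by (simp add: localization_def zigzag_class_def)
qed

lemma localization_simps:
  "Obj (localization C S) = Obj C" "Ident (localization C S) A = zigzag_class C S A [] A"
  by (simp_all add: localization_def)

lemma category_localization: "category (localization C S)"
proof
  fix f assume "f \<in> Arr (localization C S)"
  then obtain A w B where f: "f = zigzag_class C S A w B" "zigzag C S A w B"
    by (auto simp: localization_def)
  then show "Dom (localization C S) f \<in> Obj (localization C S)" "Cod (localization C S) f \<in> Obj (localization C S)"
    using zigzag_obj[OF f(2)] by (simp_all add: localization_def zigzag_class_def)
next
  fix A assume "A \<in> Obj (localization C S)"
  then show "Ident (localization C S) A \<in> homs (localization C S) A A"
    by (auto simp: homs_localization localization_simps intro: zigzag.empty)
next
  fix f g A B D assume "f \<in> homs (localization C S) A B" "g \<in> homs (localization C S) B D"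
  then obtain v w where "zigzag C S A v B" "f = zigzag_class C S A v B"
    "zigzag C S B w D" "g = zigzag_class C S B w D"
    by (auto simp: homs_localization)
  then show "g \<bullet>\<^bsub>localization C S\<^esub> f \<in> homs (localization C S) A D"
    using localization_cmp zigzag_append unfolding homs_localization by blast
next
  fix f A B assume "f \<in> homs (localization C S) A B"
  then obtain v where v: "zigzag C S A v B" "f = zigzag_class C S A v B"
    by (auto simp: homs_localization)
  have O: "A \<in> Obj C" "B \<in> Obj C" using zigzag_obj[OF v(1)] by auto
  show "f \<bullet>\<^bsub>localization C S\<^esub> Ident (localization C S) A = f"
    using localization_cmp[OF zigzag.empty[OF O(1)] v(1)] v by (simp add: localization_simps)
  show "Ident (localization C S) B \<bullet>\<^bsub>localization C S\<^esub> f = f"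
    using localization_cmp[OF v(1) zigzag.empty[OF O(2)]] v by (simp add: localization_simps)
next
  fix f g h A B D E assume "f \<in> homs (localization C S) A B" "g \<in> homs (localization C S) B D"
    "h \<in> homs (localization C S) D E"
  then obtain u v w where u: "zigzag C S A u B" "f = zigzag_class C S A u B"
    and v: "zigzag C S B v D" "g = zigzag_class C S B v D"
    and w: "zigzag C S D w E" "h = zigzag_class C S D w E"
    by (auto simp: homs_localization)
  show "(h \<bullet>\<^bsub>localization C S\<^esub> g) \<bullet>\<^bsub>localization C S\<^esub> f = h \<bullet>\<^bsub>localization C S\<^esub> (g \<bullet>\<^bsub>localization C S\<^esub> f)"
    unfolding u(2) v(2) w(2) localization_cmp[OF u(1) v(1)] localization_cmp[OF v(1) w(1)]
      localization_cmp[OF u(1) zigzag_append[OF v(1) w(1)]]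
      localization_cmp[OF zigzag_append[OF u(1) v(1)] w(1)] by simp
qed

end

section \<open>Gliders\<close>

context glider_setup
begin

section \<open>Values over \<Lambda> as a group with partial operators\<close>

abbreviation W :: "('g, 'r, 'u) filt_mod_arr set" where "W \<equiv> preglid_weq \<Gamma> leq R F \<Lambda>"

text \<open>The value at the greatest point contains the values at all points of \<Lambda>, as
  \<open>T_le_z\<close> shows. \<open>Om A\<close> serves only as ambient group here, being no
  invariant of the glider.\<close>

definition Gr :: "('g, 'r, 'u) filt_mod \<Rightarrow> 'u monoid" where
  "Gr A = (Om A)\<lparr>carrier := sub A (Pt z)\<rparr>"

definition T :: "('g, 'r, 'u) filt_mod \<Rightarrow> 'g \<Rightarrow> 'u set" where
  "T A \<alpha> = sub A (Pt \<alpha>)"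

text \<open>Empty between points that are not in order, where \<open>filt_homs\<close> has the zero
  arrow: commuting with 0 is automatic for homomorphisms.\<close>

definition K :: "'g \<Rightarrow> 'g \<Rightarrow> 'r set" where
  "K \<alpha> \<beta> = (if (\<alpha>, \<beta>) \<in> leq then F (\<beta> \<otimes>\<^bsub>\<Gamma>\<^esub> inv\<^bsub>\<Gamma>\<^esub> \<alpha>) else {})"

lemma Gr_simps [simp]:
  "carrier (Gr A) = T A z" "m \<otimes>\<^bsub>Gr A\<^esub> n = m \<otimes>\<^bsub>Om A\<^esub> n" "\<one>\<^bsub>Gr A\<^esub> = \<one>\<^bsub>Om A\<^esub>"
  by (simp_all add: Gr_def T_def)

lemma K_H: "\<alpha> \<in> \<Lambda> \<Longrightarrow> \<beta> \<in> \<Lambda> \<Longrightarrow> r \<in> K \<alpha> \<beta> \<Longrightarrow> r \<in> H (Pt \<alpha>) (Pt \<beta>)"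
  by (simp add: K_def split: if_splits)

lemma K_carrier: "\<alpha> \<in> \<Lambda> \<Longrightarrow> \<beta> \<in> \<Lambda> \<Longrightarrow> r \<in> K \<alpha> \<beta> \<Longrightarrow> r \<in> carrier R"
  using F_carrier by (auto simp: K_def split: if_splits)

lemma T_Om: "A \<in> Obj PG \<Longrightarrow> \<alpha> \<in> \<Lambda> \<Longrightarrow> m \<in> T A \<alpha> \<Longrightarrow> m \<in> carrier (Om A)"
  using stableD(4)[OF stable_Obj] by (auto simp: T_def)

lemma T_subgroup: "A \<in> Obj PG \<Longrightarrow> \<alpha> \<in> \<Lambda> \<Longrightarrow> subgroup (T A \<alpha>) (Om A)"
  using stableD(2)[OF stable_Obj] by (auto simp: T_def)

lemma T_act: "A \<in> Obj PG \<Longrightarrow> \<alpha> \<in> \<Lambda> \<Longrightarrow> \<beta> \<in> \<Lambda> \<Longrightarrow> r \<in> K \<alpha> \<beta> \<Longrightarrow> m \<in> T A \<alpha> \<Longrightarrow> act A r m \<in> T A \<beta>"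
  using stableD(3)[OF stable_Obj, of A "Pt \<alpha>" "Pt \<beta>" r m] K_H[of \<alpha> \<beta> r] by (simp add: T_def)

text \<open>1 is an operator from \<alpha> to the greatest point, and it acts as the identity of
  \<open>Om A\<close>.\<close>

lemma T_le_z: "A \<in> Obj PG \<Longrightarrow> \<alpha> \<in> \<Lambda> \<Longrightarrow> T A \<alpha> \<subseteq> T A z"
proof
  fix m assume A: "A \<in> Obj PG" and \<alpha>: "\<alpha> \<in> \<Lambda>" and m: "m \<in> T A \<alpha>"
  have "\<one>\<^bsub>R\<^esub> \<in> K \<alpha> z" using one_F[OF greatest[OF \<alpha>] \<alpha> z] greatest[OF \<alpha>] by (simp add: K_def)
  then have "act A \<one>\<^bsub>R\<^esub> m \<in> T A z" using T_act A \<alpha> z m by blast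
  then show "m \<in> T A z" using rmodD(3)[OF rmod_Obj[OF A]] T_Om[OF A \<alpha> m] by simp
qed

lemma operator_groups_PG: "operator_groups (Obj PG) Gr \<Lambda> z T K act"
proof (rule operator_groups.intro)
  fix A :: "('g, 'r, 'u) filt_mod" assume A: "A \<in> Obj PG"
  interpret Om: comm_group "Om A" using rmodD(1)[OF rmod_Obj[OF A]] .
  show "comm_group (Gr A)"
    using subgroup_comm_group[OF Om.comm_group_axioms T_subgroup[OF A z]] by (simp add: Gr_def T_def)
  show "subgroup (T A \<alpha>) (Gr A)" if "\<alpha> \<in> \<Lambda>" for \<alpha>
    using Om.subgroup_incl[OF T_subgroup[OF A that] T_subgroup[OF A z] T_le_z[OF A that]]
    by (simp add: Gr_def T_def)
  show "act A r (m \<otimes>\<^bsub>Gr A\<^esub> n) = act A r m \<otimes>\<^bsub>Gr A\<^esub> act A r n"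
    if "\<alpha> \<in> \<Lambda>" "\<beta> \<in> \<Lambda>" "r \<in> K \<alpha> \<beta>" "m \<in> T A \<alpha>" "n \<in> T A \<alpha>" for \<alpha> \<beta> r m n
    using rmodD(7)[OF rmod_Obj[OF A] K_carrier[OF that(1-3)]] T_Om[OF A that(1)] that(4,5) by simp
qed (simp_all add: z T_act)

sublocale PO: operator_groups "Obj PG" Gr \<Lambda> z T K act
  by (rule operator_groups_PG)

abbreviation lin where "lin \<equiv> PO.op_linear"

lemma plin_lin:
  assumes h: "plin A B h" and A: "A \<in> Obj PG" and B: "B \<in> Obj PG"
  shows "lin A B h"
proof (rule PO.op_linearI[OF _ _ _ A B])
  show "h (m \<otimes>\<^bsub>Gr A\<^esub> n) = h m \<otimes>\<^bsub>Gr B\<^esub> h n" if "m \<in> carrier (Gr A)" "n \<in> carrier (Gr A)" for m n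
    using that T_Om[OF A z] h by (simp add: plin_def hom_def)
  show "h m \<in> T B \<alpha>" if "\<alpha> \<in> \<Lambda>" "m \<in> T A \<alpha>" for \<alpha> m
    using that h by (simp add: plin_def T_def)
  show "h (act A r m) = act B r (h m)" if "\<alpha> \<in> \<Lambda>" "\<beta> \<in> \<Lambda>" "r \<in> K \<alpha> \<beta>" "m \<in> T A \<alpha>" for \<alpha> \<beta> r m
    using that h K_carrier T_Om[OF A] by (simp add: plin_def)
qed

lemma hinf_lin: "f \<in> homs PG A B \<Longrightarrow> lin A B (hinf f)"
  using plin_lin[OF plin_hinf] PG_obj by blast

section \<open>Zigzags as \<Lambda>-linear maps\<close>

definition binv :: "('g, 'r, 'u) filt_mod_arr \<Rightarrow> 'u \<Rightarrow> 'u" where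
  "binv s = inv_into (T (Dom PG s) z) (hinf s)"

text \<open>A member of \<open>W\<close> is bijective on every level, so the inverse of its top
  level respects the levels and is linear, although the map at infinity need not be
  invertible.\<close>

lemma binv:
  assumes s: "s \<in> W" "s \<in> homs PG B A"
  shows "m \<in> T B z \<Longrightarrow> binv s (hinf s m) = m" "m \<in> T A z \<Longrightarrow> hinf s (binv s m) = m" "lin A B (binv s)"
proof -
  have D: "Dom PG s = B" using s(2) by (simp add: homs_def)
  have O: "B \<in> Obj PG" "A \<in> Obj PG" using PG_obj s by blast+
  have bij: "bij_betw (hinf s) (T B \<alpha>) (T A \<alpha>)" if "\<alpha> \<in> \<Lambda>" for \<alpha>
    using weq_iff[OF s(2)] s(1) that by (simp add: T_def)
  have inj: "inj_on (hinf s) (T B z)" and im: "hinf s ` T B z = T A z"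
    using bij[OF z] by (auto simp: bij_betw_def)
  show "binv s (hinf s m) = m" if "m \<in> T B z" using that inj by (simp add: binv_def D)
  have r: "hinf s (binv s m) = m" "binv s m \<in> T B z" if "m \<in> T A z" for m
    using that im f_inv_into_f[of m "hinf s" "T B z"] inv_into_into[of m "hinf s" "T B z"]
    by (simp_all add: binv_def D)
  then show "m \<in> T A z \<Longrightarrow> hinf s (binv s m) = m" by blast
  show "lin A B (binv s)"
  proof (rule PO.op_linear_factor_mono[OF O(1,2,2) hinf_lin[OF s(2)] _ PO.op_linear_id[OF O(2)]])
    show "(\<lambda>m. m) ` T A \<alpha> \<subseteq> hinf s ` T B \<alpha>" if "\<alpha> \<in> \<Lambda>" for \<alpha>
      using bij[OF that] by (simp add: bij_betw_def)
  qed (use inj r in simp_all)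
qed

primrec evz :: "('g, 'r, 'u) filt_mod_arr step list \<Rightarrow> 'u \<Rightarrow> 'u" where
  "evz [] m = m"
| "evz (x # w) m = evz w (case x of Fwd f \<Rightarrow> hinf f m | Bwd s \<Rightarrow> binv s m)"

lemma evz_append: "evz (v @ w) m = evz w (evz v m)"
  by (induction v arbitrary: m) auto

lemma evz_lin: "zigzag PG W A w B \<Longrightarrow> lin A B (evz w)"
proof (induction rule: zigzag.induct)
  case (empty A)
  have "evz [] = (\<lambda>m. m)" by (simp add: fun_eq_iff)
  then show ?case using PO.op_linear_id[OF empty] by simp
next
  case (fwd f A B w D)
  have "evz (Fwd f # w) = (\<lambda>m. evz w (hinf f m))" by (simp add: fun_eq_iff)
  then show ?case
    using PO.op_linear_comp[OF hinf_lin[OF fwd(1)] fwd(3)] PG_obj[OF fwd(1)] PG.zigzag_obj[OF fwd(2)] by simp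
next
  case (bwd s B A w D)
  have "evz (Bwd s # w) = (\<lambda>m. evz w (binv s m))" by (simp add: fun_eq_iff)
  then show ?case
    using PO.op_linear_comp[OF binv(3)[OF bwd(1,2)] bwd(4)] PG_obj[OF bwd(2)] PG.zigzag_obj[OF bwd(3)] by simp
qed

lemma evz_closed: "zigzag PG W A w B \<Longrightarrow> m \<in> T A z \<Longrightarrow> evz w m \<in> T B z"
  using PO.op_linear_T[OF evz_lin] z by blast

text \<open>Each generating relation of the localization holds for the evaluated maps, but only on
  \<open>T A z\<close>, where \<open>binv\<close> is a genuine inverse. The case of concatenation
  therefore has to know that the first part ends in \<open>T B z\<close>.\<close>

lemma evz_eq: "zigzag_eq PG W A v w B \<Longrightarrow> m \<in> T A z \<Longrightarrow> evz v m = evz w m"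
proof (induction arbitrary: m rule: zigzag_eq.induct)
  case (append A v w B v' w' D)
  have "evz w m \<in> T B z" using evz_closed PG.zigzag_eq_zigzag[OF append(1)] append(5) by blast
  then show ?case using append by (simp add: evz_append)
next
  case (ident A)
  then show ?case using hinf_ident T_Om z by simp
next
  case (cmp f A B g D)
  then show ?case using hinf_cmp T_Om[OF PG_obj(1)[OF cmp(1)] z] by simp
next
  case (fwd_bwd s A B)
  then show ?case using binv(1) by simp
next
  case (bwd_fwd s A B)
  then show ?case using binv(2) by simp
qed auto

section \<open>Direct products and roofs inside the universe\<close>

definition pfst where "pfst u = fst (inv_into UNIV pair u)"
definition psnd where "psnd u = snd (inv_into UNIV pair u)"

lemma pair_simps [simp]: "pfst (pair (a, b)) = a" "psnd (pair (a, b)) = b" "pair x = pair y \<longleftrightarrow> x = y"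
  using pair_inj by (simp_all add: pfst_def psnd_def inj_eq)

text \<open>The elements of the direct product are coded by \<open>pair\<close> because all values
  of a preglider are groups over the one type \<open>'u\<close>. Outside the range of
  \<open>pair\<close> the coordinates \<open>pfst\<close> and \<open>psnd\<close> have no
  meaning.\<close>

definition prodG :: "'u monoid \<Rightarrow> 'u monoid \<Rightarrow> 'u monoid" where
  "prodG G N = \<lparr>carrier = pair ` (carrier G \<times> carrier N),
     monoid.mult = (\<lambda>u v. pair (pfst u \<otimes>\<^bsub>G\<^esub> pfst v, psnd u \<otimes>\<^bsub>N\<^esub> psnd v)), one = pair (\<one>\<^bsub>G\<^esub>, \<one>\<^bsub>N\<^esub>)\<rparr>"

definition pact :: "('r \<Rightarrow> 'u \<Rightarrow> 'u) \<Rightarrow> ('r \<Rightarrow> 'u \<Rightarrow> 'u) \<Rightarrow> 'r \<Rightarrow> 'u \<Rightarrow> 'u" where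
  "pact a b r u = pair (a r (pfst u), b r (psnd u))"

lemma prodG_simps [simp]:
  "carrier (prodG G N) = pair ` (carrier G \<times> carrier N)" "\<one>\<^bsub>prodG G N\<^esub> = pair (\<one>\<^bsub>G\<^esub>, \<one>\<^bsub>N\<^esub>)"
  "u \<otimes>\<^bsub>prodG G N\<^esub> v = pair (pfst u \<otimes>\<^bsub>G\<^esub> pfst v, psnd u \<otimes>\<^bsub>N\<^esub> psnd v)"
  by (simp_all add: prodG_def)

lemma comm_group_prodG:
  assumes "comm_group G" "comm_group N" shows "comm_group (prodG G N)"
proof -
  interpret G: comm_group G by fact
  interpret N: comm_group N by fact
  show ?thesis
  proof (rule comm_groupI)
    fix x assume "x \<in> carrier (prodG G N)"
    then obtain a b where "x = pair (a, b)" "a \<in> carrier G" "b \<in> carrier N" by auto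
    then show "\<exists>y \<in> carrier (prodG G N). y \<otimes>\<^bsub>prodG G N\<^esub> x = \<one>\<^bsub>prodG G N\<^esub>"
      by (intro bexI[of _ "pair (inv\<^bsub>G\<^esub> a, inv\<^bsub>N\<^esub> b)"]) auto
  qed (auto simp: G.m_ac N.m_ac)
qed

lemma rmod_prodG:
  assumes G: "rmod G a" and N: "rmod N b" shows "rmod (prodG G N) (pact a b)"
  unfolding rmod_def hom_def
  by (auto simp: pact_def comm_group_prodG rmodD[OF G] rmodD[OF N])

lemma subgroup_prodG:
  assumes G: "comm_group G" "comm_group N" and S: "subgroup S G" "subgroup S' N"
  shows "subgroup (pair ` (S \<times> S')) (prodG G N)"
proof -
  interpret G: comm_group G by fact
  interpret N: comm_group N by fact
  interpret P: comm_group "prodG G N" by (rule comm_group_prodG) fact+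
  have inv: "inv\<^bsub>prodG G N\<^esub> pair (a, b) = pair (inv\<^bsub>G\<^esub> a, inv\<^bsub>N\<^esub> b)" if "a \<in> carrier G" "b \<in> carrier N" for a b
    by (rule P.inv_equality) (use that in auto)
  show ?thesis
  proof (rule P.subgroupI)
    show "pair ` (S \<times> S') \<subseteq> carrier (prodG G N)"
      using subgroup.subset[OF S(1)] subgroup.subset[OF S(2)] by auto
    show "pair ` (S \<times> S') \<noteq> {}" using subgroup.one_closed[OF S(1)] subgroup.one_closed[OF S(2)] by blast
    show "inv\<^bsub>prodG G N\<^esub> x \<in> pair ` (S \<times> S')" if x: "x \<in> pair ` (S \<times> S')" for x
      using x inv subgroup.mem_carrier[OF S(1)] subgroup.mem_carrier[OF S(2)]
        subgroup.m_inv_closed[OF S(1)] subgroup.m_inv_closed[OF S(2)] by auto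
    show "x \<otimes>\<^bsub>prodG G N\<^esub> y \<in> pair ` (S \<times> S')" if "x \<in> pair ` (S \<times> S')" "y \<in> pair ` (S \<times> S')" for x y
      using that subgroup.m_closed[OF S(1)] subgroup.m_closed[OF S(2)] by auto
  qed
qed

text \<open>The groups over \<open>\<Lambda>\<close> of the roof \<open>A \<leftarrow> P \<rightarrow> B\<close> form the graph of \<open>\<phi>\<close>, so that the left leg is
  inverted in the localization although \<open>\<phi>\<close> need not extend to \<open>Om A\<close>.\<close>

definition roofS where
  "roofS A B \<phi> x = (case x of Infty \<Rightarrow> carrier (prodG (Om A) (Om B)) | Pt \<alpha> \<Rightarrow> (\<lambda>m. pair (m, \<phi> m)) ` T A \<alpha>)"

definition roof where
  "roof A B \<phi> = preglid_of (prodG (Om A) (Om B)) (pact (act A) (act B)) (roofS A B \<phi>)"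

definition r1 where "r1 A B \<phi> = parr (roof A B \<phi>) A pfst"
definition r2 where "r2 A B \<phi> = parr (roof A B \<phi>) B psnd"

lemma rmod_prod_Obj: "A \<in> Obj PG \<Longrightarrow> B \<in> Obj PG \<Longrightarrow> rmod (prodG (Om A) (Om B)) (pact (act A) (act B))"
  by (intro rmod_prodG rmod_Obj)

context
  fixes A B \<phi> assumes A: "A \<in> Obj PG" and B: "B \<in> Obj PG" and \<phi>: "lin A B \<phi>"
begin

lemma lin_mem: "\<alpha> \<in> \<Lambda> \<Longrightarrow> m \<in> T A \<alpha> \<Longrightarrow> m \<in> carrier (Om A) \<and> \<phi> m \<in> T B \<alpha> \<and> \<phi> m \<in> carrier (Om B)"
  using PO.op_linear_T[OF \<phi>] T_Om A B by blast

lemma stable_roof: "stable (prodG (Om A) (Om B)) (pact (act A) (act B)) (roofS A B \<phi>)"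
proof (rule stableI[OF rmod_prod_Obj[OF A B]])
  show "roofS A B \<phi> Infty = carrier (prodG (Om A) (Om B))" by (simp add: roofS_def)
  interpret P: comm_group "prodG (Om A) (Om B)" using rmodD(1)[OF rmod_prod_Obj[OF A B]] .
  interpret G: comm_group "Gr A" using PO.Gr_comm[OF A] .
  \<comment> \<open>The graph over \<alpha> is the image of \<open>T A \<alpha>\<close> under this
    homomorphism. Its source is \<open>Gr A\<close> and not \<open>Om A\<close>, since \<phi> is
    additive on the value at the greatest point only.\<close>
  have "group_hom (Gr A) (prodG (Om A) (Om B)) (\<lambda>m. pair (m, \<phi> m))"
    by unfold_locales (use lin_mem[OF z] PO.op_linear_mult[OF \<phi>] in \<open>auto simp: hom_def\<close>)
  then show "subgroup (roofS A B \<phi> (Pt \<alpha>)) (prodG (Om A) (Om B))" if "\<alpha> \<in> \<Lambda>" for \<alpha>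
    using group_hom.subgroup_img_is_subgroup PO.T_sub[OF A that] by (fastforce simp: roofS_def)
  show "pact (act A) (act B) r m \<in> roofS A B \<phi> (Pt \<beta>)"
    if "\<alpha> \<in> \<Lambda>" "\<beta> \<in> \<Lambda>" "(\<alpha>, \<beta>) \<in> leq" "r \<in> F (\<beta> \<otimes>\<^bsub>\<Gamma>\<^esub> inv\<^bsub>\<Gamma>\<^esub> \<alpha>)" "m \<in> roofS A B \<phi> (Pt \<alpha>)" for \<alpha> \<beta> r m
  proof -
    from that(5) obtain n where n: "n \<in> T A \<alpha>" "m = pair (n, \<phi> n)" by (auto simp: roofS_def)
    have r: "r \<in> K \<alpha> \<beta>" using that by (simp add: K_def)
    have "pact (act A) (act B) r m = pair (act A r n, \<phi> (act A r n))"
      using PO.op_linear_act[OF \<phi> that(1,2) r n(1)] n by (simp add: pact_def)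
    then show ?thesis using T_act[OF A that(1,2) r n(1)] by (simp add: roofS_def)
  qed
qed

lemma roof_Obj: "roof A B \<phi> \<in> Obj PG"
  unfolding roof_def by (rule preglid_of_Obj[OF rmod_prod_Obj[OF A B] stable_roof])

lemma roof_Om: "Om (roof A B \<phi>) = prodG (Om A) (Om B)" "act (roof A B \<phi>) = pact (act A) (act B)"
  "\<alpha> \<in> \<Lambda> \<Longrightarrow> T (roof A B \<phi>) \<alpha> = (\<lambda>m. pair (m, \<phi> m)) ` T A \<alpha>"
  "x \<in> Pts \<Longrightarrow> sub (roof A B \<phi>) x = roofS A B \<phi> x"
  using sub_preglid_of[OF rmod_prod_Obj[OF A B] stable_roof] Om_preglid_of[OF stable_roof]
  by (auto simp: roof_def T_def roofS_def)

lemma r1: "r1 A B \<phi> \<in> homs PG (roof A B \<phi>) A" "r1 A B \<phi> \<in> W"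
    "u \<in> carrier (prodG (Om A) (Om B)) \<Longrightarrow> hinf (r1 A B \<phi>) u = pfst u"
  and r2: "r2 A B \<phi> \<in> homs PG (roof A B \<phi>) B"
    "u \<in> carrier (prodG (Om A) (Om B)) \<Longrightarrow> hinf (r2 A B \<phi>) u = psnd u"
proof -
  have sub: "pfst m \<in> sub A x \<and> psnd m \<in> sub B x" if "x \<in> Pts" "m \<in> sub (roof A B \<phi>) x" for x m
    using that lin_mem sub_Infty[OF A] sub_Infty[OF B] unfolding roof_Om(4)[OF that(1)]
    by (auto simp: roofS_def T_def)
  have "plin (roof A B \<phi>) A pfst" "plin (roof A B \<phi>) B psnd"
    unfolding plin_def roof_Om(1,2) using sub by (auto simp: hom_def pact_def)
  note p = parr[OF roof_Obj A this(1)] parr[OF roof_Obj B this(2)]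
  show 1: "r1 A B \<phi> \<in> homs PG (roof A B \<phi>) A" "r2 A B \<phi> \<in> homs PG (roof A B \<phi>) B"
    and 2: "u \<in> carrier (prodG (Om A) (Om B)) \<Longrightarrow> hinf (r1 A B \<phi>) u = pfst u"
    "u \<in> carrier (prodG (Om A) (Om B)) \<Longrightarrow> hinf (r2 A B \<phi>) u = psnd u" for u
    using p by (simp_all only: r1_def r2_def roof_Om(1))
  have "bij_betw (hinf (r1 A B \<phi>)) (T (roof A B \<phi>) \<alpha>) (T A \<alpha>)" if \<alpha>: "\<alpha> \<in> \<Lambda>" for \<alpha>
  proof (rule bij_betw_byWitness[where f' = "\<lambda>m. pair (m, \<phi> m)"])
    have eq: "hinf (r1 A B \<phi>) (pair (m, \<phi> m)) = m" if "m \<in> T A \<alpha>" for m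
      using 2(1)[of "pair (m, \<phi> m)"] lin_mem[OF \<alpha> that] by simp
    show "\<forall>a \<in> T (roof A B \<phi>) \<alpha>. pair (hinf (r1 A B \<phi>) a, \<phi> (hinf (r1 A B \<phi>) a)) = a"
      "\<forall>a' \<in> T A \<alpha>. hinf (r1 A B \<phi>) (pair (a', \<phi> a')) = a'"
      "hinf (r1 A B \<phi>) ` T (roof A B \<phi>) \<alpha> \<subseteq> T A \<alpha>" "(\<lambda>m. pair (m, \<phi> m)) ` T A \<alpha> \<subseteq> T (roof A B \<phi>) \<alpha>"
      using eq by (auto simp: roof_Om(3)[OF \<alpha>])
  qed
  then show "r1 A B \<phi> \<in> W" unfolding weq_iff[OF 1(1)] by (simp add: T_def)
qed

lemma zigzag_roof: "zigzag PG W A [Bwd (r1 A B \<phi>), Fwd (r2 A B \<phi>)] B"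
  using PG.zigzag_append[OF PG.zigzag_Bwd[OF r1(2,1)] PG.zigzag_Fwd[OF r2(1)]] by simp

lemma evz_roof:
  assumes m: "m \<in> T A z" shows "evz [Bwd (r1 A B \<phi>), Fwd (r2 A B \<phi>)] m = \<phi> m"
proof -
  have c: "pair (m, \<phi> m) \<in> carrier (prodG (Om A) (Om B))" using lin_mem[OF z m] by simp
  have "pair (m, \<phi> m) \<in> T (roof A B \<phi>) z" using roof_Om(3)[OF z] m by simp
  then have "binv (r1 A B \<phi>) m = pair (m, \<phi> m)" using binv(1)[OF r1(2,1)] r1(3)[OF c] by force
  then show ?thesis using r2(2)[OF c] by simp
qed

end

text \<open>A commutative square over \<Lambda> maps graph to graph. The sides f and g have to be
  morphisms at infinity, where the roofs carry full direct products, while \<phi> and \<psi> live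
  over \<Lambda>.\<close>

lemma plin_pair:
  assumes "A \<in> Obj PG" "B \<in> Obj PG" "D \<in> Obj PG" "E \<in> Obj PG"
    and \<phi>: "lin A B \<phi>" and \<psi>: "lin D E \<psi>" and f: "plin A D f" and g: "plin B E g"
    and comm: "\<And>m. m \<in> T A z \<Longrightarrow> g (\<phi> m) = \<psi> (f m)"
  shows "plin (roof A B \<phi>) (roof D E \<psi>) (\<lambda>u. pair (f (pfst u), g (psnd u)))" (is "plin _ _ ?h")
proof -
  note O = assms(1-4)
  note R = roof_Om[OF O(1,2) \<phi>] roof_Om[OF O(3,4) \<psi>]
  have hom: "f \<in> hom (Om A) (Om D)" "g \<in> hom (Om B) (Om E)" using f g by (simp_all add: plin_def)
  have "?h \<in> hom (prodG (Om A) (Om B)) (prodG (Om D) (Om E))"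
    using hom by (auto simp: hom_def)
  moreover have "?h (pact (act A) (act B) r u) = pact (act D) (act E) r (?h u)"
    if "r \<in> carrier R" "u \<in> carrier (prodG (Om A) (Om B))" for r u
    using that f g by (auto simp: pact_def plin_def)
  moreover have "?h u \<in> roofS D E \<psi> x" if x: "x \<in> Pts" and u: "u \<in> roofS A B \<phi> x" for x u
  proof (cases x)
    case Infty
    then show ?thesis using u hom by (auto simp: roofS_def hom_def)
  next
    case (Pt \<alpha>)
    then have \<alpha>: "\<alpha> \<in> \<Lambda>" using x by auto
    obtain m where m: "m \<in> T A \<alpha>" "u = pair (m, \<phi> m)" using u Pt by (auto simp: roofS_def)
    have "m \<in> T A z" using T_le_z[OF O(1) \<alpha>] m by blast
    then have "?h u = pair (f m, \<psi> (f m))" using m comm by simp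
    moreover have "f m \<in> T D \<alpha>" using PO.op_linear_T[OF plin_lin[OF f O(1,3)] \<alpha> m(1)] .
    ultimately show ?thesis using Pt by (simp add: roofS_def)
  qed
  ultimately show ?thesis unfolding plin_def R(1,2,5,6) using R(4,8) by simp
qed

lemma W_cmp:
  assumes "f \<in> W" "f \<in> homs PG A B" "g \<in> W" "g \<in> homs PG B D"
  shows "g \<bullet>\<^bsub>PG\<^esub> f \<in> W"
  unfolding weq_iff[OF PG_cmp_hom[OF assms(2,4)]]
proof
  fix \<alpha> assume \<alpha>: "\<alpha> \<in> \<Lambda>"
  have "bij_betw (hinf g \<circ> hinf f) (sub A (Pt \<alpha>)) (sub D (Pt \<alpha>))"
    by (rule bij_betw_trans) (use weq_iff[OF assms(2)] weq_iff[OF assms(4)] assms(1,3) \<alpha> in auto)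
  moreover have "hinf (g \<bullet>\<^bsub>PG\<^esub> f) m = (hinf g \<circ> hinf f) m" if "m \<in> sub A (Pt \<alpha>)" for m
    using hinf_cmp[OF assms(2,4)] T_Om[OF PG_obj(1)[OF assms(2)] \<alpha>] that by (simp add: T_def)
  ultimately show "bij_betw (hinf (g \<bullet>\<^bsub>PG\<^esub> f)) (sub A (Pt \<alpha>)) (sub D (Pt \<alpha>))"
    using bij_betw_cong[of "sub A (Pt \<alpha>)" "hinf (g \<bullet>\<^bsub>PG\<^esub> f)" "hinf g \<circ> hinf f"] by simp
qed

lemma W_ident: "A \<in> Obj PG \<Longrightarrow> Ident PG A \<in> W"
  unfolding weq_iff[OF PG_ident] using hinf_ident T_Om by (auto simp: T_def bij_betw_def inj_on_def)

text \<open>Normal form by induction: the first step is absorbed into the roof of the rest. Here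
  \<phi> is any linear map that agrees with the evaluation on \<open>T A z\<close>, and not the
  evaluation itself, so that two zigzags with the same evaluation can be compared with literally the
  same roof.\<close>

lemma zigzag_eq_roof:
  assumes "zigzag PG W A w B" and "lin A B \<phi>" and "\<And>m. m \<in> T A z \<Longrightarrow> \<phi> m = evz w m"
  shows "zigzag_eq PG W A w [Bwd (r1 A B \<phi>), Fwd (r2 A B \<phi>)] B"
  using assms
proof (induction arbitrary: \<phi> rule: zigzag.induct)
  case (empty A)
  note A = empty(1) and \<phi> = empty(2)
  note r1 = r1[OF A A \<phi>] and r2 = r2[OF A A \<phi>] and R = roof_Om[OF A A \<phi>]
  \<comment> \<open>Here \<phi> is the identity on \<open>T A z\<close>, so the roof carries the
    diagonal over \<Lambda>. The diagonal map from A into the roof turns both legs into the identity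
    of A, and refining along it leaves the empty zigzag.\<close>
  let ?d = "\<lambda>m. pair (m, m)"
  have d: "plin A (roof A A \<phi>) ?d"
    unfolding plin_def R(1,2)
  proof (intro conjI ballI)
    show "?d m \<in> sub (roof A A \<phi>) x" if x: "x \<in> Pts" and m: "m \<in> sub A x" for x m
    proof (cases x)
      case Infty
      then show ?thesis using m R(4)[OF x] sub_Infty[OF A] by (simp add: roofS_def)
    next
      case (Pt \<alpha>)
      then have \<alpha>: "\<alpha> \<in> \<Lambda>" using x by auto
      have mT: "m \<in> T A \<alpha>" using m Pt by (simp add: T_def)
      then have "\<phi> m = m" using empty(3) T_le_z[OF A \<alpha>] by auto
      then have "?d m \<in> T (roof A A \<phi>) \<alpha>" unfolding R(3)[OF \<alpha>] by (intro image_eqI[OF _ mT]) simp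
      then show ?thesis using Pt by (simp add: T_def)
    qed
  qed (auto simp: hom_def pact_def)
  note p = parr[OF A roof_Obj[OF A A \<phi>] d]
  have dm: "?d m \<in> carrier (prodG (Om A) (Om A))" if "m \<in> carrier (Om A)" for m using that by simp
  have 1: "r1 A A \<phi> \<bullet>\<^bsub>PG\<^esub> parr A (roof A A \<phi>) ?d = Ident PG A"
    by (rule PG_inj[OF PG_cmp_hom[OF p(1) r1(1)] PG_ident[OF A]])
      (simp add: hinf_cmp[OF p(1) r1(1)] p(2) r1(3)[OF dm] hinf_ident[OF A])
  have 2: "r2 A A \<phi> \<bullet>\<^bsub>PG\<^esub> parr A (roof A A \<phi>) ?d = Ident PG A"
    by (rule PG_inj[OF PG_cmp_hom[OF p(1) r2(1)] PG_ident[OF A]])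
      (simp add: hinf_cmp[OF p(1) r2(1)] p(2) r2(2)[OF dm] hinf_ident[OF A])
  have "zigzag_eq PG W A [Bwd (Ident PG A), Fwd (Ident PG A)] [Bwd (r1 A A \<phi>), Fwd (r2 A A \<phi>)] A"
    using PG.roof_refine[OF r1(2,1) r2(1) p(1), unfolded 1 2, OF W_ident[OF A]] .
  moreover have "zigzag_eq PG W A [Bwd (Ident PG A), Fwd (Ident PG A)] [] A"
    by (rule zigzag_eq.bwd_fwd[OF W_ident[OF A] PG_ident[OF A]])
  ultimately show ?case by (rule zigzag_eq.trans[OF zigzag_eq.sym, rotated])
next
  case (fwd f A B w D)
  note f = fwd(1) and w = fwd(2) and \<phi> = fwd(4)
  have O: "A \<in> Obj PG" "B \<in> Obj PG" "D \<in> Obj PG" using PG_obj[OF f] PG.zigzag_obj[OF w] by auto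
  define \<psi> where "\<psi> = evz w"
  have \<psi>: "lin B D \<psi>" unfolding \<psi>_def by (rule evz_lin[OF w])
  note r = r1[OF O(1,3) \<phi>] r2[OF O(1,3) \<phi>] and R = roof_Om[OF O(1,3) \<phi>]
  note r' = r1[OF O(2,3) \<psi>] r2[OF O(2,3) \<psi>]
  \<comment> \<open>f times the identity carries the graph of \<phi> into the graph of \<psi>,
    because \<phi> is \<psi> after f on \<open>T A z\<close>. It completes the Ore square for f and
    is compatible with the right legs.\<close>
  let ?u = "\<lambda>u. pair (hinf f (pfst u), psnd u)"
  have id: "plin D D (\<lambda>m. m)" by (simp add: plin_def hom_def)
  have u: "plin (roof A D \<phi>) (roof B D \<psi>) ?u"
    by (rule plin_pair[OF O(1,3,2,3) \<phi> \<psi> plin_hinf[OF f] id]) (use fwd(5) in \<open>simp add: \<psi>_def\<close>)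
  note p = parr[OF roof_Obj[OF O(1,3) \<phi>] roof_Obj[OF O(2,3) \<psi>] u, unfolded R(1)]
  note fc = plin_closed[OF plin_hinf[OF f]]
  have 1: "r1 B D \<psi> \<bullet>\<^bsub>PG\<^esub> parr (roof A D \<phi>) (roof B D \<psi>) ?u = f \<bullet>\<^bsub>PG\<^esub> r1 A D \<phi>"
  proof (rule PG_inj[OF PG_cmp_hom[OF p(1) r'(1)] PG_cmp_hom[OF r(1) f]], unfold R(1))
    fix v assume v: "v \<in> carrier (prodG (Om A) (Om D))"
    then have "?u v \<in> carrier (prodG (Om B) (Om D))" using fc by auto
    then show "hinf (r1 B D \<psi> \<bullet>\<^bsub>PG\<^esub> parr (roof A D \<phi>) (roof B D \<psi>) ?u) v = hinf (f \<bullet>\<^bsub>PG\<^esub> r1 A D \<phi>) v"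
      using hinf_cmp[OF p(1) r'(1), unfolded R(1), OF v] hinf_cmp[OF r(1) f, unfolded R(1), OF v]
        p(2)[OF v] r'(3) r(3)[OF v] by simp
  qed
  have 2: "r2 B D \<psi> \<bullet>\<^bsub>PG\<^esub> parr (roof A D \<phi>) (roof B D \<psi>) ?u = r2 A D \<phi>"
  proof (rule PG_inj[OF PG_cmp_hom[OF p(1) r'(4)] r(4)], unfold R(1))
    fix v assume v: "v \<in> carrier (prodG (Om A) (Om D))"
    then have "?u v \<in> carrier (prodG (Om B) (Om D))" using fc by auto
    then show "hinf (r2 B D \<psi> \<bullet>\<^bsub>PG\<^esub> parr (roof A D \<phi>) (roof B D \<psi>) ?u) v = hinf (r2 A D \<phi>) v"
      using hinf_cmp[OF p(1) r'(4), unfolded R(1), OF v] p(2)[OF v] r'(5) r(5)[OF v] by simp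
  qed
  have a: "zigzag_eq PG W A [Fwd f, Bwd (r1 B D \<psi>), Fwd (r2 B D \<psi>)] [Bwd (r1 A D \<phi>), Fwd (r2 A D \<phi>)] D"
    using PG.roof_Fwd[OF f r'(2,1) r'(4) r(2,1) p(1) 1] unfolding 2 .
  have c: "zigzag_eq PG W A ([Fwd f] @ w) ([Fwd f] @ [Bwd (r1 B D \<psi>), Fwd (r2 B D \<psi>)]) D"
    by (rule zigzag_eq.append[OF zigzag_eq.refl[OF PG.zigzag_Fwd[OF f]] fwd(3)[OF \<psi>]]) (simp add: \<psi>_def)
  show ?case by (rule zigzag_eq.trans[OF c[unfolded append_Cons append_Nil] a])
next
  case (bwd s B A w D)
  note s = bwd(1,2) and w = bwd(3) and \<phi> = bwd(5)
  have O: "A \<in> Obj PG" "B \<in> Obj PG" "D \<in> Obj PG" using PG_obj[OF s(2)] PG.zigzag_obj[OF w] by auto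
  define \<psi> where "\<psi> = evz w"
  have \<psi>: "lin B D \<psi>" unfolding \<psi>_def by (rule evz_lin[OF w])
  note r = r1[OF O(1,3) \<phi>] r2[OF O(1,3) \<phi>]
  note r' = r1[OF O(2,3) \<psi>] r2[OF O(2,3) \<psi>] and R' = roof_Om[OF O(2,3) \<psi>]
  \<comment> \<open>Now the map of roofs runs in the other direction: s times the identity carries
    the graph of \<psi> into that of \<phi>, and the roof of \<phi> is refined along it.\<close>
  let ?u = "\<lambda>u. pair (hinf s (pfst u), psnd u)"
  have id: "plin D D (\<lambda>m. m)" by (simp add: plin_def hom_def)
  have u: "plin (roof B D \<psi>) (roof A D \<phi>) ?u"
  proof (rule plin_pair[OF O(2,3,1,3) \<psi> \<phi> plin_hinf[OF s(2)] id])
    fix m assume m: "m \<in> T B z"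
    then have "hinf s m \<in> T A z" using PO.op_linear_T[OF hinf_lin[OF s(2)] z] by blast
    then show "\<psi> m = \<phi> (hinf s m)" using bwd(6) binv(1)[OF s m] by (simp add: \<psi>_def)
  qed
  note p = parr[OF roof_Obj[OF O(2,3) \<psi>] roof_Obj[OF O(1,3) \<phi>] u, unfolded R'(1)]
  note sc = plin_closed[OF plin_hinf[OF s(2)]]
  have 1: "r1 A D \<phi> \<bullet>\<^bsub>PG\<^esub> parr (roof B D \<psi>) (roof A D \<phi>) ?u = s \<bullet>\<^bsub>PG\<^esub> r1 B D \<psi>"
  proof (rule PG_inj[OF PG_cmp_hom[OF p(1) r(1)] PG_cmp_hom[OF r'(1) s(2)]], unfold R'(1))
    fix v assume v: "v \<in> carrier (prodG (Om B) (Om D))"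
    then have "?u v \<in> carrier (prodG (Om A) (Om D))" using sc by auto
    then show "hinf (r1 A D \<phi> \<bullet>\<^bsub>PG\<^esub> parr (roof B D \<psi>) (roof A D \<phi>) ?u) v = hinf (s \<bullet>\<^bsub>PG\<^esub> r1 B D \<psi>) v"
      using hinf_cmp[OF p(1) r(1), unfolded R'(1), OF v] hinf_cmp[OF r'(1) s(2), unfolded R'(1), OF v]
        p(2)[OF v] r(3) r'(3)[OF v] by simp
  qed
  have 2: "r2 A D \<phi> \<bullet>\<^bsub>PG\<^esub> parr (roof B D \<psi>) (roof A D \<phi>) ?u = r2 B D \<psi>"
  proof (rule PG_inj[OF PG_cmp_hom[OF p(1) r(4)] r'(4)], unfold R'(1))
    fix v assume v: "v \<in> carrier (prodG (Om B) (Om D))"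
    then have "?u v \<in> carrier (prodG (Om A) (Om D))" using sc by auto
    then show "hinf (r2 A D \<phi> \<bullet>\<^bsub>PG\<^esub> parr (roof B D \<psi>) (roof A D \<phi>) ?u) v = hinf (r2 B D \<psi>) v"
      using hinf_cmp[OF p(1) r(4), unfolded R'(1), OF v] p(2)[OF v] r(5) r'(5)[OF v] by simp
  qed
  have sr: "s \<bullet>\<^bsub>PG\<^esub> r1 B D \<psi> \<in> W" by (rule W_cmp[OF r'(2,1) s])
  have a: "zigzag_eq PG W A [Bwd (s \<bullet>\<^bsub>PG\<^esub> r1 B D \<psi>), Fwd (r2 B D \<psi>)] [Bwd (r1 A D \<phi>), Fwd (r2 A D \<phi>)] D"
    using PG.roof_refine[OF r(2,1) r(4) p(1), unfolded 1 2, OF sr] .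
  have b: "zigzag_eq PG W A ([Bwd s, Bwd (r1 B D \<psi>)] @ [Fwd (r2 B D \<psi>)])
      ([Bwd (s \<bullet>\<^bsub>PG\<^esub> r1 B D \<psi>)] @ [Fwd (r2 B D \<psi>)]) D"
    by (rule zigzag_eq.append[OF PG.Bwd_Bwd[OF s r'(2,1) sr] zigzag_eq.refl[OF PG.zigzag_Fwd[OF r'(4)]]])
  have c: "zigzag_eq PG W A ([Bwd s] @ w) ([Bwd s] @ [Bwd (r1 B D \<psi>), Fwd (r2 B D \<psi>)]) D"
    by (rule zigzag_eq.append[OF zigzag_eq.refl[OF PG.zigzag_Bwd[OF s]] bwd(4)[OF \<psi>]]) (simp add: \<psi>_def)
  show ?case
    by (rule zigzag_eq.trans[OF c[unfolded append_Cons append_Nil]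
          zigzag_eq.trans[OF b[unfolded append_Cons append_Nil] a]])
qed

text \<open>Both zigzags equal the roof of \<open>evz v\<close>. This is the converse of
  \<open>evz_eq\<close> and makes the evaluation faithful.\<close>

lemma zigzag_eqI:
  assumes v: "zigzag PG W A v B" and w: "zigzag PG W A w B" and eq: "\<And>m. m \<in> T A z \<Longrightarrow> evz v m = evz w m"
  shows "zigzag_eq PG W A v w B"
  by (rule zigzag_eq.trans[OF zigzag_eq_roof[OF v evz_lin[OF v]] zigzag_eq.sym[OF zigzag_eq_roof[OF w evz_lin[OF v]]]])
    (simp_all add: eq)

section \<open>Arrows of Glid as \<Lambda>-linear maps\<close>

abbreviation GG :: "(('g, 'r, 'u) filt_mod, ('g, 'r, 'u) glid_arr) category" where
  "GG \<equiv> Glid \<Gamma> leq R F \<Lambda>"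

text \<open>The representative is arbitrary; by \<open>evz_eq\<close> its choice does not affect
  values on \<open>T A z\<close>.\<close>

definition gev :: "('g, 'r, 'u) glid_arr \<Rightarrow> 'u \<Rightarrow> 'u" where
  "gev f = evz (SOME w. w \<in> fst (snd f))"

lemma gev_class:
  assumes w: "zigzag PG W A w B" and m: "m \<in> T A z"
  shows "gev (zigzag_class PG W A w B) m = evz w m"
proof -
  have "zigzag_eq PG W A w (SOME v. zigzag_eq PG W A w v B) B"
    by (rule someI[of _ w]) (rule zigzag_eq.refl[OF w])
  then show ?thesis using evz_eq[OF _ m] by (simp add: gev_def zigzag_class_def)
qed

lemma GG_homs: "homs GG A B = {zigzag_class PG W A w B | w. zigzag PG W A w B}"
  unfolding Glid_def by (rule PG.homs_localization)

lemma GG_simps: "Obj GG = Obj PG" "Ident GG A = zigzag_class PG W A [] A"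
  unfolding Glid_def by (rule PG.localization_simps)+

text \<open>Roofs realise every linear map, and \<open>zigzag_eqI\<close> shows that no two arrows
  share one.\<close>

theorem operator_group_category_GG: "operator_group_category GG Gr \<Lambda> z T K act gev"
proof (intro operator_group_category.intro operator_group_category_axioms.intro)
  show "category GG" unfolding Glid_def by (rule PG.category_localization)
  show og: "operator_groups (Obj GG) Gr \<Lambda> z T K act" unfolding GG_simps by (rule operator_groups_PG)
  show "\<exists>f \<in> homs GG A B. \<forall>m \<in> carrier (Gr A). gev f m = \<phi> m"
    if O: "A \<in> Obj GG" "B \<in> Obj GG" and \<phi>: "lin A B \<phi>" for A B \<phi>
  proof -
    note O = O[unfolded GG_simps]
    note w = zigzag_roof[OF O \<phi>]
    show ?thesis
    proof (rule bexI)
      show "\<forall>m \<in> carrier (Gr A). gev (zigzag_class PG W A [Bwd (r1 A B \<phi>), Fwd (r2 A B \<phi>)] B) m = \<phi> m"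
        using gev_class[OF w] evz_roof[OF O \<phi>] by simp
      show "zigzag_class PG W A [Bwd (r1 A B \<phi>), Fwd (r2 A B \<phi>)] B \<in> homs GG A B"
        unfolding GG_homs by (rule CollectI, rule exI, rule conjI[OF HOL.refl w])
    qed
  qed
  show "gev (Ident GG A) m = m" if "A \<in> Obj GG" "m \<in> carrier (Gr A)" for A m
    using gev_class[OF zigzag.empty] that by (simp add: GG_simps)
  fix f A B assume "f \<in> homs GG A B"
  then obtain v where v: "zigzag PG W A v B" "f = zigzag_class PG W A v B" by (auto simp: GG_homs)
  have O: "A \<in> Obj PG" "B \<in> Obj PG" using PG.zigzag_obj[OF v(1)] by auto
  show "lin A B (gev f)"
    by (rule PO.op_linear_cong[OF evz_lin[OF v(1)] O]) (use gev_class[OF v(1)] v(2) in simp)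
  show "f = g" if g: "g \<in> homs GG A B" and eq: "\<And>m. m \<in> carrier (Gr A) \<Longrightarrow> gev f m = gev g m" for g
  proof -
    obtain w where w: "zigzag PG W A w B" "g = zigzag_class PG W A w B" using g by (auto simp: GG_homs)
    have "zigzag_eq PG W A v w B"
      by (rule zigzag_eqI[OF v(1) w(1)]) (use eq gev_class[OF v(1)] gev_class[OF w(1)] v(2) w(2) in simp)
    then show ?thesis using PG.zigzag_class_eq_iff[OF w(1)] v(2) w(2) by simp
  qed
  show "gev (g \<bullet>\<^bsub>GG\<^esub> f) m = gev g (gev f m)" if g: "g \<in> homs GG B D" and m: "m \<in> carrier (Gr A)" for g D m
  proof -
    obtain w where w: "zigzag PG W B w D" "g = zigzag_class PG W B w D" using g by (auto simp: GG_homs)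
    have "g \<bullet>\<^bsub>GG\<^esub> f = zigzag_class PG W A (v @ w) D"
      unfolding Glid_def v(2) w(2) by (rule PG.localization_cmp[OF v(1) w(1)])
    then show ?thesis
      using gev_class[OF PG.zigzag_append[OF v(1) w(1)]] gev_class[OF v(1)] gev_class[OF w(1)] m
        evz_closed[OF v(1)] v(2) w(2) by (simp add: evz_append)
  qed
qed

end

section \<open>Images, kernels and products in Glid\<close>

context glider_setup
begin

sublocale G: operator_group_category GG Gr \<Lambda> z T K act gev
  by (rule operator_group_category_GG)

text \<open>The levels shrink but the module at infinity stays \<open>Om A\<close>. Glid does not
  see that module, and keeping it lets saturation of the subobject be tested in the module in which
  saturation of A is known.\<close>

definition subobj :: "('g, 'r, 'u) filt_mod \<Rightarrow> ('g \<Rightarrow> 'u set) \<Rightarrow> ('g, 'r, 'u) filt_mod" where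
  "subobj A S = preglid_of (Om A) (act A) (\<lambda>x. case x of Infty \<Rightarrow> carrier (Om A) | Pt \<alpha> \<Rightarrow> S \<alpha>)"

lemma T_preglid_of:
  "rmod G a \<Longrightarrow> stable G a S \<Longrightarrow> \<alpha> \<in> \<Lambda> \<Longrightarrow> T (preglid_of G a S) \<alpha> = S (Pt \<alpha>)"
  by (simp add: T_def sub_preglid_of)

definition subfamily :: "('g, 'r, 'u) filt_mod \<Rightarrow> ('g \<Rightarrow> 'u set) \<Rightarrow> bool" where
  "subfamily A S \<longleftrightarrow> A \<in> Obj PG \<and> (\<forall>\<alpha> \<in> \<Lambda>. subgroup (S \<alpha>) (Gr A) \<and> S \<alpha> \<subseteq> T A \<alpha>) \<and>
     (\<forall>\<alpha> \<in> \<Lambda>. \<forall>\<beta> \<in> \<Lambda>. \<forall>r \<in> K \<alpha> \<beta>. \<forall>m \<in> S \<alpha>. act A r m \<in> S \<beta>)"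

lemma subobj:
  assumes S: "subfamily A S"
  shows "subobj A S \<in> Obj PG" "Om (subobj A S) = Om A" "act (subobj A S) = act A"
    "\<alpha> \<in> \<Lambda> \<Longrightarrow> T (subobj A S) \<alpha> = S \<alpha>"
proof -
  have A: "A \<in> Obj PG"
    and stab: "\<And>\<alpha> \<beta> r m. \<alpha> \<in> \<Lambda> \<Longrightarrow> \<beta> \<in> \<Lambda> \<Longrightarrow> r \<in> K \<alpha> \<beta> \<Longrightarrow> m \<in> S \<alpha> \<Longrightarrow> act A r m \<in> S \<beta>"
    using S by (simp_all add: subfamily_def)
  interpret Om: comm_group "Om A" using rmodD(1)[OF rmod_Obj[OF A]] .
  have sub: "subgroup (S \<alpha>) (Om A)" if "\<alpha> \<in> \<Lambda>" for \<alpha>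
    by (rule Om.incl_subgroup[OF T_subgroup[OF A z]]) (use S that in \<open>simp add: subfamily_def Gr_def T_def\<close>)
  have st: "stable (Om A) (act A) (\<lambda>x. case x of Infty \<Rightarrow> carrier (Om A) | Pt \<alpha> \<Rightarrow> S \<alpha>)"
    by (rule stableI[OF rmod_Obj[OF A]]) (use sub stab in \<open>simp_all add: K_def\<close>)
  show "subobj A S \<in> Obj PG" unfolding subobj_def by (rule preglid_of_Obj[OF rmod_Obj[OF A] st])
  show "Om (subobj A S) = Om A" unfolding subobj_def by (rule Om_preglid_of[OF st])
  show "act (subobj A S) = act A" by (simp add: subobj_def)
  show "\<alpha> \<in> \<Lambda> \<Longrightarrow> T (subobj A S) \<alpha> = S \<alpha>"
    unfolding subobj_def T_preglid_of[OF rmod_Obj[OF A] st] by simp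
qed

lemma subobj_inclusion:
  assumes S: "subfamily A S"
  obtains k where "k \<in> homs GG (subobj A S) A" "\<And>m. m \<in> S z \<Longrightarrow> gev k m = m"
proof -
  note D = subobj[OF S]
  have A: "A \<in> Obj PG" using S by (simp add: subfamily_def)
  have "lin (subobj A S) A (\<lambda>m. m)"
    by (rule PO.op_linearI) (use A D S in \<open>auto simp: subfamily_def\<close>)
  then obtain k where "k \<in> homs GG (subobj A S) A" "\<forall>m \<in> carrier (Gr (subobj A S)). gev k m = m"
    using G.ev_ex[of "subobj A S" A "\<lambda>m. m"] A D(1) unfolding GG_simps by blast
  then show ?thesis using that D(4)[OF z] by simp
qed

lemma image_stable:
  assumes f: "f \<in> homs GG A B"
  shows "\<alpha> \<in> \<Lambda> \<Longrightarrow> subgroup (gev f ` T A \<alpha>) (Gr B)"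
    and "\<alpha> \<in> \<Lambda> \<Longrightarrow> \<beta> \<in> \<Lambda> \<Longrightarrow> r \<in> K \<alpha> \<beta> \<Longrightarrow> m \<in> gev f ` T A \<alpha> \<Longrightarrow> act B r m \<in> gev f ` T A \<beta>"
proof -
  have A: "A \<in> Obj PG" using G.homs_obj(1)[OF f] by (simp add: GG_simps)
  show "\<alpha> \<in> \<Lambda> \<Longrightarrow> subgroup (gev f ` T A \<alpha>) (Gr B)"
    by (rule group_hom.subgroup_img_is_subgroup[OF G.ev_group_hom[OF f G.homs_obj(1)[OF f] f] PO.T_sub[OF A]])
  assume r: "\<alpha> \<in> \<Lambda>" "\<beta> \<in> \<Lambda>" "r \<in> K \<alpha> \<beta>" and "m \<in> gev f ` T A \<alpha>"
  then obtain n where n: "n \<in> T A \<alpha>" "m = gev f n" by blast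
  then have "act B r m = gev f (act A r n)" using PO.op_linear_act[OF G.ev_linear[OF f] r n(1)] by simp
  then show "act B r m \<in> gev f ` T A \<beta>" using T_act[OF A r n(1)] by blast
qed

text \<open>The images of the levels are subgroups stable under the operators, so they form a
  subobject of B. Its value at \<alpha> is the image of \<open>T A \<alpha>\<close>, in general less
  than the part of \<open>T B \<alpha>\<close> hit by \<open>T A z\<close>; this is how cokernels
  come to be surjective at each level.\<close>

lemma image_ex:
  assumes f: "f \<in> homs GG A B"
  shows "\<exists>D. \<exists>j \<in> homs GG D B. inj_on (gev j) (carrier (Gr D)) \<and> (\<forall>\<alpha> \<in> \<Lambda>. gev j ` T D \<alpha> = gev f ` T A \<alpha>)"
proof -
  have O: "A \<in> Obj PG" "B \<in> Obj PG" using G.homs_obj[OF f] by (simp_all add: GG_simps)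
  define S where "S \<alpha> = gev f ` T A \<alpha>" for \<alpha>
  have st: "subfamily B S"
    using image_stable[OF f, folded S_def] G.ev_T[OF f] O(2) by (auto simp: subfamily_def S_def)
  note D = subobj[OF st]
  obtain k where k: "k \<in> homs GG (subobj B S) B" "\<And>m. m \<in> S z \<Longrightarrow> gev k m = m"
    using subobj_inclusion[OF st] by blast
  have "S \<alpha> \<subseteq> S z" if "\<alpha> \<in> \<Lambda>" for \<alpha> using T_le_z[OF O(1) that] by (auto simp: S_def)
  then have "gev k ` T (subobj B S) \<alpha> = S \<alpha>" if "\<alpha> \<in> \<Lambda>" for \<alpha>
    using k(2) D(4)[OF that] that by force
  moreover have "inj_on (gev k) (carrier (Gr (subobj B S)))" using k(2) D(4)[OF z] by (simp add: inj_on_def)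
  ultimately show ?thesis using k(1) unfolding S_def by blast
qed

text \<open>Since 1 is among the r, such an m already lies in \<open>T A z\<close>. Its other
  multiples are formed in \<open>Om A\<close> and are not determined over \<Lambda>, where only
  elements of \<open>F (z \<otimes> inv z)\<close> act on the value at the greatest point. So this
  is a property of the preglider and not of the glider.\<close>

definition saturated :: "('g, 'r, 'u) filt_mod \<Rightarrow> bool" where
  "saturated A \<longleftrightarrow> (\<forall>\<alpha> \<in> \<Lambda>. \<forall>m \<in> carrier (Om A).
     (\<forall>r \<in> F (z \<otimes>\<^bsub>\<Gamma>\<^esub> inv\<^bsub>\<Gamma>\<^esub> \<alpha>). act A r m \<in> T A z) \<longrightarrow> m \<in> T A \<alpha>)"

text \<open>Saturation passes from A to D because 1 lies in
  \<open>F (z \<otimes> inv \<alpha>)\<close>: if all multiples of m lie in the kernel at the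
  greatest point, then m is in \<open>T A \<alpha>\<close> by saturation of A, and f kills m since m
  = 1 m.\<close>

lemma kernel_obj:
  assumes f: "f \<in> homs GG A B"
  obtains D k where "D \<in> Obj PG" "k \<in> homs GG D A" "inj_on (gev k) (T D z)"
    "\<forall>\<alpha> \<in> \<Lambda>. gev k ` T D \<alpha> = {m \<in> T A \<alpha>. gev f m = \<one>\<^bsub>Gr B\<^esub>}" "saturated A \<longrightarrow> saturated D"
proof -
  have O: "A \<in> Obj PG" "B \<in> Obj PG" using G.homs_obj[OF f] by (simp_all add: GG_simps)
  interpret A: comm_group "Gr A" using PO.Gr_comm[OF O(1)] .
  interpret f: group_hom "Gr A" "Gr B" "gev f" using G.ev_group_hom[OF f G.homs_obj(1)[OF f] f] .
  define S where "S \<alpha> = {m \<in> T A \<alpha>. gev f m = \<one>\<^bsub>Gr B\<^esub>}" for \<alpha>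
  have sub: "subgroup (S \<alpha>) (Gr A)" if "\<alpha> \<in> \<Lambda>" for \<alpha>
  proof -
    have "S \<alpha> = T A \<alpha> \<inter> kernel (Gr A) (Gr B) (gev f)"
      using T_le_z[OF O(1) that] by (auto simp: S_def kernel_def)
    then show ?thesis using A.subgroups_Inter_pair[OF PO.T_sub[OF O(1) that] f.subgroup_kernel] by simp
  qed
  have stab: "act A r m \<in> S \<beta>" if "\<alpha> \<in> \<Lambda>" "\<beta> \<in> \<Lambda>" "r \<in> K \<alpha> \<beta>" "m \<in> S \<alpha>" for \<alpha> \<beta> r m
    using that(4) T_act[OF O(1) that(1-3)] PO.op_linear_act[OF G.ev_linear[OF f] that(1-3)]
      PO.act_one[OF O(2) that(1-3)] by (simp add: S_def)
  have st: "subfamily A S"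
    using O(1) sub stab unfolding subfamily_def by (auto simp: S_def)
  note D = subobj[OF st]
  obtain k where k: "k \<in> homs GG (subobj A S) A" "\<And>m. m \<in> S z \<Longrightarrow> gev k m = m"
    using subobj_inclusion[OF st] by blast
  have "S \<alpha> \<subseteq> S z" if "\<alpha> \<in> \<Lambda>" for \<alpha> using T_le_z[OF O(1) that] by (auto simp: S_def)
  then have im: "gev k ` T (subobj A S) \<alpha> = S \<alpha>" if "\<alpha> \<in> \<Lambda>" for \<alpha>
    using k(2) D(4)[OF that] that by force
  have inj: "inj_on (gev k) (T (subobj A S) z)" using k(2) D(4)[OF z] by (simp add: inj_on_def)
  have "saturated (subobj A S)" if A: "saturated A"
    unfolding saturated_def D(2,3)
  proof (intro ballI impI)
    fix \<alpha> m assume \<alpha>: "\<alpha> \<in> \<Lambda>" and m: "m \<in> carrier (Om A)"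
      and r: "\<forall>r \<in> F (z \<otimes>\<^bsub>\<Gamma>\<^esub> inv\<^bsub>\<Gamma>\<^esub> \<alpha>). act A r m \<in> T (subobj A S) z"
    have "m \<in> T A \<alpha>" using A \<alpha> m r unfolding saturated_def D(4)[OF z] S_def by blast
    moreover have "act A \<one>\<^bsub>R\<^esub> m \<in> S z" using r one_F[OF greatest[OF \<alpha>] \<alpha> z] D(4)[OF z] by blast
    ultimately show "m \<in> T (subobj A S) \<alpha>"
      using rmodD(3)[OF rmod_Obj[OF O(1)] m] D(4)[OF \<alpha>] by (simp add: S_def)
  qed
  then show ?thesis using that[OF D(1) k(1) inj] im unfolding S_def by blast
qed

definition prodobj :: "('g, 'r, 'u) filt_mod \<Rightarrow> ('g, 'r, 'u) filt_mod \<Rightarrow> ('g, 'r, 'u) filt_mod" where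
  "prodobj A B = preglid_of (prodG (Om A) (Om B)) (pact (act A) (act B)) (\<lambda>x. pair ` (sub A x \<times> sub B x))"

lemma prodobj:
  assumes A: "A \<in> Obj PG" and B: "B \<in> Obj PG"
  shows "prodobj A B \<in> Obj PG" "Om (prodobj A B) = prodG (Om A) (Om B)"
    "act (prodobj A B) = pact (act A) (act B)" "\<alpha> \<in> \<Lambda> \<Longrightarrow> T (prodobj A B) \<alpha> = pair ` (T A \<alpha> \<times> T B \<alpha>)"
proof -
  note sA = stableD[OF stable_Obj[OF A]] and sB = stableD[OF stable_Obj[OF B]]
  have st: "stable (prodG (Om A) (Om B)) (pact (act A) (act B)) (\<lambda>x. pair ` (sub A x \<times> sub B x))"
    unfolding stable_def
  proof (intro conjI ballI)
    show "pair ` (sub A Infty \<times> sub B Infty) = carrier (prodG (Om A) (Om B))"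
      by (simp add: sub_Infty A B)
    show "subgroup (pair ` (sub A x \<times> sub B x)) (prodG (Om A) (Om B))" if "x \<in> Pts" for x
      by (rule subgroup_prodG[OF rmodD(1)[OF rmod_Obj[OF A]] rmodD(1)[OF rmod_Obj[OF B]] sA(2)[OF that] sB(2)[OF that]])
    show "pact (act A) (act B) r m \<in> pair ` (sub A y \<times> sub B y)"
      if "x \<in> Pts" "y \<in> Pts" "r \<in> H x y" "m \<in> pair ` (sub A x \<times> sub B x)" for x y r m
      using that(4) sA(3)[OF that(1-3)] sB(3)[OF that(1-3)] by (auto simp: pact_def)
  qed
  show "prodobj A B \<in> Obj PG" unfolding prodobj_def by (rule preglid_of_Obj[OF rmod_prod_Obj[OF A B] st])
  show "Om (prodobj A B) = prodG (Om A) (Om B)" unfolding prodobj_def by (rule Om_preglid_of[OF st])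
  show "act (prodobj A B) = pact (act A) (act B)" by (simp add: prodobj_def)
  show "\<alpha> \<in> \<Lambda> \<Longrightarrow> T (prodobj A B) \<alpha> = pair ` (T A \<alpha> \<times> T B \<alpha>)"
    unfolding prodobj_def T_preglid_of[OF rmod_prod_Obj[OF A B] st] by (simp add: T_def)
qed

text \<open>Levels and multiples in the product are formed in coordinates, so the saturation test
  for the product splits into the tests for A and for B.\<close>

lemma product_obj:
  assumes A: "A \<in> Obj PG" and B: "B \<in> Obj PG"
  obtains P p q where "P \<in> Obj PG" "p \<in> homs GG P A" "q \<in> homs GG P B"
    "\<forall>\<alpha> \<in> \<Lambda>. bij_betw (\<lambda>m. (gev p m, gev q m)) (T P \<alpha>) (T A \<alpha> \<times> T B \<alpha>)"
    "saturated A \<longrightarrow> saturated B \<longrightarrow> saturated P"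
proof -
  note P = prodobj[OF A B]
  have "lin (prodobj A B) A pfst" "lin (prodobj A B) B psnd"
    by (rule PO.op_linearI; use A B in \<open>auto simp: P z pact_def\<close>)+
  then obtain p q where p: "p \<in> homs GG (prodobj A B) A" "\<forall>m \<in> carrier (Gr (prodobj A B)). gev p m = pfst m"
    and q: "q \<in> homs GG (prodobj A B) B" "\<forall>m \<in> carrier (Gr (prodobj A B)). gev q m = psnd m"
    using G.ev_ex[of "prodobj A B" A pfst] G.ev_ex[of "prodobj A B" B psnd] A B P(1) unfolding GG_simps by blast
  have "bij_betw (\<lambda>m. (gev p m, gev q m)) (T (prodobj A B) \<alpha>) (T A \<alpha> \<times> T B \<alpha>)" if \<alpha>: "\<alpha> \<in> \<Lambda>" for \<alpha>
  proof (rule bij_betw_byWitness[where f' = pair])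
    have eq: "gev p (pair (a, b)) = a \<and> gev q (pair (a, b)) = b" if "a \<in> T A \<alpha>" "b \<in> T B \<alpha>" for a b
    proof -
      have "pair (a, b) \<in> T (prodobj A B) z"
        using that T_le_z[OF A \<alpha>] T_le_z[OF B \<alpha>] by (auto simp: P(4)[OF z])
      then show ?thesis using p(2) q(2) by simp
    qed
    then show "\<forall>m \<in> T (prodobj A B) \<alpha>. pair (gev p m, gev q m) = m"
      "\<forall>x \<in> T A \<alpha> \<times> T B \<alpha>. (gev p (pair x), gev q (pair x)) = x"
      "(\<lambda>m. (gev p m, gev q m)) ` T (prodobj A B) \<alpha> \<subseteq> T A \<alpha> \<times> T B \<alpha>"
      "pair ` (T A \<alpha> \<times> T B \<alpha>) \<subseteq> T (prodobj A B) \<alpha>"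
      by (auto simp: P(4)[OF \<alpha>])
  qed
  moreover have "saturated (prodobj A B)" if "saturated A" "saturated B"
    unfolding saturated_def P(2,3)
  proof (intro ballI impI)
    fix \<alpha> m assume \<alpha>: "\<alpha> \<in> \<Lambda>" and m: "m \<in> carrier (prodG (Om A) (Om B))"
      and r: "\<forall>r \<in> F (z \<otimes>\<^bsub>\<Gamma>\<^esub> inv\<^bsub>\<Gamma>\<^esub> \<alpha>). pact (act A) (act B) r m \<in> T (prodobj A B) z"
    obtain a b where ab: "m = pair (a, b)" "a \<in> carrier (Om A)" "b \<in> carrier (Om B)" using m by auto
    have "\<forall>r \<in> F (z \<otimes>\<^bsub>\<Gamma>\<^esub> inv\<^bsub>\<Gamma>\<^esub> \<alpha>). act A r a \<in> T A z \<and> act B r b \<in> T B z"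
      using r by (auto simp: P(4)[OF z] pact_def ab(1))
    then have "a \<in> T A \<alpha>" "b \<in> T B \<alpha>" using that \<alpha> ab unfolding saturated_def by blast+
    then show "m \<in> T (prodobj A B) \<alpha>" by (simp add: P(4)[OF \<alpha>] ab(1))
  qed
  ultimately show ?thesis using that[OF P(1) p(1) q(1)] by blast
qed

lemma zero_obj:
  obtains Z where "Z \<in> Obj PG" "T Z z = {\<one>\<^bsub>Gr Z\<^esub>}" "saturated Z"
proof -
  \<comment> \<open>The group with one element; \<open>undefined\<close> stands for some element of
    \<open>'u\<close>.\<close>
  define G :: "'u monoid" where "G = \<lparr>carrier = {undefined}, monoid.mult = (\<lambda>_ _. undefined), one = undefined\<rparr>"
  define Z where "Z = (preglid_of G (\<lambda>_ m. m) (\<lambda>_. {undefined}) :: ('g, 'r, 'u) filt_mod)"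
  have comm: "comm_group G" by (rule comm_groupI) (simp_all add: G_def)
  have G: "rmod G (\<lambda>_ m. m)" using comm by (simp add: rmod_def hom_def G_def)
  interpret G: comm_group G by (rule comm)
  have "subgroup {undefined} G" using G.subgroup_self by (simp add: G_def)
  then have st: "stable G (\<lambda>_ m. m) (\<lambda>_. {undefined})" by (simp add: stable_def G_def)
  have T: "T Z \<alpha> = {undefined}" if "\<alpha> \<in> \<Lambda>" for \<alpha> unfolding Z_def by (rule T_preglid_of[OF G st that])
  have Om: "Om Z = G" unfolding Z_def by (rule Om_preglid_of[OF st])
  have "saturated Z" by (simp add: saturated_def Om T) (simp add: G_def)
  moreover have "T Z z = {\<one>\<^bsub>Gr Z\<^esub>}" by (simp add: T[OF z] Om) (simp add: G_def)
  moreover have "Z \<in> Obj PG" unfolding Z_def by (rule preglid_of_Obj[OF G st])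
  ultimately show ?thesis using that by blast
qed

sublocale KG: kernel_operator_group_category GG Gr \<Lambda> z T K act gev
proof
  show "\<exists>Z \<in> Obj GG. carrier (Gr Z) = {\<one>\<^bsub>Gr Z\<^esub>}"
  proof -
    obtain Z where "Z \<in> Obj PG" "T Z z = {\<one>\<^bsub>Gr Z\<^esub>}" "saturated Z" by (rule zero_obj)
    then show ?thesis by (intro bexI[of _ Z]) (simp_all add: GG_simps)
  qed
  show "\<exists>D. \<exists>k \<in> homs GG D A. inj_on (gev k) (carrier (Gr D)) \<and>
      (\<forall>i \<in> \<Lambda>. gev k ` T D i = {m \<in> T A i. gev f m = \<one>\<^bsub>Gr B\<^esub>})" if f: "f \<in> homs GG A B" for f A B
  proof -
    obtain D k where "D \<in> Obj PG" "k \<in> homs GG D A" "inj_on (gev k) (T D z)"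
      "\<forall>\<alpha> \<in> \<Lambda>. gev k ` T D \<alpha> = {m \<in> T A \<alpha>. gev f m = \<one>\<^bsub>Gr B\<^esub>}" "saturated A \<longrightarrow> saturated D"
      by (rule kernel_obj[OF f])
    then show ?thesis unfolding Gr_simps(1) by (intro exI[of _ D] bexI[of _ k] conjI)
  qed
  show "\<exists>P. \<exists>p \<in> homs GG P A. \<exists>q \<in> homs GG P B.
      \<forall>i \<in> \<Lambda>. bij_betw (\<lambda>m. (gev p m, gev q m)) (T P i) (T A i \<times> T B i)"
    if "A \<in> Obj GG" "B \<in> Obj GG" for A B
  proof -
    note O = that[unfolded GG_simps]
    obtain P p q where "P \<in> Obj PG" "p \<in> homs GG P A" "q \<in> homs GG P B"
      "\<forall>\<alpha> \<in> \<Lambda>. bij_betw (\<lambda>m. (gev p m, gev q m)) (T P \<alpha>) (T A \<alpha> \<times> T B \<alpha>)"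
      "saturated A \<longrightarrow> saturated B \<longrightarrow> saturated P"
      by (rule product_obj[OF O])
    then show ?thesis by (intro exI[of _ P] bexI[of _ p] bexI[of _ q])
  qed
qed

text \<open>The converse inclusion rests on \<open>image_ex\<close>, so it is drawn in Glid, where
  images exist without a saturation condition. The conflations of NGlid are then obtained from this
  description.\<close>

lemma kernel_cokernel_pairs_GG: "kernel_cokernel_pairs GG = {(k, p). KG.exact_pair k p}"
  using KG.exact_pair_kernel_cokernel KG.kernel_cokernel_exact_pair[OF image_ex] by auto

section \<open>Natural gliders\<close>

abbreviation NG :: "('g, 'r, 'u) filt_mod set" where "NG \<equiv> natural_gliders \<Gamma> leq R F \<Lambda> z"

lemma nat_preglid_facts:
  assumes M: "M \<in> Obj (Preglid \<Gamma> leq R F {z})"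
  defines "N \<equiv> nat_preglid \<Gamma> R F z M"
  shows "N \<in> Obj PG" "Om N = Om M" "act N = act M"
    "\<alpha> \<in> \<Lambda> \<Longrightarrow> T N \<alpha> = {m \<in> carrier (Om M). \<forall>r \<in> F (z \<otimes>\<^bsub>\<Gamma>\<^esub> inv\<^bsub>\<Gamma>\<^esub> \<alpha>). act M r m \<in> T M z}"
proof -
  show N: "N \<in> Obj PG"
    unfolding N_def by (rule nat_preglid_couniversal(1)[OF filtered_ring_axioms \<Lambda>_sub z greatest M])
  show "Om N = Om M" "act N = act M" by (simp_all add: N_def nat_preglid_def act_def fun_eq_iff)
  have one: "Fmap M (Infty, \<one>\<^bsub>R\<^esub>, Infty) m = m" if "m \<in> carrier (Om M)" for m
    using Preglid_ObjD(3)[OF M, of Infty] that by simp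
  show "\<alpha> \<in> \<Lambda> \<Longrightarrow> T N \<alpha> = {m \<in> carrier (Om M). \<forall>r \<in> F (z \<otimes>\<^bsub>\<Gamma>\<^esub> inv\<^bsub>\<Gamma>\<^esub> \<alpha>). act M r m \<in> T M z}"
    by (auto simp: N_def T_def sub_def inc_def nat_preglid_def act_def one image_iff)
qed

text \<open>1 lies in \<open>F (z \<otimes> inv z)\<close>, so the value of the natural preglider at
  the greatest point is contained in that of M. Passing the test against the former is thus passing
  it against the latter, which defines the levels.\<close>

lemma saturated_nat_preglid:
  assumes M: "M \<in> Obj (Preglid \<Gamma> leq R F {z})"
  shows "saturated (nat_preglid \<Gamma> R F z M)"
  unfolding saturated_def
proof (intro ballI impI)
  note N = nat_preglid_facts[OF M]
  fix \<alpha> m assume \<alpha>: "\<alpha> \<in> \<Lambda>" and m: "m \<in> carrier (Om (nat_preglid \<Gamma> R F z M))"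
    and r: "\<forall>r \<in> F (z \<otimes>\<^bsub>\<Gamma>\<^esub> inv\<^bsub>\<Gamma>\<^esub> \<alpha>). act (nat_preglid \<Gamma> R F z M) r m \<in> T (nat_preglid \<Gamma> R F z M) z"
  have one: "act M \<one>\<^bsub>R\<^esub> x = x" if "x \<in> carrier (Om M)" for x
    using Preglid_ObjD(3)[OF M, of Infty] that by (simp add: act_def)
  have "act M s m \<in> T M z" if s: "s \<in> F (z \<otimes>\<^bsub>\<Gamma>\<^esub> inv\<^bsub>\<Gamma>\<^esub> \<alpha>)" for s
  proof -
    have "act M s m \<in> carrier (Om M)" "act M \<one>\<^bsub>R\<^esub> (act M s m) \<in> T M z"
      using r s one_F[OF greatest[OF z] z z] unfolding N(3) N(4)[OF z] by blast+
    then show ?thesis using one by simp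
  qed
  then show "m \<in> T (nat_preglid \<Gamma> R F z M) \<alpha>" using m unfolding N(2) N(4)[OF \<alpha>] by blast
qed

text \<open>The localization functor preserves isomorphisms; here this is read off from the maps at
  infinity, which restrict to bijections on each level.\<close>

lemma isomorphic_PG_GG:
  assumes "isomorphic PG A B" shows "isomorphic GG A B"
proof -
  obtain f where f: "f \<in> homs PG A B" "iso_arr PG f" using assms by (auto simp: isomorphic_def)
  then obtain g where g: "g \<in> homs PG B A" "g \<bullet>\<^bsub>PG\<^esub> f = Ident PG A" "f \<bullet>\<^bsub>PG\<^esub> g = Ident PG B"
    by (auto simp: iso_arr_def homs_def)
  note O = PG_obj[OF f(1)]
  have gf: "hinf g (hinf f m) = m" if "m \<in> carrier (Om A)" for m
    using hinf_cmp[OF f(1) g(1) that] g(2) hinf_ident[OF O(1) that] by simp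
  have fg: "hinf f (hinf g m) = m" if "m \<in> carrier (Om B)" for m
    using hinf_cmp[OF g(1) f(1) that] g(3) hinf_ident[OF O(2) that] by simp
  show ?thesis
  proof (rule G.isomorphicI[unfolded GG_simps, OF O hinf_lin[OF f(1)]])
    show "inj_on (hinf f) (T A z)" by (rule inj_on_inverseI[where g = "hinf g"]) (use gf T_Om[OF O(1) z] in blast)
    fix \<alpha> assume \<alpha>: "\<alpha> \<in> \<Lambda>"
    show "hinf f ` T A \<alpha> = T B \<alpha>"
    proof
      show "hinf f ` T A \<alpha> \<subseteq> T B \<alpha>" using PO.op_linear_T[OF hinf_lin[OF f(1)] \<alpha>] by blast
      show "T B \<alpha> \<subseteq> hinf f ` T A \<alpha>"
      proof
        fix m assume m: "m \<in> T B \<alpha>"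
        then have "hinf g m \<in> T A \<alpha>" using PO.op_linear_T[OF hinf_lin[OF g(1)] \<alpha>] by blast
        moreover have "m = hinf f (hinf g m)" using fg[OF T_Om[OF O(2) \<alpha> m]] by simp
        ultimately show "m \<in> hinf f ` T A \<alpha>" by blast
      qed
    qed
  qed
qed

text \<open>\<open>n\<^sub>*\<close> produces saturated pregliders. Conversely, for saturated A the
  same record, read over the greatest point and infinity only, is sent by \<open>n\<^sub>*\<close>
  to a preglider with the levels of A: saturation gives one inclusion, and the other holds because
  \<open>F (z \<otimes> inv \<alpha>)\<close> maps \<open>T A \<alpha>\<close> into
  \<open>T A z\<close>.\<close>

lemma natural_iff: "N \<in> NG \<longleftrightarrow> (\<exists>A \<in> Obj PG. saturated A \<and> isomorphic GG A N)"
proof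
  assume "N \<in> NG"
  then obtain M where M: "M \<in> natural_pregliders \<Gamma> leq R F \<Lambda> z" "isomorphic GG N M"
    by (auto simp: natural_gliders_def)
  then obtain Q where Q: "Q \<in> Obj (Preglid \<Gamma> leq R F {z})" "isomorphic PG M (nat_preglid \<Gamma> R F z Q)"
    by (auto simp: natural_pregliders_def)
  have "isomorphic GG (nat_preglid \<Gamma> R F z Q) N"
    using G.isomorphic_sym[OF G.isomorphic_trans[OF M(2) isomorphic_PG_GG[OF Q(2)]]] .
  then show "\<exists>A \<in> Obj PG. saturated A \<and> isomorphic GG A N"
    using nat_preglid_facts(1)[OF Q(1)] saturated_nat_preglid[OF Q(1)] by blast
next
  assume "\<exists>A \<in> Obj PG. saturated A \<and> isomorphic GG A N"
  then obtain A where A: "A \<in> Obj PG" "saturated A" "isomorphic GG A N" by blast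
  define M where "M = nat_preglid \<Gamma> R F z A"
  have A': "A \<in> Obj (Preglid \<Gamma> leq R F {z})" using A(1) Obj_Preglid_subset[of "{z}" \<Lambda>] z by blast
  note M = nat_preglid_facts[OF A', folded M_def]
  have T: "T M \<alpha> = T A \<alpha>" if \<alpha>: "\<alpha> \<in> \<Lambda>" for \<alpha>
  proof
    show "T M \<alpha> \<subseteq> T A \<alpha>" unfolding M(4)[OF \<alpha>] using A(2) \<alpha> unfolding saturated_def by blast
    have "F (z \<otimes>\<^bsub>\<Gamma>\<^esub> inv\<^bsub>\<Gamma>\<^esub> \<alpha>) = K \<alpha> z" using greatest[OF \<alpha>] by (simp add: K_def)
    then show "T A \<alpha> \<subseteq> T M \<alpha>" unfolding M(4)[OF \<alpha>] using T_act[OF A(1) \<alpha> z] T_Om[OF A(1) \<alpha>] by blast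
  qed
  have "lin A M (\<lambda>m. m)" by (rule PO.op_linearI) (use A(1) M T in auto)
  then have AM: "isomorphic GG A M"
    using G.isomorphicI[of A M "\<lambda>m. m"] A(1) M(1) T by (simp add: GG_simps)
  have "iso_arr PG (Ident PG M)"
    unfolding iso_arr_def using PG_ident[OF M(1)] PG.cmp_ident_left[OF PG_ident[OF M(1)]]
    by (intro conjI bexI[of _ "Ident PG M"]) (simp_all add: homs_def)
  then have "isomorphic PG M M" unfolding isomorphic_def using PG_ident[OF M(1)] by blast
  then have "M \<in> natural_pregliders \<Gamma> leq R F \<Lambda> z"
    unfolding natural_pregliders_def using M(1) A' by (auto simp: M_def)
  moreover have "isomorphic GG N M" using G.isomorphic_trans[OF G.isomorphic_sym[OF A(3)] AM] .
  moreover have "N \<in> Obj GG" using A(3) G.homs_obj(2) by (auto simp: isomorphic_def)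
  ultimately show "N \<in> NG" unfolding natural_gliders_def by blast
qed

lemma natural_self:
  assumes "A \<in> Obj PG" "saturated A" shows "A \<in> NG"
proof -
  have "isomorphic GG A A"
    using G.isomorphicI[of A A "\<lambda>m. m"] PO.op_linear_id[OF assms(1)] assms(1) by (simp add: GG_simps)
  then show ?thesis using natural_iff assms by blast
qed

lemma naturalE:
  assumes "N \<in> NG"
  obtains A \<theta> where "A \<in> Obj PG" "saturated A" "\<theta> \<in> homs GG A N" "inj_on (gev \<theta>) (T A z)"
    "\<forall>\<alpha> \<in> \<Lambda>. gev \<theta> ` T A \<alpha> = T N \<alpha>"
proof -
  obtain A where A: "A \<in> Obj PG" "saturated A" "isomorphic GG A N" using assms natural_iff by blast
  then obtain \<theta> where \<theta>: "\<theta> \<in> homs GG A N" "iso_arr GG \<theta>" by (auto simp: isomorphic_def)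
  then show ?thesis using that[OF A(1,2) \<theta>(1)] G.iso_arr_iff[OF \<theta>(1)] by simp
qed

section \<open>The exact structure on natural gliders\<close>

abbreviation NGG :: "(('g, 'r, 'u) filt_mod, ('g, 'r, 'u) glid_arr) category" where
  "NGG \<equiv> NGlid \<Gamma> leq R F \<Lambda> z"

lemma NGG_homs: "homs NGG A B = (if A \<in> NG \<and> B \<in> NG then homs GG A B else {})"
  unfolding NGlid_def by (rule G.homs_full_subcategory)

lemma NGG_Obj: "Obj NGG = NG"
  by (auto simp: NGlid_def full_subcategory_def natural_gliders_def)

text \<open>A natural glider need not be saturated itself. Kernels and products are formed for
  saturated representatives, where they are saturated and hence natural, and are then composed with
  the isomorphisms to the given objects.\<close>

sublocale KN: kernel_operator_group_category NGG Gr \<Lambda> z T K act gev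
proof (intro kernel_operator_group_category.intro kernel_operator_group_category_axioms.intro)
  show "operator_group_category NGG Gr \<Lambda> z T K act gev"
    unfolding NGlid_def by (rule G.operator_group_category_full_subcategory)
  show "\<exists>Z \<in> Obj NGG. carrier (Gr Z) = {\<one>\<^bsub>Gr Z\<^esub>}"
  proof -
    obtain Z where Z: "Z \<in> Obj PG" "T Z z = {\<one>\<^bsub>Gr Z\<^esub>}" "saturated Z" by (rule zero_obj)
    show ?thesis by (intro bexI[of _ Z]) (use Z natural_self in \<open>simp_all add: NGG_Obj\<close>)
  qed
  show "\<exists>D. \<exists>k \<in> homs NGG D A. inj_on (gev k) (carrier (Gr D)) \<and>
      (\<forall>i \<in> \<Lambda>. gev k ` T D i = {m \<in> T A i. gev f m = \<one>\<^bsub>Gr B\<^esub>})" if "f \<in> homs NGG A B" for f A B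
  proof -
    have N: "A \<in> NG" "B \<in> NG" and f: "f \<in> homs GG A B" using that by (auto simp: NGG_homs split: if_splits)
    obtain A' \<theta> where A': "A' \<in> Obj PG" "saturated A'" "\<theta> \<in> homs GG A' A" "inj_on (gev \<theta>) (T A' z)"
      and im: "\<forall>\<alpha> \<in> \<Lambda>. gev \<theta> ` T A' \<alpha> = T A \<alpha>"
      by (rule naturalE[OF N(1)])
    \<comment> \<open>Precomposing f with \<theta> replaces its source by the saturated
      \<open>A'\<close>, which makes the kernel saturated.\<close>
    obtain D j where D: "D \<in> Obj PG" "j \<in> homs GG D A'" "inj_on (gev j) (T D z)"
      and jm: "\<forall>\<alpha> \<in> \<Lambda>. gev j ` T D \<alpha> = {m \<in> T A' \<alpha>. gev (f \<bullet>\<^bsub>GG\<^esub> \<theta>) m = \<one>\<^bsub>Gr B\<^esub>}"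
      and sat: "saturated A' \<longrightarrow> saturated D"
      by (rule kernel_obj[OF G.cmp_hom[OF A'(3) f]])
    have D_NG: "D \<in> NG" using natural_self[OF D(1)] sat A'(2) by blast
    have ev: "gev (\<theta> \<bullet>\<^bsub>GG\<^esub> j) m = gev \<theta> (gev j m)" if "m \<in> T D z" for m
      using G.ev_cmp[OF D(2) A'(3)] that by simp
    have jz: "gev j m \<in> T A' z" if "m \<in> T D z" for m using G.ev_T[OF D(2) z that] .
    have "inj_on (gev (\<theta> \<bullet>\<^bsub>GG\<^esub> j)) (T D z)"
      using D(3) A'(4) jz by (auto simp: inj_on_def ev)
    moreover have "gev (\<theta> \<bullet>\<^bsub>GG\<^esub> j) ` T D \<alpha> = {m \<in> T A \<alpha>. gev f m = \<one>\<^bsub>Gr B\<^esub>}" if \<alpha>: "\<alpha> \<in> \<Lambda>" for \<alpha>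
    proof -
      have "gev (\<theta> \<bullet>\<^bsub>GG\<^esub> j) ` T D \<alpha> = gev \<theta> ` gev j ` T D \<alpha>"
        unfolding image_image by (rule image_cong) (use ev T_le_z[OF D(1) \<alpha>] in auto)
      also have "\<dots> = gev \<theta> ` {m \<in> T A' \<alpha>. gev f (gev \<theta> m) = \<one>\<^bsub>Gr B\<^esub>}"
      proof -
        have "gev (f \<bullet>\<^bsub>GG\<^esub> \<theta>) m = gev f (gev \<theta> m)" if "m \<in> T A' \<alpha>" for m
          using G.ev_cmp[OF A'(3) f] that T_le_z[OF A'(1) \<alpha>] by auto
        then show ?thesis using jm \<alpha> by (auto intro!: arg_cong[where f = "(`) (gev \<theta>)"])
      qed
      also have "\<dots> = {m \<in> T A \<alpha>. gev f m = \<one>\<^bsub>Gr B\<^esub>}" unfolding im[rule_format, OF \<alpha>, symmetric] by blast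
      finally show ?thesis .
    qed
    moreover have "\<theta> \<bullet>\<^bsub>GG\<^esub> j \<in> homs NGG D A" using G.cmp_hom[OF D(2) A'(3)] D_NG N by (simp add: NGG_homs)
    ultimately show ?thesis unfolding Gr_simps(1) by blast
  qed
  show "\<exists>P. \<exists>p \<in> homs NGG P A. \<exists>q \<in> homs NGG P B.
      \<forall>i \<in> \<Lambda>. bij_betw (\<lambda>m. (gev p m, gev q m)) (T P i) (T A i \<times> T B i)"
    if "A \<in> Obj NGG" "B \<in> Obj NGG" for A B
  proof -
    have N: "A \<in> NG" "B \<in> NG" using that by (simp_all add: NGG_Obj)
    obtain A' \<theta> where A': "A' \<in> Obj PG" "saturated A'" "\<theta> \<in> homs GG A' A" "inj_on (gev \<theta>) (T A' z)"
      and imA: "\<forall>\<alpha> \<in> \<Lambda>. gev \<theta> ` T A' \<alpha> = T A \<alpha>"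
      by (rule naturalE[OF N(1)])
    obtain B' \<eta> where B': "B' \<in> Obj PG" "saturated B'" "\<eta> \<in> homs GG B' B" "inj_on (gev \<eta>) (T B' z)"
      and imB: "\<forall>\<alpha> \<in> \<Lambda>. gev \<eta> ` T B' \<alpha> = T B \<alpha>"
      by (rule naturalE[OF N(2)])
    obtain P p q where P: "P \<in> Obj PG" "p \<in> homs GG P A'" "q \<in> homs GG P B'"
      and bij: "\<forall>\<alpha> \<in> \<Lambda>. bij_betw (\<lambda>m. (gev p m, gev q m)) (T P \<alpha>) (T A' \<alpha> \<times> T B' \<alpha>)"
      and sat: "saturated A' \<longrightarrow> saturated B' \<longrightarrow> saturated P"
      by (rule product_obj[OF A'(1) B'(1)])
    have P_NG: "P \<in> NG" using natural_self[OF P(1)] sat A'(2) B'(2) by blast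
    have "bij_betw (\<lambda>m. (gev (\<theta> \<bullet>\<^bsub>GG\<^esub> p) m, gev (\<eta> \<bullet>\<^bsub>GG\<^esub> q) m)) (T P \<alpha>) (T A \<alpha> \<times> T B \<alpha>)"
      if \<alpha>: "\<alpha> \<in> \<Lambda>" for \<alpha>
    proof -
      have "bij_betw (gev \<theta>) (T A' \<alpha>) (T A \<alpha>)" "bij_betw (gev \<eta>) (T B' \<alpha>) (T B \<alpha>)"
        using inj_on_subset[OF A'(4) T_le_z[OF A'(1) \<alpha>]] inj_on_subset[OF B'(4) T_le_z[OF B'(1) \<alpha>]]
          imA[rule_format, OF \<alpha>] imB[rule_format, OF \<alpha>] by (simp_all add: bij_betw_def)
      then have "bij_betw (map_prod (gev \<theta>) (gev \<eta>)) (T A' \<alpha> \<times> T B' \<alpha>) (T A \<alpha> \<times> T B \<alpha>)"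
        by (rule bij_betw_map_prod)
      from bij_betw_trans[OF bij[rule_format, OF \<alpha>] this]
      have "bij_betw (map_prod (gev \<theta>) (gev \<eta>) \<circ> (\<lambda>m. (gev p m, gev q m))) (T P \<alpha>) (T A \<alpha> \<times> T B \<alpha>)" .
      moreover have "(gev (\<theta> \<bullet>\<^bsub>GG\<^esub> p) m, gev (\<eta> \<bullet>\<^bsub>GG\<^esub> q) m)
          = (map_prod (gev \<theta>) (gev \<eta>) \<circ> (\<lambda>m. (gev p m, gev q m))) m" if "m \<in> T P \<alpha>" for m
        using G.ev_cmp[OF P(2) A'(3)] G.ev_cmp[OF P(3) B'(3)] that T_le_z[OF P(1) \<alpha>] by auto
      ultimately show ?thesis by (subst bij_betw_cong) auto
    qed
    moreover have "\<theta> \<bullet>\<^bsub>GG\<^esub> p \<in> homs NGG P A" "\<eta> \<bullet>\<^bsub>GG\<^esub> q \<in> homs NGG P B"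
      using G.cmp_hom[OF P(2) A'(3)] G.cmp_hom[OF P(3) B'(3)] P_NG N by (simp_all add: NGG_homs)
    ultimately show ?thesis by blast
  qed
qed

text \<open>Exactness of a pair is the same formula in both categories, which share levels,
  evaluation, domains and codomains. Only membership of the two arrows differs, and that is what the
  induced structure adds.\<close>

lemma nglid_conflations_eq: "nglid_conflations \<Gamma> leq R F \<Lambda> z = {(k, p). KN.exact_pair k p}"
proof -
  have [simp]: "Dom NGG = Dom GG" "Cod NGG = Cod GG" and arr: "f \<in> Arr NGG \<Longrightarrow> f \<in> Arr GG" for f
    by (auto simp: NGlid_def full_subcategory_def)
  show ?thesis
    unfolding nglid_conflations_def glid_conflations_def kernel_cokernel_pairs_GG
      KG.exact_pair_def KN.exact_pair_def by (auto intro: arr)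
qed

end

theorem corollary7p14:
  fixes \<Gamma> :: "('g, 'a) monoid_scheme" and leq :: "('g \<times> 'g) set"
    and R :: "('r, 'b) ring_scheme" and F :: "'g \<Rightarrow> 'r set"
    and \<Lambda> :: "'g set" and z :: 'g
  assumes "filtered_ring \<Gamma> leq R F"
    and "\<Lambda> \<subseteq> carrier \<Gamma>"
    and "z \<in> \<Lambda>" and "\<And>\<alpha>. \<alpha> \<in> \<Lambda> \<Longrightarrow> (\<alpha>, z) \<in> leq"
    and "infinite (UNIV :: 'u set)"
  shows "deflation_exact_category
    (NGlid \<Gamma> leq R F \<Lambda> z :: (('g, 'r, 'u) filt_mod, ('g, 'r, 'u) glid_arr) category)
    (nglid_conflations \<Gamma> leq R F \<Lambda> z)"
proof -
  \<comment> \<open>An infinite set is equipotent with its square, which supplies the coding of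
    pairs.\<close>
  obtain pair :: "'u \<times> 'u \<Rightarrow> 'u" where "bij_betw pair (UNIV \<times> UNIV) UNIV"
    using card_of_Times_same_infinite[OF assms(5)] card_of_ordIso[of "UNIV \<times> UNIV :: ('u \<times> 'u) set" "UNIV :: 'u set"]
    by blast
  then have "inj pair" by (simp add: bij_betw_def)
  then interpret glider_setup \<Gamma> leq R F \<Lambda> z pair
    using assms(1-4) by (intro glider_setup.intro glider_setup_axioms.intro)
  show ?thesis unfolding nglid_conflations_eq by (rule KN.deflation_exact)
qed

end
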